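(* Let $\kappa\ge4$ be an integer, let $\mu$ be an integer with $\mu+2\not\equiv\pm1\pmod\kappa$, and let $\eta\in\mathbb{C}$ with $\mathrm{Im}(\eta)<0$. Then the elliptic Macdonald polynomial satisfies $$P_{\mu,\kappa}(4\eta;-8\eta,\eta)=-2\pi\, e^{-12\pi i\eta-2\pi i(\mu+2)\eta}\,\frac{\Gamma(-6\eta;-2\kappa\eta,-8\eta)}{\Gamma(-2\eta;-2\kappa\eta,-8\eta)}\,\frac{\theta_0(2(\mu+2)\eta;-2\kappa\eta)\,(-2\kappa\eta;-2\kappa\eta)^2}{(-8\eta;-8\eta)\,(-4\eta;-4\eta)^2\,(-2\eta;-2\eta)}.$$
   Context: Additive notation is used. For $\mathrm{Im}(\tau),\mathrm{Im}(\sigma)>0$: $(z;\tau):=\prod_{n\ge 0}(1-e^{2\pi i z+2\pi i\tau n})$; $\theta_0(z;\tau):=(z;\tau)(\tau-z;\tau)$; $\theta(z;\tau):=i e^{\pi i\tau/4-\pi i z}(\tau;\tau)\theta_0(z;\tau)$ (with $\theta'$ the derivative in $z$); and $\Gamma(z;\tau,\sigma):=\prod_{n,m\ge0}\frac{1-e^{2\pi i(\tau+\sigma-z+n\tau+m\sigma)}}{1-e^{2\pi i (z+n\tau+m\sigma)}}$. For an integer $\kappa\ge4$, an integer $\mu\not\equiv\pm1\pmod\kappa$, $\mathrm{Im}(\tau)>0$ and $\mathrm{Im}(\eta)<0$ with $j\tau+4\eta\notin\mathbb{Z}$ for all positive integers $j$, define the non-symmetric hypergeometric theta function $$\widetilde{\Delta}_{\mu,\kappa}(\lambda;\tau,\eta)=e^{\frac{2\pi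 i\eta}{\kappa}\mu^2}\,Q(2\eta\mu;-2\eta\kappa,\eta)\,\widetilde{I}_{\mu,\kappa}(\lambda;\tau,\eta),\qquad Q(\mu;\sigma,\eta):=\frac{\theta(4\eta;\sigma)\,\theta'(0;\sigma)}{\theta(\mu-2\eta;\sigma)\,\theta(\mu+2\eta;\sigma)},$$ $$\widetilde{I}_{\mu,\kappa}(\lambda;\tau,\eta):=e^{\pi i\tau\frac{\mu^2}{2\kappa}-\pi i\lambda\mu}(2\kappa\tau;2\kappa\tau)\int_\gamma\frac{\Gamma(t+2\eta;\tau,-2\eta\kappa)}{\Gamma(t-2\eta;\tau,-2\eta\kappa)}\frac{\theta(t+\lambda;\tau)}{\theta(t-2\eta;\tau)}\frac{\theta(t+2\eta\mu;-2\eta\kappa)}{\theta(t-2\eta;-2\eta\kappa)}\,\theta_0(\tfrac12+\mu\tau+\kappa\tau-\kappa\lambda+2t;2\kappa\tau)\,dt.$$ Here the cycle $\gamma$ travels from $-\tfrac12$ to $\tfrac12$, lies above the pole at $t=-2\eta$ and below the pole at $t=2\eta$, and separates all other poles: the poles $-2\eta-j\tau+2\kappa k\eta+\mathbb{Z}$ ($j,k\ge0$) lie below $\gamma$ and the poles $2\eta+j\tau-2\kappa k\eta+\mathbb{Z}$ ($j,k\ge 0$) lie above $\gamma$. Put $\Delta_{\mu,\kappa}(\lambda;\tau,\eta):=\widetilde{\Delta}_{\mu,\kappa}(\lambda;\tau,\eta)-\widetilde{\Delta}_{\mu,\kappa}(-\lambda;\tau,\eta)$. The elliptic Macdonald polynomial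 (for $t=q^2$) is, for $\mu+2\not\equiv\pm1\pmod\kappa$, $$P_{\mu,\kappa}(\lambda;\tau,\eta):=e^{-\pi i\frac{4\eta+\tau}{2\kappa}(\mu+2)^2+\frac{3\pi i\tau}{4}}\,\frac{\Delta_{\mu+2,\kappa}(\lambda;\tau,\eta)}{\theta(\lambda-2\eta;\tau)\,\theta(\lambda;\tau)\,\theta(\lambda+2\eta;\tau)}.$$ The claim evaluates this at $\lambda=4\eta$, $\tau=-8\eta$. *)

theory Defs
  imports "HOL-Complex_Analysis.Complex_Analysis" "HOL-Number_Theory.Cong"
begin

text \<open>Additive notation: \<open>\<tau>\<close> and \<open>\<sigma>\<close> are points of the upper half plane.\<close>

definition qpoch :: "complex \<Rightarrow> complex \<Rightarrow> complex" where
  "qpoch z \<tau> = (\<Prod>n. 1 - exp (2 * of_real pi * \<i> * z + 2 * of_real pi * \<i> * \<tau> * of_nat n))"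

definition theta0 :: "complex \<Rightarrow> complex \<Rightarrow> complex" where
  "theta0 z \<tau> = qpoch z \<tau> * qpoch (\<tau> - z) \<tau>"

definition theta :: "complex \<Rightarrow> complex \<Rightarrow> complex" where
  "theta z \<tau> = \<i> * exp (of_real pi * \<i> * \<tau> / 4 - of_real pi * \<i> * z) * qpoch \<tau> \<tau> * theta0 z \<tau>"

text \<open>The double product converges absolutely, so taking it as an iterated product is harmless.
  At a pole some factor is \<open>x / 0 = 0\<close>, so \<open>ell_Gamma\<close> takes the value 0 there.\<close>

definition ell_Gamma :: "complex \<Rightarrow> complex \<Rightarrow> complex \<Rightarrow> complex" where
  "ell_Gamma z \<tau> \<sigma> =
     (\<Prod>n. \<Prod>m.
        (1 - exp (2 * of_real pi * \<i> * (\<tau> + \<sigma> - z + of_nat n * \<tau> + of_nat m * \<sigma>))) /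
        (1 - exp (2 * of_real pi * \<i> * (z + of_nat n * \<tau> + of_nat m * \<sigma>))))"

definition Qfac :: "complex \<Rightarrow> complex \<Rightarrow> complex \<Rightarrow> complex" where
  "Qfac u \<sigma> \<eta> =
     theta (4 * \<eta>) \<sigma> * deriv (\<lambda>z. theta z \<sigma>) 0 /
     (theta (u - 2 * \<eta>) \<sigma> * theta (u + 2 * \<eta>) \<sigma>)"

text \<open>A path from \<open>-1/2\<close> to \<open>1/2\<close> is a cycle in the cylinder of complex numbers modulo 1.
  Its preimage in the plane, the union of the integer translates of the path, separates
  the two ends \<open>Im z \<rightarrow> \<infinity>\<close> and \<open>Im z \<rightarrow> -\<infinity>\<close>; a point lies above (below) the cycle if it can
  be joined to the upper (lower) end without meeting this preimage. Since the preimage has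
  bounded imaginary part, reaching the end is the same as the component having
  imaginary part unbounded above (below).\<close>

definition translates :: "(real \<Rightarrow> complex) \<Rightarrow> complex set" where
  "translates \<gamma> = {z + of_int n | z n. z \<in> path_image \<gamma>}"

definition lies_above :: "complex \<Rightarrow> (real \<Rightarrow> complex) \<Rightarrow> bool" where
  "lies_above p \<gamma> \<longleftrightarrow> (\<forall>y. \<exists>z. connected_component (- translates \<gamma>) p z \<and> Im z > y)"

definition lies_below :: "complex \<Rightarrow> (real \<Rightarrow> complex) \<Rightarrow> bool" where
  "lies_below p \<gamma> \<longleftrightarrow> (\<forall>y. \<exists>z. connected_component (- translates \<gamma>) p z \<and> Im z < y)"

text \<open>The case \<open>j = k = 0\<close> is the requirement that the cycle passes above \<open>-2 * \<eta>\<close> and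
  below \<open>2 * \<eta>\<close>. As \<open>Im \<eta> < 0\<close>, the first of these points lies in the upper half plane and the
  second one in the lower half plane, so the segment from \<open>-1/2\<close> to \<open>1/2\<close> is not such a cycle.\<close>

definition theta_cycle :: "int \<Rightarrow> complex \<Rightarrow> complex \<Rightarrow> (real \<Rightarrow> complex) \<Rightarrow> bool" where
  "theta_cycle \<kappa> \<tau> \<eta> \<gamma> \<longleftrightarrow>
     valid_path \<gamma> \<and> pathstart \<gamma> = -1/2 \<and> pathfinish \<gamma> = 1/2 \<and>
     (\<forall>(j::nat) (k::nat) (n::int).
        lies_below (- 2 * \<eta> - of_nat j * \<tau> + 2 * of_int \<kappa> * of_nat k * \<eta> + of_int n) \<gamma> \<and>
        lies_above (2 * \<eta> + of_nat j * \<tau> - 2 * of_int \<kappa> * of_nat k * \<eta> + of_int n) \<gamma>)"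

text \<open>At a removable singularity the formula below yields 0 because of \<open>x / 0 = 0\<close>; these points
  are isolated, so this does not affect the contour integral.\<close>

definition theta_integrand ::
  "int \<Rightarrow> int \<Rightarrow> complex \<Rightarrow> complex \<Rightarrow> complex \<Rightarrow> complex \<Rightarrow> complex" where
  "theta_integrand \<mu> \<kappa> l \<tau> \<eta> t =
     ell_Gamma (t + 2 * \<eta>) \<tau> (- 2 * \<eta> * of_int \<kappa>) / ell_Gamma (t - 2 * \<eta>) \<tau> (- 2 * \<eta> * of_int \<kappa>) *
     (theta (t + l) \<tau> / theta (t - 2 * \<eta>) \<tau>) *
     (theta (t + 2 * \<eta> * of_int \<mu>) (- 2 * \<eta> * of_int \<kappa>) / theta (t - 2 * \<eta>) (- 2 * \<eta> * of_int \<kappa>)) *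
     theta0 (1/2 + of_int \<mu> * \<tau> + of_int \<kappa> * \<tau> - of_int \<kappa> * l + 2 * t) (2 * of_int \<kappa> * \<tau>)"

text \<open>The integrand has period 1 in \<open>t\<close> and no poles other than those in \<open>theta_cycle\<close>, so by
  Cauchy's theorem the integral does not depend on which admissible cycle is chosen.\<close>

definition I_tilde :: "int \<Rightarrow> int \<Rightarrow> complex \<Rightarrow> complex \<Rightarrow> complex \<Rightarrow> complex" where
  "I_tilde \<mu> \<kappa> l \<tau> \<eta> =
     exp (of_real pi * \<i> * \<tau> * (of_int \<mu> ^ 2 / (2 * of_int \<kappa>)) - of_real pi * \<i> * l * of_int \<mu>) *
     qpoch (2 * of_int \<kappa> * \<tau>) (2 * of_int \<kappa> * \<tau>) *
     contour_integral (SOME \<gamma>. theta_cycle \<kappa> \<tau> \<eta> \<gamma>) (theta_integrand \<mu> \<kappa> l \<tau> \<eta>)"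

definition Delta_tilde :: "int \<Rightarrow> int \<Rightarrow> complex \<Rightarrow> complex \<Rightarrow> complex \<Rightarrow> complex" where
  "Delta_tilde \<mu> \<kappa> l \<tau> \<eta> =
     exp (2 * of_real pi * \<i> * \<eta> / of_int \<kappa> * of_int \<mu> ^ 2) *
     Qfac (2 * \<eta> * of_int \<mu>) (- 2 * \<eta> * of_int \<kappa>) \<eta> *
     I_tilde \<mu> \<kappa> l \<tau> \<eta>"

definition Delta :: "int \<Rightarrow> int \<Rightarrow> complex \<Rightarrow> complex \<Rightarrow> complex \<Rightarrow> complex" where
  "Delta \<mu> \<kappa> l \<tau> \<eta> = Delta_tilde \<mu> \<kappa> l \<tau> \<eta> - Delta_tilde \<mu> \<kappa> (- l) \<tau> \<eta>"

definition ell_Macdonald :: "int \<Rightarrow> int \<Rightarrow> complex \<Rightarrow> complex \<Rightarrow> complex \<Rightarrow> complex" where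
  "ell_Macdonald \<mu> \<kappa> l \<tau> \<eta> =
     exp (- of_real pi * \<i> * ((4 * \<eta> + \<tau>) / (2 * of_int \<kappa>)) * of_int (\<mu> + 2) ^ 2
          + 3 * of_real pi * \<i> * \<tau> / 4) *
     (Delta (\<mu> + 2) \<kappa> l \<tau> \<eta> / (theta (l - 2 * \<eta>) \<tau> * theta l \<tau> * theta (l + 2 * \<eta>) \<tau>))"

end

theory Submission
  imports Defs
begin

text \<open>At \<open>\<tau> = -8\<eta>\<close>, \<open>\<lambda> = 4\<eta>\<close>, put \<open>h = -2\<eta>\<close>, \<open>s = \<kappa>h\<close>, \<open>u = (\<mu>+2)h\<close>. The two integrands of the antisymmetrisation
  have a common even factor \<open>g\<close> built from elliptic Gamma functions, and a dissection of theta functions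
  combines the remaining factors to a single theta function \<open>b\<^sub>u(t)\<close>. Modulo odd functions of \<open>t\<close>, \<open>b\<^sub>u\<close> lies in
  the two-dimensional space of even theta functions of degree two, so it is a combination of \<open>b\<^sub>h\<close> and
  \<open>b\<^bsub>1/2\<^esub>\<close>. The integral of \<open>g b\<^sub>h\<close> vanishes because the integrand is odd about \<open>-2h\<close>, and that of
  \<open>g b\<^bsub>1/2\<^esub>\<close> is an elliptic beta integral \<open>J(a, b)\<close> with \<open>a + b = s + 3h + 1/2\<close>. A contiguous relation shows that
  the quotient of \<open>J(a, b)\<close> by the expected product of Gamma functions is holomorphic in \<open>a\<close> with periods \<open>1\<close>
  and \<open>4h\<close>, hence constant; the constant is found in the limit \<open>a \<rightarrow> h\<close>, where two poles pinch the cycle.\<close>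

section \<open>Infinite products\<close>

text \<open>The point \<lambda> = 4\<eta>, \<tau> = -8\<eta> is special because \<lambda> =
  -\<tau>/2: the factors \<open>theta (t + \<lambda>) \<tau>\<close> and
  \<open>theta (t - \<lambda>) \<tau>\<close> then differ by a quasi-period, hence by an exponential
  and a sign, which is what gives the two integrands a common factor. \<open>J a b\<close> is
  Spiridonov's elliptic beta integral with periods 4h, 2s and the six parameters -h, a, b, 0, 2h +
  1/2, s. The last three are half-periods: by the duplication formula their Gamma functions cancel
  most of 1/(\<Gamma>(2z) \<Gamma>(-2z)) and leave only theta functions. The value of a + b is the
  balancing condition, that the parameters add up to 4h + 2s modulo 1. A cycle is constrained only
  by the sides on which the poles lie, and h and -h lie on the opposite sides of the real line.
  Every cycle integral is therefore moved to the real period at the cost of two explicit residues.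
  The comparison takes place in the plane of x = exp(2 \<pi> i t), where a cycle becomes a loop and
  its position is encoded in winding numbers.\<close>

lemma summable_imp_convergent_prod_complex:
  fixes f :: "nat \<Rightarrow> complex"
  assumes "summable (\<lambda>n. norm (f n - 1))"
  shows "convergent_prod f"
  using assms by (intro abs_convergent_prod_imp_convergent_prod summable_imp_abs_convergent_prod)

lemma convergent_prod_tendsto_prodinf:
  fixes f :: "nat \<Rightarrow> complex"
  assumes "convergent_prod f"
  shows "(\<lambda>n. \<Prod>k<n. f k) \<longlonglongrightarrow> prodinf f"
  using convergent_prod_has_prod[OF assms] by (rule has_prod_imp_tendsto')

text \<open>The finite inequality |prod (1 + a_k) - 1| \<le> prod (1 + |a_k|) - 1 \<le> exp (sum
  |a_k|) - 1 passes to the limit. It serves to bound the inner products of a double product, so that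
  the outer product gets a summable majorant.\<close>

lemma norm_prodinf_minus_one_le:
  fixes f :: "nat \<Rightarrow> complex"
  assumes "summable (\<lambda>n. norm (f n - 1))"
  shows "norm (prodinf f - 1) \<le> exp (\<Sum>n. norm (f n - 1)) - 1"
proof -
  have lim: "(\<lambda>n. \<Prod>k<n. f k) \<longlonglongrightarrow> prodinf f"
    by (intro convergent_prod_tendsto_prodinf summable_imp_convergent_prod_complex assms)
  have "norm ((\<Prod>k<n. f k) - 1) \<le> exp (\<Sum>n. norm (f n - 1)) - 1" for n
  proof -
    have "norm ((\<Prod>k<n. f k) - 1) = norm ((\<Prod>k<n. 1 + (f k - 1)) - 1)" by simp
    also have "\<dots> \<le> (\<Prod>k<n. 1 + norm (f k - 1)) - 1"
      by (rule norm_prod_minus1_le_prod_minus1)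
    also have "\<dots> \<le> (\<Prod>k<n. exp (norm (f k - 1))) - 1"
      by (intro diff_right_mono prod_mono) auto
    also have "(\<Prod>k<n. exp (norm (f k - 1))) = exp (\<Sum>k<n. norm (f k - 1))"
      by (simp add: exp_sum)
    also have "(\<Sum>k<n. norm (f k - 1)) \<le> (\<Sum>n. norm (f n - 1))"
      by (rule sum_le_suminf) (use assms in auto)
    finally show ?thesis by simp
  qed
  moreover have "(\<lambda>n. norm ((\<Prod>k<n. f k) - 1)) \<longlonglongrightarrow> norm (prodinf f - 1)"
    using lim by (intro tendsto_intros)
  ultimately show ?thesis
    by (meson LIMSEQ_le_const2)
qed

text \<open>A summable majorant on small closed discs makes the partial products converge uniformly
  there; the uniform limit is identified with \<open>prodinf\<close> pointwise, as both are limits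
  of the same partial products.\<close>

lemma holomorphic_on_prodinf:
  fixes f :: "nat \<Rightarrow> complex \<Rightarrow> complex"
  assumes A: "open A" and hol: "\<And>n. f n holomorphic_on A"
    and dom: "\<And>x. x \<in> A \<Longrightarrow> \<exists>d>0. cball x d \<subseteq> A \<and>
      (\<exists>M. summable M \<and> (\<forall>y\<in>cball x d. \<forall>n. norm (f n y - 1) \<le> M n))"
  shows "(\<lambda>x. \<Prod>n. f n x) holomorphic_on A"
proof (rule holomorphic_uniform_sequence[OF A])
  show "(\<lambda>x. \<Prod>k<n. f k x) holomorphic_on A" for n
    using hol by (intro holomorphic_intros) auto
  fix x assume "x \<in> A"
  then obtain d M where d: "d > 0" "cball x d \<subseteq> A" "summable M"
    and M: "\<And>y n. y \<in> cball x d \<Longrightarrow> norm (f n y - 1) \<le> M n"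
    using dom by metis
  have "uniformly_convergent_on (cball x d) (\<lambda>N x. \<Sum>n<N. norm (f n x - 1))"
    by (rule Weierstrass_m_test'[where M=M]) (use M d in auto)
  hence "uniformly_convergent_on (cball x d) (\<lambda>N x. \<Prod>n<N. f n x)"
    using d hol by (intro uniformly_convergent_on_prod')
      (auto intro!: holomorphic_on_imp_continuous_on holomorphic_on_subset[OF hol])
  then obtain g where g: "uniform_limit (cball x d) (\<lambda>N x. \<Prod>n<N. f n x) g sequentially"
    by (auto simp: uniformly_convergent_on_def)
  have "g y = (\<Prod>n. f n y)" if y: "y \<in> cball x d" for y
  proof -
    have "summable (\<lambda>n. norm (f n y - 1))"
      by (rule summable_comparison_test'[OF d(3), of 0]) (use M y in auto)
    hence "convergent_prod (\<lambda>n. f n y)"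
      by (rule summable_imp_convergent_prod_complex)
    hence "(\<lambda>n. \<Prod>k<n. f k y) \<longlonglongrightarrow> (\<Prod>n. f n y)"
      by (rule convergent_prod_tendsto_prodinf)
    moreover have "(\<lambda>n. \<Prod>k<n. f k y) \<longlonglongrightarrow> g y"
      using tendsto_uniform_limitI[OF g y] .
    ultimately show ?thesis by (rule LIMSEQ_unique[symmetric])
  qed
  with g have "uniform_limit (cball x d) (\<lambda>N x. \<Prod>n<N. f n x) (\<lambda>x. \<Prod>n. f n x) sequentially"
    by (subst (asm) uniform_limit_cong'[where g="\<lambda>N x. \<Prod>n<N. f n x" and i="\<lambda>x. \<Prod>n. f n x"]) auto
  with d show "\<exists>d>0. cball x d \<subseteq> A \<and>
      uniform_limit (cball x d) (\<lambda>n x. \<Prod>k<n. f k x) (\<lambda>x. \<Prod>n. f n x) sequentially"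
    by blast
qed

section \<open>Simple and double q-products in the multiplicative variable\<close>

definition qprod :: "complex \<Rightarrow> complex \<Rightarrow> complex" where
  "qprod x q = (\<Prod>n. 1 - x * q ^ n)"

lemma summable_norm_qprod:
  fixes x q :: complex
  assumes "norm q < 1"
  shows "summable (\<lambda>n. norm ((1 - x * q ^ n) - 1))"
  using summable_mult[OF summable_geometric[of "norm q"], of "norm x"] assms
  by (simp add: norm_mult norm_power)

lemma convergent_qprod:
  fixes x q :: complex
  assumes "norm q < 1"
  shows "convergent_prod (\<lambda>n. 1 - x * q ^ n)"
  by (rule summable_imp_convergent_prod_complex[OF summable_norm_qprod[OF assms]])

lemma qprod_tendsto:
  fixes x q :: complex
  assumes "norm q < 1"
  shows "(\<lambda>n. \<Prod>k<n. 1 - x * q ^ k) \<longlonglongrightarrow> qprod x q"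
  unfolding qprod_def
  by (rule convergent_prod_tendsto_prodinf[OF convergent_qprod[OF assms]])

lemma qprod_rec:
  assumes "norm q < 1"
  shows "qprod x q = (1 - x) * qprod (x * q) q"
proof -
  have "(\<lambda>n. \<Prod>k<Suc n. 1 - x * q ^ k) \<longlonglongrightarrow> qprod x q"
    using qprod_tendsto[OF assms] by (rule LIMSEQ_Suc)
  moreover have "(\<Prod>k<Suc n. 1 - x * q ^ k) = (1 - x) * (\<Prod>k<n. 1 - x * q * q ^ k)" for n
    by (subst prod.lessThan_Suc_shift) (simp add: mult.assoc)
  moreover have "(\<lambda>n. (1 - x) * (\<Prod>k<n. 1 - x * q * q ^ k)) \<longlonglongrightarrow> (1 - x) * qprod (x * q) q"
    by (intro tendsto_intros qprod_tendsto assms)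
  ultimately show ?thesis
    using LIMSEQ_unique by force
qed

lemma qprod_eq_0_iff:
  assumes "norm q < 1"
  shows "qprod x q = 0 \<longleftrightarrow> (\<exists>n. x * q ^ n = 1)"
proof -
  have "(\<lambda>n. 1 - x * q ^ n) has_prod qprod x q"
    unfolding qprod_def using convergent_qprod[OF assms] by (rule convergent_prod_has_prod)
  from has_prod_eq_0_iff[OF this] show ?thesis
    by (auto simp: image_iff)
qed

lemma qprod_0 [simp]: "qprod 0 q = 1"
  by (simp add: qprod_def)

lemma holomorphic_qprod:
  assumes "norm q < 1"
  shows "(\<lambda>x. qprod x q) holomorphic_on A"
proof -
  have "(\<lambda>x. qprod x q) holomorphic_on UNIV"
    unfolding qprod_def
  proof (rule holomorphic_on_prodinf)
    fix x :: complex
    show "\<exists>d>0. cball x d \<subseteq> UNIV \<and> (\<exists>M. summable M \<and>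
       (\<forall>y\<in>cball x d. \<forall>n. norm (1 - y * q ^ n - 1) \<le> M n))"
    proof (rule exI[of _ 1], intro conjI exI[of _ "\<lambda>n. (norm x + 1) * norm q ^ n"] ballI allI)
      show "summable (\<lambda>n. (norm x + 1) * norm q ^ n)"
        using assms by (intro summable_mult summable_geometric) auto
      fix y n assume "y \<in> cball x 1"
      hence "norm y \<le> norm x + 1"
        using norm_triangle_ineq2[of y x] by (simp add: dist_norm norm_minus_commute)
      thus "norm (1 - y * q ^ n - 1) \<le> (norm x + 1) * norm q ^ n"
        by (simp add: norm_mult norm_power mult_right_mono)
    qed auto
  qed (auto intro!: holomorphic_intros)
  thus ?thesis by (rule holomorphic_on_subset) auto
qed

text \<open>The factor \<open>norm x\<close> is what matters: at x q^n the bound decays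
  geometrically in n, which makes the outer product of \<open>qprod2\<close> converge.\<close>

lemma norm_qprod_minus_one_le:
  assumes "norm q < 1"
  shows "norm (qprod x q - 1) \<le> norm x * (exp (norm x / (1 - norm q)) / (1 - norm q))"
proof -
  have s: "(\<Sum>n. norm ((1 - x * q ^ n) - 1)) = norm x / (1 - norm q)"
    using suminf_geometric[of "norm q"] suminf_mult[of "\<lambda>n. norm q ^ n" "norm x"] assms
    by (simp add: norm_mult norm_power summable_geometric)
  have "norm (qprod x q - 1) \<le> exp (norm x / (1 - norm q)) - 1"
    using norm_prodinf_minus_one_le[OF summable_norm_qprod[OF assms, of x]] s
    by (simp add: qprod_def)
  also have "\<dots> \<le> (norm x / (1 - norm q)) * exp (norm x / (1 - norm q))"
  proof -
    have "exp y - 1 \<le> y * exp y" for y :: real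
    proof -
      have "1 + (- y) \<le> exp (- y)" by (rule exp_ge_add_one_self)
      hence "(1 + (-y)) * exp y \<le> exp (-y) * exp y" by (intro mult_right_mono) auto
      thus ?thesis by (simp add: exp_minus algebra_simps)
    qed
    thus ?thesis .
  qed
  finally show ?thesis by simp
qed

lemma qprod_square:
  assumes "norm q < 1"
  shows "qprod (x\<^sup>2) (q\<^sup>2) = qprod x q * qprod (- x) q"
proof -
  have q2: "norm (q\<^sup>2) < 1" using assms by (simp add: norm_power power_less_one_iff)
  have "(\<lambda>n. (\<Prod>k<n. 1 - x * q ^ k) * (\<Prod>k<n. 1 - (- x) * q ^ k)) \<longlonglongrightarrow> qprod x q * qprod (- x) q"
    by (intro tendsto_mult qprod_tendsto assms)
  moreover have "(\<Prod>k<n. 1 - x * q ^ k) * (\<Prod>k<n. 1 - (- x) * q ^ k) = (\<Prod>k<n. 1 - x\<^sup>2 * (q\<^sup>2) ^ k)" for n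
    unfolding prod.distrib[symmetric]
    by (intro prod.cong refl) (simp add: algebra_simps power2_eq_square power_mult_distrib)
  ultimately show ?thesis
    using qprod_tendsto[OF q2, of "x\<^sup>2"] LIMSEQ_unique by force
qed

lemma qprod_dissect:
  assumes "norm q < 1"
  shows "qprod x q = qprod x (q\<^sup>2) * qprod (x * q) (q\<^sup>2)"
proof -
  have q2: "norm (q\<^sup>2) < 1" using assms by (simp add: norm_power power_less_one_iff)
  have "(\<lambda>n. (\<Prod>k<n. 1 - x * (q\<^sup>2) ^ k) * (\<Prod>k<n. 1 - x * q * (q\<^sup>2) ^ k)) \<longlonglongrightarrow>
        qprod x (q\<^sup>2) * qprod (x * q) (q\<^sup>2)"
    by (intro tendsto_mult qprod_tendsto q2)
  moreover have "(\<Prod>k<n. 1 - x * (q\<^sup>2) ^ k) * (\<Prod>k<n. 1 - x * q * (q\<^sup>2) ^ k) = (\<Prod>k<2 * n. 1 - x * q ^ k)" for n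
    by (induction n) (auto simp: power_mult power2_eq_square algebra_simps simp flip: power_mult_distrib)
  moreover have "(\<lambda>n. \<Prod>k<2 * n. 1 - x * q ^ k) \<longlonglongrightarrow> qprod x q"
    using LIMSEQ_subseq_LIMSEQ[OF qprod_tendsto[OF assms, of x], of "\<lambda>n. 2 * n"]
    by (auto simp: o_def strict_mono_def)
  ultimately show ?thesis
    using LIMSEQ_unique by force
qed

definition qprod2 :: "complex \<Rightarrow> complex \<Rightarrow> complex \<Rightarrow> complex" where
  "qprod2 x q p = (\<Prod>n. qprod (x * q ^ n) p)"

lemma qprod_majorant:
  assumes "norm q < 1" "norm p < 1" "norm x \<le> r"
  shows "norm (qprod (x * q ^ n) p - 1) \<le> r * (exp (r / (1 - norm p)) / (1 - norm p)) * norm q ^ n"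
proof -
  have le: "norm (x * q ^ n) \<le> r * norm q ^ n"
    using assms by (simp add: norm_mult norm_power mult_right_mono)
  have r0: "0 \<le> r" using norm_ge_zero[of x] assms(3) by linarith
  have "r * norm q ^ n \<le> r" using r0 assms by (simp add: mult_left_le power_le_one)
  hence le': "norm (x * q ^ n) \<le> r" using le by linarith
  have "norm (qprod (x * q ^ n) p - 1) \<le> norm (x * q ^ n) * (exp (norm (x * q ^ n) / (1 - norm p)) / (1 - norm p))"
    by (rule norm_qprod_minus_one_le[OF assms(2)])
  also have "\<dots> \<le> (r * norm q ^ n) * (exp (r / (1 - norm p)) / (1 - norm p))"
    using le le' assms r0 by (intro mult_mono divide_right_mono) (auto intro!: divide_right_mono)
  finally show ?thesis by (simp add: mult_ac)
qed

lemma summable_qprod2_majorant: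
  assumes "norm (q::complex) < 1"
  shows "summable (\<lambda>n. (c::real) * norm q ^ n)"
  using assms by (intro summable_mult summable_geometric) auto

lemma summable_norm_qprod2:
  assumes "norm q < 1" "norm p < 1"
  shows "summable (\<lambda>n. norm (qprod (x * q ^ n) p - 1))"
  by (rule summable_comparison_test'[OF summable_qprod2_majorant[OF assms(1)], of 0])
     (simp, rule qprod_majorant[OF assms order_refl])

lemma convergent_qprod2:
  assumes "norm q < 1" "norm p < 1"
  shows "convergent_prod (\<lambda>n. qprod (x * q ^ n) p)"
  by (rule summable_imp_convergent_prod_complex[OF summable_norm_qprod2[OF assms]])

lemma qprod2_tendsto:
  assumes "norm q < 1" "norm p < 1"
  shows "(\<lambda>n. \<Prod>k<n. qprod (x * q ^ k) p) \<longlonglongrightarrow> qprod2 x q p"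
  unfolding qprod2_def
  by (rule convergent_prod_tendsto_prodinf[OF convergent_qprod2[OF assms]])

lemma qprod2_rec:
  assumes "norm q < 1" "norm p < 1"
  shows "qprod2 x q p = qprod x p * qprod2 (x * q) q p"
proof -
  have "(\<lambda>n. \<Prod>k<Suc n. qprod (x * q ^ k) p) \<longlonglongrightarrow> qprod2 x q p"
    using qprod2_tendsto[OF assms] by (rule LIMSEQ_Suc)
  moreover have "(\<Prod>k<Suc n. qprod (x * q ^ k) p) = qprod x p * (\<Prod>k<n. qprod (x * q * q ^ k) p)" for n
    by (subst prod.lessThan_Suc_shift) (simp add: mult.assoc)
  moreover have "(\<lambda>n. qprod x p * (\<Prod>k<n. qprod (x * q * q ^ k) p)) \<longlonglongrightarrow> qprod x p * qprod2 (x * q) q p"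
    by (intro tendsto_intros qprod2_tendsto assms)
  ultimately show ?thesis
    using LIMSEQ_unique by force
qed

text \<open>Every inner product loses its first factor, and these factors, taken over the outer
  index, form a simple product in q.\<close>

lemma qprod2_rec':
  assumes "norm q < 1" "norm p < 1"
  shows "qprod2 x q p = qprod x q * qprod2 (x * p) q p"
proof -
  have "(\<lambda>n. (\<Prod>k<n. 1 - x * q ^ k) * (\<Prod>k<n. qprod (x * p * q ^ k) p)) \<longlonglongrightarrow> qprod x q * qprod2 (x * p) q p"
    by (intro tendsto_mult qprod2_tendsto qprod_tendsto assms)
  moreover have "(\<Prod>k<n. 1 - x * q ^ k) * (\<Prod>k<n. qprod (x * p * q ^ k) p) = (\<Prod>k<n. qprod (x * q ^ k) p)" for n
    unfolding prod.distrib[symmetric]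
    by (intro prod.cong refl) (subst (2) qprod_rec[OF assms(2)], simp add: mult_ac)
  ultimately show ?thesis
    using qprod2_tendsto[OF assms, of x] LIMSEQ_unique by force
qed

lemma qprod2_eq_0_iff:
  assumes "norm q < 1" "norm p < 1"
  shows "qprod2 x q p = 0 \<longleftrightarrow> (\<exists>n m. x * q ^ n * p ^ m = 1)"
proof -
  have "(\<lambda>n. qprod (x * q ^ n) p) has_prod qprod2 x q p"
    unfolding qprod2_def using convergent_qprod2[OF assms] by (rule convergent_prod_has_prod)
  from has_prod_eq_0_iff[OF this] show ?thesis
    using qprod_eq_0_iff[OF assms(2)] by (auto simp: image_iff)
qed

lemma qprod2_0 [simp]: "qprod2 0 q p = 1"
  by (simp add: qprod2_def)

lemma holomorphic_qprod2:
  assumes "norm q < 1" "norm p < 1"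
  shows "(\<lambda>x. qprod2 x q p) holomorphic_on A"
proof -
  have "(\<lambda>x. qprod2 x q p) holomorphic_on UNIV"
    unfolding qprod2_def
  proof (rule holomorphic_on_prodinf)
    fix x :: complex
    define M where "M = (\<lambda>n. (norm x + 1) * (exp ((norm x + 1) / (1 - norm p)) / (1 - norm p)) * norm q ^ n)"
    show "\<exists>d>0. cball x d \<subseteq> UNIV \<and> (\<exists>M. summable M \<and>
       (\<forall>y\<in>cball x d. \<forall>n. norm (qprod (y * q ^ n) p - 1) \<le> M n))"
    proof (rule exI[of _ 1], intro conjI exI[of _ M] ballI allI)
      show "summable M"
        unfolding M_def by (rule summable_qprod2_majorant[OF assms(1)])
      fix y n assume "y \<in> cball x 1"
      hence "norm y \<le> norm x + 1"
        using norm_triangle_ineq2[of y x] by (simp add: dist_norm norm_minus_commute)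
      thus "norm (qprod (y * q ^ n) p - 1) \<le> M n"
        unfolding M_def by (rule qprod_majorant[OF assms])
    qed auto
  next
    fix n
    have "((\<lambda>x. qprod x p) \<circ> (\<lambda>x. x * q ^ n)) holomorphic_on UNIV"
      by (intro holomorphic_on_compose holomorphic_qprod assms holomorphic_intros)
    thus "(\<lambda>x. qprod (x * q ^ n) p) holomorphic_on UNIV" by (simp add: o_def)
  qed auto
  thus ?thesis by (rule holomorphic_on_subset) auto
qed

text \<open>The exchange of two limits is replaced by splitting off n inner factors with
  \<open>qprod2_rec'\<close>: the remainder is the same double product at x q^n, which tends to its
  value 1 at 0 by continuity.\<close>

lemma qprod2_commute:
  assumes "norm q < 1" "norm p < 1"
  shows "qprod2 x q p = qprod2 x p q"
proof -
  have eq: "qprod2 x p q = (\<Prod>k<n. qprod (x * q ^ k) p) * qprod2 (x * q ^ n) p q" for n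
  proof (induction n)
    case (Suc n)
    show ?case
      using Suc qprod2_rec'[OF assms(2,1), of "x * q ^ n"] by (simp add: mult_ac)
  qed simp
  have "isCont (\<lambda>x. qprod2 x p q) 0"
    using holomorphic_on_imp_continuous_on[OF holomorphic_qprod2[OF assms(2,1), of UNIV]]
    by (simp add: continuous_on_eq_continuous_at)
  moreover have "(\<lambda>n. x * q ^ n) \<longlonglongrightarrow> 0"
    using LIMSEQ_power_zero[OF assms(1)] by (rule tendsto_mult_right_zero)
  ultimately have "(\<lambda>n. qprod2 (x * q ^ n) p q) \<longlonglongrightarrow> qprod2 0 p q"
    by (rule isCont_tendsto_compose)
  hence "(\<lambda>n. (\<Prod>k<n. qprod (x * q ^ k) p) * qprod2 (x * q ^ n) p q) \<longlonglongrightarrow> qprod2 x q p * 1"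
    using qprod2_tendsto[OF assms] by (intro tendsto_mult) auto
  hence "(\<lambda>n::nat. qprod2 x p q) \<longlonglongrightarrow> qprod2 x q p"
    by (simp flip: eq)
  thus ?thesis
    by (simp add: LIMSEQ_const_iff)
qed

lemma qprod2_dissect:
  assumes "norm q < 1" "norm p < 1"
  shows "qprod2 x q p = qprod2 x q (p\<^sup>2) * qprod2 (x * p) q (p\<^sup>2)"
proof -
  have p2: "norm (p\<^sup>2) < 1" using assms by (simp add: norm_power power_less_one_iff)
  have "(\<lambda>n. (\<Prod>k<n. qprod (x * q ^ k) (p\<^sup>2)) * (\<Prod>k<n. qprod (x * p * q ^ k) (p\<^sup>2))) \<longlonglongrightarrow>
      qprod2 x q (p\<^sup>2) * qprod2 (x * p) q (p\<^sup>2)"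
    by (intro tendsto_mult qprod2_tendsto p2 assms)
  moreover have "(\<Prod>k<n. qprod (x * q ^ k) (p\<^sup>2)) * (\<Prod>k<n. qprod (x * p * q ^ k) (p\<^sup>2))
      = (\<Prod>k<n. qprod (x * q ^ k) p)" for n
    unfolding prod.distrib[symmetric]
    by (intro prod.cong refl) (use qprod_dissect[OF assms(2)] in \<open>simp add: mult_ac\<close>)
  ultimately show ?thesis
    using qprod2_tendsto[OF assms, of x] LIMSEQ_unique by force
qed

section \<open>Theta functions and elliptic Gamma functions\<close>

text \<open>The covering map from the plane to the punctured plane; it serves both for the
  multiplicative form of the products and for cycles modulo 1.\<close>

definition ee :: "complex \<Rightarrow> complex" where
  "ee z = exp (2 * of_real pi * \<i> * z)"

lemma ee_nonzero [simp]: "ee z \<noteq> 0"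
  by (simp add: ee_def)

lemma ee_add: "ee (z + w) = ee z * ee w"
  by (simp add: ee_def exp_add algebra_simps)

lemma ee_diff: "ee (z - w) = ee z / ee w"
  by (simp add: ee_def exp_diff algebra_simps)

lemma ee_minus: "ee (- z) = 1 / ee z"
  by (simp add: ee_def exp_minus field_simps)

lemma ee_0 [simp]: "ee 0 = 1"
  by (simp add: ee_def)

lemma ee_of_int [simp]: "ee (of_int n) = 1"
  unfolding ee_def by (simp add: exp_eq_1)

lemma ee_1 [simp]: "ee 1 = 1"
  using ee_of_int[of 1] by simp

lemma ee_half [simp]: "ee (1/2) = -1"
  by (simp add: ee_def mult.commute)

lemma ee_of_nat_mult: "ee (of_nat n * z) = ee z ^ n"
  by (simp add: ee_def flip: exp_of_nat_mult) (simp add: algebra_simps)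

lemma ee_double: "ee (2 * z) = (ee z)\<^sup>2"
  using ee_of_nat_mult[of 2 z] by simp

lemma norm_ee: "norm (ee z) = exp (- 2 * pi * Im z)"
  by (simp add: ee_def)

lemma norm_ee_less_1: "Im z > 0 \<Longrightarrow> norm (ee z) < 1"
  by (simp add: norm_ee)

lemma ee_eq_1_iff: "ee z = 1 \<longleftrightarrow> (\<exists>k::int. z = of_int k)"
proof
  assume "ee z = 1"
  then obtain k :: int where "2 * of_real pi * \<i> * z = of_int (2 * k) * pi * \<i>"
    unfolding ee_def exp_eq_1 by (auto simp: complex_eq_iff)
  hence "z = of_int k" by (simp add: field_simps)
  thus "\<exists>k::int. z = of_int k" ..
qed auto

lemma holomorphic_ee [holomorphic_intros]:
  "f holomorphic_on A \<Longrightarrow> (\<lambda>z. ee (f z)) holomorphic_on A"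
  unfolding ee_def by (intro holomorphic_intros)

lemma has_field_derivative_ee [derivative_intros]:
  "(f has_field_derivative f') (at z within A) \<Longrightarrow>
   ((\<lambda>z. ee (f z)) has_field_derivative (2 * of_real pi * \<i> * f' * ee (f z))) (at z within A)"
  unfolding ee_def by (auto intro!: derivative_eq_intros)

lemma continuous_on_ee [continuous_intros]:
  "continuous_on A f \<Longrightarrow> continuous_on A (\<lambda>z. ee (f z))"
  unfolding ee_def by (intro continuous_intros)

lemma qpoch_eq_qprod: "qpoch z \<tau> = qprod (ee z) (ee \<tau>)"
  unfolding qpoch_def qprod_def
  by (intro prodinf_cong) (simp add: ee_def exp_add mult_ac flip: exp_of_nat_mult)

lemma qpoch_rec: "Im \<tau> > 0 \<Longrightarrow> qpoch z \<tau> = (1 - ee z) * qpoch (z + \<tau>) \<tau>"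
  unfolding qpoch_eq_qprod ee_add by (rule qprod_rec[OF norm_ee_less_1])

lemma qpoch_add_of_int [simp]: "qpoch (z + of_int n) \<tau> = qpoch z \<tau>"
  by (simp add: qpoch_eq_qprod ee_add)

lemma qpoch_eq_0_iff:
  assumes "Im \<tau> > 0"
  shows "qpoch z \<tau> = 0 \<longleftrightarrow> (\<exists>(n::nat) (k::int). z + of_nat n * \<tau> = of_int k)"
  unfolding qpoch_eq_qprod qprod_eq_0_iff[OF norm_ee_less_1[OF assms]]
  by (simp flip: ee_of_nat_mult ee_add add: ee_eq_1_iff)

lemma holomorphic_qpoch:
  assumes "Im \<tau> > 0" "f holomorphic_on A"
  shows "(\<lambda>z. qpoch (f z) \<tau>) holomorphic_on A"
proof -
  have "((\<lambda>x. qprod x (ee \<tau>)) \<circ> (\<lambda>z. ee (f z))) holomorphic_on A"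
    by (intro holomorphic_on_compose holomorphic_qprod norm_ee_less_1 assms holomorphic_intros)
  thus ?thesis by (simp add: o_def qpoch_eq_qprod)
qed

lemma qpoch_double: "Im \<tau> > 0 \<Longrightarrow> qpoch (2 * z) (2 * \<tau>) = qpoch z \<tau> * qpoch (z + 1/2) \<tau>"
  using qprod_square[OF norm_ee_less_1, of \<tau> "ee z"]
  by (simp add: qpoch_eq_qprod ee_double ee_add)

lemma qpoch_dissect: "Im \<tau> > 0 \<Longrightarrow> qpoch z \<tau> = qpoch z (2 * \<tau>) * qpoch (z + \<tau>) (2 * \<tau>)"
  using qprod_dissect[OF norm_ee_less_1, of \<tau> "ee z"]
  by (simp add: qpoch_eq_qprod ee_double ee_add)

lemma qpoch_nonzero:
  assumes "Im \<tau> > 0" "Im z > 0"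
  shows "qpoch z \<tau> \<noteq> 0"
proof
  assume "qpoch z \<tau> = 0"
  then obtain n :: nat and k :: int where "z + of_nat n * \<tau> = of_int k"
    using qpoch_eq_0_iff[OF assms(1)] by blast
  hence "Im z + of_nat n * Im \<tau> = 0"
    by (metis Im_complex_of_real add_cancel_right_right complex_Im_of_int plus_complex.sel(2)
        times_complex.sel(2) complex_Re_of_nat complex_Im_of_nat mult_zero_left)
  moreover have "of_nat n * Im \<tau> \<ge> 0" using assms by simp
  ultimately show False using assms by linarith
qed

lemma theta0_reflect [simp]: "theta0 (\<tau> - z) \<tau> = theta0 z \<tau>"
  by (simp add: theta0_def)

lemma theta0_add_of_int [simp]: "theta0 (z + of_int n) \<tau> = theta0 z \<tau>"
  using qpoch_add_of_int[of z n \<tau>] qpoch_add_of_int[of "\<tau> - z - of_int n" n \<tau>]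
  by (simp add: theta0_def algebra_simps)

lemma theta0_shift:
  assumes "Im \<tau> > 0"
  shows "theta0 (z + \<tau>) \<tau> = - ee (- z) * theta0 z \<tau>"
proof -
  have a: "qpoch (- z) \<tau> = (1 - 1 / ee z) * qpoch (\<tau> - z) \<tau>"
    using qpoch_rec[OF assms, of "- z"] by (simp add: ee_minus)
  have "qpoch (z + \<tau>) \<tau> * qpoch (- z) \<tau> = - ee (- z) * (qpoch z \<tau> * qpoch (\<tau> - z) \<tau>)"
    unfolding a qpoch_rec[OF assms, of z] by (simp add: ee_minus field_simps)
  thus ?thesis by (simp add: theta0_def)
qed

lemma theta0_eq_shift: "Im \<tau> > 0 \<Longrightarrow> theta0 z \<tau> = - ee z * theta0 (z + \<tau>) \<tau>"
  by (simp add: theta0_shift ee_minus)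

lemma theta0_minus: "Im \<tau> > 0 \<Longrightarrow> theta0 (- z) \<tau> = - ee (- z) * theta0 z \<tau>"
  using theta0_shift[of \<tau> z] theta0_reflect[of \<tau> "- z"] by (simp add: add.commute)

lemma theta0_eq_0_iff:
  assumes "Im \<tau> > 0"
  shows "theta0 z \<tau> = 0 \<longleftrightarrow> (\<exists>(n::int) (k::int). z = of_int n + of_int k * \<tau>)"
proof
  assume "theta0 z \<tau> = 0"
  hence "qpoch z \<tau> = 0 \<or> qpoch (\<tau> - z) \<tau> = 0" by (simp add: theta0_def)
  thus "\<exists>(n::int) (k::int). z = of_int n + of_int k * \<tau>"
  proof
    assume "qpoch z \<tau> = 0"
    then obtain n :: nat and k :: int where "z + of_nat n * \<tau> = of_int k"
      using qpoch_eq_0_iff[OF assms(1)] by blast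
    hence "z = of_int k + of_int (- int n) * \<tau>" by (simp add: algebra_simps)
    thus ?thesis by blast
  next
    assume "qpoch (\<tau> - z) \<tau> = 0"
    then obtain n :: nat and k :: int where "\<tau> - z + of_nat n * \<tau> = of_int k"
      using qpoch_eq_0_iff[OF assms(1)] by blast
    hence "z = of_int (-k) + of_int (1 + int n) * \<tau>" by (simp add: algebra_simps)
    thus ?thesis by blast
  qed
next
  assume "\<exists>(n::int) (k::int). z = of_int n + of_int k * \<tau>"
  then obtain n k :: int where z: "z = of_int n + of_int k * \<tau>" by blast
  show "theta0 z \<tau> = 0"
  proof (cases "k \<le> 0")
    case True
    have "z + of_nat (nat (-k)) * \<tau> = of_int n" using True z by (simp add: algebra_simps)
    hence "qpoch z \<tau> = 0" using qpoch_eq_0_iff[OF assms(1)] by blast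
    thus ?thesis by (simp add: theta0_def)
  next
    case False
    then obtain j where j: "k = 1 + int j" by (metis linorder_not_le zle_iff_zadd zless_iff_Suc_zadd int_one_le_iff_zero_less)
    hence "\<tau> - z + of_nat j * \<tau> = of_int (- n)" using z by (simp add: algebra_simps)
    hence "qpoch (\<tau> - z) \<tau> = 0" using qpoch_eq_0_iff[OF assms(1)] by blast
    thus ?thesis by (simp add: theta0_def)
  qed
qed

lemma theta0_0 [simp]: "Im \<tau> > 0 \<Longrightarrow> theta0 0 \<tau> = 0"
  by (subst theta0_eq_0_iff) (auto intro!: exI[of _ 0])

lemma holomorphic_theta0:
  assumes "Im \<tau> > 0" "f holomorphic_on A"
  shows "(\<lambda>z. theta0 (f z) \<tau>) holomorphic_on A"
  unfolding theta0_def by (intro holomorphic_intros holomorphic_qpoch assms)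

lemma theta0_dissect: "Im \<tau> > 0 \<Longrightarrow> theta0 z \<tau> = theta0 z (2 * \<tau>) * theta0 (z + \<tau>) (2 * \<tau>)"
  using qpoch_dissect[of \<tau> z] qpoch_dissect[of \<tau> "\<tau> - z"]
  by (simp add: theta0_def algebra_simps)

lemma theta0_double:
  assumes "Im \<tau> > 0"
  shows "theta0 (2 * z) (2 * \<tau>) = theta0 z \<tau> * theta0 (z + 1/2) \<tau>"
proof -
  have "qpoch (\<tau> - z + 1/2) \<tau> = qpoch (\<tau> - (z + 1/2)) \<tau>"
    using qpoch_add_of_int[of "\<tau> - (z + 1/2)" 1 \<tau>] by (simp add: algebra_simps)
  thus ?thesis
    using qpoch_double[OF assms, of z] qpoch_double[OF assms, of "\<tau> - z"]
    by (simp add: theta0_def right_diff_distrib)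
qed

lemma theta0_half_minus:
  assumes "Im \<tau> > 0"
  shows "theta0 (1/2 - z) \<tau> = ee (- z) * theta0 (z + 1/2) \<tau>"
  using theta0_minus[OF assms, of "z - 1/2"] theta0_add_of_int[of "z - 1/2" 1 \<tau>]
  by (simp add: ee_diff ee_minus add.commute)

text \<open>Only the factor 1 - \<open>ee z\<close> vanishes at 0, so the derivative is that of this
  factor times the value of all the others.\<close>

lemma has_field_derivative_theta0_0:
  assumes "Im \<tau> > 0"
  shows "((\<lambda>z. theta0 z \<tau>) has_field_derivative (- 2 * of_real pi * \<i> * (qpoch \<tau> \<tau>)\<^sup>2)) (at 0)"
proof -
  define r where "r = (\<lambda>z. qpoch (z + \<tau>) \<tau> * qpoch (\<tau> - z) \<tau>)"
  have "r holomorphic_on UNIV"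
    unfolding r_def by (intro holomorphic_intros holomorphic_qpoch assms)
  hence r: "(r has_field_derivative deriv r 0) (at 0)"
    by (simp add: holomorphic_derivI)
  have "((\<lambda>z. (1 - ee z) * r z) has_field_derivative
      ((1 - ee 0) * deriv r 0 + - (2 * of_real pi * \<i>) * r 0)) (at 0)"
    by (auto intro!: derivative_eq_intros r)
  moreover have "(1 - ee z) * r z = theta0 z \<tau>" for z
    using qpoch_rec[OF assms, of z] by (simp add: theta0_def r_def)
  moreover have "r 0 = (qpoch \<tau> \<tau>)\<^sup>2" by (simp add: r_def power2_eq_square)
  ultimately show ?thesis by simp
qed

text \<open>Only the shape of the multiplier matters, a nonzero constant times an exponential: it
  carries the simple zero at 0 to all points of the lattice.\<close>

lemma theta0_shift_int:
  assumes "Im \<tau> > 0"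
  shows "\<exists>c m. c \<noteq> 0 \<and> (\<forall>z. theta0 (z + of_int k * \<tau>) \<tau> = c * ee (of_int m * z) * theta0 z \<tau>)"
proof (induction k rule: int_induct[where k=0])
  case base
  show ?case by (intro exI[of _ 1] exI[of _ 0]) auto
next
  case (step1 i)
  then obtain c m where cm: "c \<noteq> 0" "\<And>z. theta0 (z + of_int i * \<tau>) \<tau> = c * ee (of_int m * z) * theta0 z \<tau>"
    by blast
  have "theta0 (z + of_int (i + 1) * \<tau>) \<tau> = (c * - ee (- of_int i * \<tau>)) * ee (of_int (m - 1) * z) * theta0 z \<tau>" for z
    using theta0_shift[OF assms, of "z + of_int i * \<tau>"] cm(2)[of z]
    by (simp add: algebra_simps ee_add ee_minus ee_diff)
  moreover have "c * - ee (- of_int i * \<tau>) \<noteq> 0" using cm by simp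
  ultimately show ?case by blast
next
  case (step2 i)
  then obtain c m where cm: "c \<noteq> 0" "\<And>z. theta0 (z + of_int i * \<tau>) \<tau> = c * ee (of_int m * z) * theta0 z \<tau>"
    by blast
  have "theta0 (z + of_int (i - 1) * \<tau>) \<tau> = (- c * ee ((of_int i - 1) * \<tau>)) * ee (of_int (m + 1) * z) * theta0 z \<tau>" for z
  proof -
    have eq: "z + (of_int i - 1) * \<tau> + \<tau> = z + of_int i * \<tau>" by (simp add: algebra_simps)
    have "theta0 (z + (of_int i - 1) * \<tau>) \<tau> = - ee (z + (of_int i - 1) * \<tau>) * theta0 (z + of_int i * \<tau>) \<tau>"
      using theta0_eq_shift[OF assms, of "z + (of_int i - 1) * \<tau>"] unfolding eq .
    thus ?thesis unfolding cm(2) by (simp add: ee_add distrib_right)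
  qed
  moreover have "- c * ee ((of_int i - 1) * \<tau>) \<noteq> 0" using cm by simp
  ultimately show ?case by blast
qed

lemma theta0_simple_zero:
  assumes "Im \<tau> > 0" "theta0 z \<tau> = 0"
  shows "deriv (\<lambda>w. theta0 w \<tau>) z \<noteq> 0"
proof -
  obtain n k :: int where z: "z = of_int n + of_int k * \<tau>"
    using assms theta0_eq_0_iff by blast
  obtain c m where c: "c \<noteq> 0" "\<And>z. theta0 (z + of_int k * \<tau>) \<tau> = c * ee (of_int m * z) * theta0 z \<tau>"
    using theta0_shift_int[OF assms(1)] by blast
  have eq: "theta0 (w + z) \<tau> = c * ee (of_int m * w) * theta0 w \<tau>" for w
    using c(2)[of "w + of_int n"] z by (simp add: algebra_simps ee_add flip: of_int_mult)
  have "((\<lambda>w. c * ee (of_int m * w) * theta0 w \<tau>) has_field_derivative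
     (c * (- 2 * of_real pi * \<i> * (qpoch \<tau> \<tau>)\<^sup>2))) (at 0)"
    using assms by (auto intro!: derivative_eq_intros has_field_derivative_theta0_0)
  hence "((\<lambda>w. theta0 (w + z) \<tau>) has_field_derivative (c * (- 2 * of_real pi * \<i> * (qpoch \<tau> \<tau>)\<^sup>2))) (at 0)"
    by (simp flip: eq)
  hence "((\<lambda>w. theta0 w \<tau>) has_field_derivative (c * (- 2 * of_real pi * \<i> * (qpoch \<tau> \<tau>)\<^sup>2))) (at z)"
    using DERIV_shift[of "\<lambda>w. theta0 w \<tau>" _ 0 z] by simp
  moreover have "c * (- 2 * of_real pi * \<i> * (qpoch \<tau> \<tau>)\<^sup>2) \<noteq> 0"
    using c(1) qpoch_nonzero[OF assms(1,1)] by simp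
  ultimately show ?thesis by (metis DERIV_imp_deriv)
qed

definition qpoch2 :: "complex \<Rightarrow> complex \<Rightarrow> complex \<Rightarrow> complex" where
  "qpoch2 z \<tau> \<sigma> = qprod2 (ee z) (ee \<tau>) (ee \<sigma>)"

lemma qpoch2_add_of_int [simp]: "qpoch2 (z + of_int n) \<tau> \<sigma> = qpoch2 z \<tau> \<sigma>"
  by (simp add: qpoch2_def ee_add)

locale two_periods =
  fixes \<tau> \<sigma> :: complex
  assumes tau: "Im \<tau> > 0" and sigma: "Im \<sigma> > 0"
begin

lemma ell_Gamma_eq: "ell_Gamma z \<tau> \<sigma> = qpoch2 (\<tau> + \<sigma> - z) \<tau> \<sigma> / qpoch2 z \<tau> \<sigma>"
proof -
  have q: "norm (ee \<tau>) < 1" and p: "norm (ee \<sigma>) < 1" using tau sigma norm_ee_less_1 by auto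
  have "ell_Gamma z \<tau> \<sigma> = (\<Prod>n. \<Prod>m. (1 - ee (\<tau> + \<sigma> - z) * ee \<tau> ^ n * ee \<sigma> ^ m) / (1 - ee z * ee \<tau> ^ n * ee \<sigma> ^ m))"
    unfolding ell_Gamma_def ee_def[symmetric] by (simp only: ee_add ee_of_nat_mult)
  also have "\<dots> = (\<Prod>n. qprod (ee (\<tau> + \<sigma> - z) * ee \<tau> ^ n) (ee \<sigma>) / qprod (ee z * ee \<tau> ^ n) (ee \<sigma>))"
    unfolding qprod_def by (intro prodinf_cong prodinf_divide[symmetric] convergent_qprod p)
  also have "\<dots> = qpoch2 (\<tau> + \<sigma> - z) \<tau> \<sigma> / qpoch2 z \<tau> \<sigma>"
    unfolding qpoch2_def qprod2_def
    by (intro prodinf_divide[symmetric] convergent_qprod2 p q)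
  finally show ?thesis .
qed

lemma ell_Gamma_add_of_int [simp]: "ell_Gamma (z + of_int n) \<tau> \<sigma> = ell_Gamma z \<tau> \<sigma>"
  using qpoch2_add_of_int[of "\<tau> + \<sigma> - z - of_int n" n]
  by (simp add: ell_Gamma_eq algebra_simps)

lemma qpoch2_rec: "qpoch2 z \<tau> \<sigma> = qpoch z \<sigma> * qpoch2 (z + \<tau>) \<tau> \<sigma>"
  unfolding qpoch2_def qpoch_eq_qprod ee_add
  by (rule qprod2_rec[OF norm_ee_less_1[OF tau] norm_ee_less_1[OF sigma]])

lemma qpoch2_rec': "qpoch2 z \<tau> \<sigma> = qpoch z \<tau> * qpoch2 (z + \<sigma>) \<tau> \<sigma>"
  unfolding qpoch2_def qpoch_eq_qprod ee_add
  by (rule qprod2_rec'[OF norm_ee_less_1[OF tau] norm_ee_less_1[OF sigma]])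

lemma qpoch2_eq_0_iff:
  "qpoch2 z \<tau> \<sigma> = 0 \<longleftrightarrow> (\<exists>(n::nat) (m::nat) (k::int). z + of_nat n * \<tau> + of_nat m * \<sigma> = of_int k)"
  unfolding qpoch2_def qprod2_eq_0_iff[OF norm_ee_less_1[OF tau] norm_ee_less_1[OF sigma]]
  by (simp flip: ee_of_nat_mult ee_add add: ee_eq_1_iff)

lemma qpoch2_nonzero:
  assumes "Im z > 0"
  shows "qpoch2 z \<tau> \<sigma> \<noteq> 0"
proof
  assume "qpoch2 z \<tau> \<sigma> = 0"
  then obtain n m :: nat and k :: int where "z + of_nat n * \<tau> + of_nat m * \<sigma> = of_int k"
    using qpoch2_eq_0_iff by blast
  hence "Im (z + of_nat n * \<tau> + of_nat m * \<sigma>) = 0" by simp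
  hence "Im z + of_nat n * Im \<tau> + of_nat m * Im \<sigma> = 0" by simp
  moreover have "of_nat n * Im \<tau> \<ge> 0" "of_nat m * Im \<sigma> \<ge> 0" using tau sigma by simp_all
  ultimately show False using assms by linarith
qed

lemma qpoch2_commute: "qpoch2 z \<tau> \<sigma> = qpoch2 z \<sigma> \<tau>"
  unfolding qpoch2_def by (intro qprod2_commute norm_ee_less_1 tau sigma)

lemma ell_Gamma_commute: "ell_Gamma z \<tau> \<sigma> = ell_Gamma z \<sigma> \<tau>"
  by (simp add: ell_Gamma_eq two_periods.ell_Gamma_eq[OF two_periods.intro[OF sigma tau]] qpoch2_commute add.commute)

lemma holomorphic_qpoch2:
  assumes "f holomorphic_on A"
  shows "(\<lambda>z. qpoch2 (f z) \<tau> \<sigma>) holomorphic_on A"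
proof -
  have "((\<lambda>x. qprod2 x (ee \<tau>) (ee \<sigma>)) \<circ> (\<lambda>z. ee (f z))) holomorphic_on A"
    by (intro holomorphic_on_compose holomorphic_qprod2 norm_ee_less_1 tau sigma assms holomorphic_intros)
  thus ?thesis by (simp add: o_def qpoch2_def)
qed

lemma holomorphic_ell_Gamma:
  assumes "f holomorphic_on A" "\<And>z. z \<in> A \<Longrightarrow> qpoch2 (f z) \<tau> \<sigma> \<noteq> 0"
  shows "(\<lambda>z. ell_Gamma (f z) \<tau> \<sigma>) holomorphic_on A"
  unfolding ell_Gamma_eq using assms by (intro holomorphic_intros holomorphic_qpoch2) auto

text \<open>At a zero of \<open>qpoch z \<sigma>\<close> the right-hand side is 0 by the convention
  x / 0 = 0, although the left-hand side can be regular and nonzero there, for instance at z =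
  0.\<close>

lemma ell_Gamma_shift:
  assumes "qpoch z \<sigma> \<noteq> 0"
  shows "ell_Gamma (z + \<tau>) \<tau> \<sigma> = theta0 z \<sigma> * ell_Gamma z \<tau> \<sigma>"
  using assms qpoch2_rec[of z] qpoch2_rec[of "\<sigma> - z"]
  by (simp add: ell_Gamma_eq theta0_def field_simps)

lemma ell_Gamma_reflect:
  assumes "qpoch2 z \<tau> \<sigma> \<noteq> 0" "qpoch2 (\<tau> + \<sigma> - z) \<tau> \<sigma> \<noteq> 0"
  shows "ell_Gamma z \<tau> \<sigma> * ell_Gamma (\<tau> + \<sigma> - z) \<tau> \<sigma> = 1"
  using assms by (simp add: ell_Gamma_eq)

lemma ell_Gamma_eq_0_iff:
  "ell_Gamma z \<tau> \<sigma> = 0 \<longleftrightarrow> qpoch2 (\<tau> + \<sigma> - z) \<tau> \<sigma> = 0 \<or> qpoch2 z \<tau> \<sigma> = 0"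
  by (simp add: ell_Gamma_eq)

lemma ell_Gamma_nonzero:
  assumes "0 < Im z" "Im z < Im \<tau> + Im \<sigma>"
  shows "ell_Gamma z \<tau> \<sigma> \<noteq> 0"
  using assms qpoch2_nonzero[of z] qpoch2_nonzero[of "\<tau> + \<sigma> - z"] by (simp add: ell_Gamma_eq_0_iff)

lemma ell_Gamma_dissect: "ell_Gamma z \<tau> \<sigma> = ell_Gamma z \<tau> (2 * \<sigma>) * ell_Gamma (z + \<sigma>) \<tau> (2 * \<sigma>)"
proof -
  have d: "qpoch2 w \<tau> \<sigma> = qpoch2 w \<tau> (2 * \<sigma>) * qpoch2 (w + \<sigma>) \<tau> (2 * \<sigma>)" for w
    using qprod2_dissect[OF norm_ee_less_1[OF tau] norm_ee_less_1[OF sigma], of "ee w"]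
    by (simp add: qpoch2_def ee_double ee_add)
  show ?thesis
    using d[of z] d[of "\<tau> + \<sigma> - z"] sigma
    by (simp add: ell_Gamma_eq two_periods.ell_Gamma_eq[OF two_periods.intro[OF tau]] algebra_simps)
qed

text \<open>Isolates the simple pole at 0: the large quotient is regular there, and
  \<open>ell_Gamma_residue_factor\<close> gives its value.\<close>

lemma ell_Gamma_eq_over_one_minus:
  "ell_Gamma z \<tau> \<sigma> = (qpoch2 (\<tau> + \<sigma> - z) \<tau> \<sigma> / (qpoch (z + \<sigma>) \<sigma> * qpoch2 (z + \<tau>) \<tau> \<sigma>)) / (1 - ee z)"
  using qpoch2_rec[of z] qpoch_rec[OF sigma, of z] by (simp add: ell_Gamma_eq mult_ac)

lemma ell_Gamma_residue_factor:
  "qpoch2 (\<tau> + \<sigma>) \<tau> \<sigma> / (qpoch \<sigma> \<sigma> * qpoch2 \<tau> \<tau> \<sigma>) = 1 / (qpoch \<tau> \<tau> * qpoch \<sigma> \<sigma>)"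
  using qpoch2_rec'[of \<tau>] qpoch2_nonzero[of "\<tau> + \<sigma>"] tau sigma by (simp add: field_simps)

end

section \<open>Rigidity of quasi-periodic entire functions and interpolation\<close>

lemma simple_zero_isolated:
  assumes "g holomorphic_on UNIV" "g z = 0" "deriv g z \<noteq> 0"
  shows "\<exists>r>0. \<forall>w\<in>ball z r - {z}. g w \<noteq> (0::complex)"
proof -
  have "(g has_field_derivative deriv g z) (at z)"
    using assms(1) by (simp add: holomorphic_derivI)
  hence "((\<lambda>w. (g w - g z) / (w - z)) \<longlongrightarrow> deriv g z) (at z)"
    by (simp add: has_field_derivative_iff)
  hence "eventually (\<lambda>w. (g w - g z) / (w - z) \<noteq> 0) (at z)"
    using assms(3) by (rule tendsto_imp_eventually_ne)
  hence "eventually (\<lambda>w. g w \<noteq> 0) (at z)"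
    by eventually_elim (use assms(2) in auto)
  thus ?thesis
    unfolding eventually_at by (auto simp: dist_commute)
qed

text \<open>At a zero of g the quotient is given the value f' / g', the limit of f / g because the
  zero is simple; the singularity is then removable.\<close>

lemma holomorphic_quotient_simple_zeros:
  assumes f: "f holomorphic_on UNIV" and g: "g holomorphic_on UNIV"
    and z: "\<And>z. g z = 0 \<Longrightarrow> f z = 0" "\<And>z. g z = 0 \<Longrightarrow> deriv g z \<noteq> (0::complex)"
  shows "\<exists>k. k holomorphic_on UNIV \<and> (\<forall>z. f z = g z * k z)"
proof -
  define k where "k = (\<lambda>z. if g z = 0 then deriv f z / deriv g z else f z / g z)"
  have "k analytic_on {z0}" for z0
  proof (cases "g z0 = 0")
    case False
    define A where "A = g -` (- {0})"
    have "open A"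
      unfolding A_def using g by (intro open_vimage holomorphic_on_imp_continuous_on) auto
    hence A: "open A" "z0 \<in> A" "\<And>w. w \<in> A \<Longrightarrow> g w \<noteq> 0"
      using False by (auto simp: A_def)
    have "(\<lambda>z. f z / g z) holomorphic_on A"
      using A f g by (intro holomorphic_intros) (auto intro: holomorphic_on_subset)
    hence "k holomorphic_on A"
      by (rule holomorphic_transform) (use A in \<open>auto simp: k_def\<close>)
    thus ?thesis using A by (auto simp: analytic_at)
  next
    case True
    obtain r where r: "r > 0" "\<And>w. w \<in> ball z0 r - {z0} \<Longrightarrow> g w \<noteq> 0"
      using simple_zero_isolated[OF g True z(2)[OF True]] by blast
    have fd: "(f has_field_derivative deriv f z0) (at z0)" "(g has_field_derivative deriv g z0) (at z0)"
      using f g by (simp_all add: holomorphic_derivI)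
    hence "((\<lambda>w. ((f w - f z0) / (w - z0)) / ((g w - g z0) / (w - z0))) \<longlongrightarrow> deriv f z0 / deriv g z0) (at z0)"
      unfolding has_field_derivative_iff using z(2)[OF True] by (intro tendsto_intros) auto
    moreover have "eventually (\<lambda>w. ((f w - f z0) / (w - z0)) / ((g w - g z0) / (w - z0)) = f w / g w) (at z0)"
      unfolding eventually_at by (rule exI[of _ 1]) (use True z(1)[OF True] in auto)
    ultimately have lim: "((\<lambda>w. f w / g w) \<longlongrightarrow> deriv f z0 / deriv g z0) (at z0)"
      by (rule Lim_transform_eventually)
    have "(\<lambda>z. f z / g z) holomorphic_on ball z0 r - {z0}"
      using r f g by (intro holomorphic_intros) (auto intro: holomorphic_on_subset)
    from removable_singularity[OF this _ lim]
    have "(\<lambda>y. if y = z0 then deriv f z0 / deriv g z0 else f y / g y) holomorphic_on ball z0 r"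
      by simp
    hence "k holomorphic_on ball z0 r"
      by (rule holomorphic_transform) (use r True in \<open>auto simp: k_def\<close>)
    thus ?thesis using r(1) by (auto simp: analytic_at intro!: exI[of _ "ball z0 r"])
  qed
  hence "k holomorphic_on UNIV"
    by (meson analytic_imp_holomorphic analytic_on_analytic_at)
  moreover have "f z = g z * k z" for z
    using z(1)[of z] by (auto simp: k_def)
  ultimately show ?thesis by blast
qed

lemma periodic_int:
  fixes k :: "complex \<Rightarrow> 'a"
  assumes "\<And>z. k (z + w) = k z"
  shows "k (z + of_int n * w) = k z"
proof (induction n rule: int_induct[where k=0])
  case (step1 i)
  thus ?case using assms[of "z + of_int i * w"] by (simp add: algebra_simps)
next
  case (step2 i)
  thus ?case using assms[of "z + (of_int i - 1) * w"] by (simp add: algebra_simps)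
qed simp

lemma complex_basis_decomposition:
  assumes "Im \<tau> \<noteq> 0"
  shows "z = of_real (Re z - Im z / Im \<tau> * Re \<tau>) + of_real (Im z / Im \<tau>) * \<tau>"
  using assms by (auto simp: complex_eq_iff)

text \<open>All values are attained on the compact period parallelogram, so Liouville's theorem
  applies.\<close>

lemma doubly_periodic_entire_constant:
  assumes k: "k holomorphic_on UNIV" and t: "Im \<tau> > 0"
    and p1: "\<And>z. k (z + 1) = k z" and p2: "\<And>z. k (z + \<tau>) = k z"
  shows "\<exists>c. \<forall>z. k z = (c::complex)"
proof -
  define F where "F = (\<lambda>(x::real,y::real). of_real x + of_real y * \<tau>)"
  have "range k \<subseteq> k ` F ` ({0..1} \<times> {0..1})"
  proof safe
    fix z
    define x y where "x = Re z - Im z / Im \<tau> * Re \<tau>" and "y = Im z / Im \<tau>"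
    have z: "z = of_real x + of_real y * \<tau>"
      unfolding x_def y_def by (rule complex_basis_decomposition) (use t in auto)
    have "F (frac x, frac y) = z + of_int (- \<lfloor>x\<rfloor>) * 1 + of_int (- \<lfloor>y\<rfloor>) * \<tau>"
      by (simp add: F_def z frac_def algebra_simps)
    hence "k (F (frac x, frac y)) = k z"
      using periodic_int[of k 1 z "-\<lfloor>x\<rfloor>", OF p1]
        periodic_int[of k \<tau> "z + of_int (- \<lfloor>x\<rfloor>) * 1" "-\<lfloor>y\<rfloor>", OF p2] by simp
    moreover have "(frac x, frac y) \<in> {0..1} \<times> {0..1}"
      by (auto intro: less_imp_le frac_lt_1)
    ultimately show "k z \<in> k ` F ` ({0..1} \<times> {0..1})" by (metis image_eqI)
  qed
  moreover have "compact (k ` F ` ({0..1} \<times> {0..1}))"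
    unfolding F_def
    by (intro compact_continuous_image continuous_on_subset[OF holomorphic_on_imp_continuous_on[OF k]] compact_Times)
       (auto intro!: continuous_intros simp: case_prod_unfold)
  ultimately have "bounded (range k)"
    using bounded_subset compact_imp_bounded by blast
  from Liouville_theorem[OF k this] show ?thesis
    by (metis constant_on_def UNIV_I)
qed

text \<open>Cancels a theta function from an identity: the other factor vanishes off the isolated
  zeros, hence at them by continuity. In this way functional equations pass to quotients.\<close>

lemma mult_eq_0_simple_zeros:
  assumes g: "g holomorphic_on UNIV" "\<And>z. g z = 0 \<Longrightarrow> deriv g z \<noteq> 0"
    and d: "continuous_on UNIV d" "\<And>z. g z * d z = (0::complex)"
  shows "d z = 0"
proof (cases "g z = 0")
  case True
  obtain r where r: "r > 0" "\<And>w. w \<in> ball z r - {z} \<Longrightarrow> g w \<noteq> 0"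
    using simple_zero_isolated[OF g(1) True g(2)[OF True]] by blast
  have "eventually (\<lambda>w. d w = 0) (at z)"
    unfolding eventually_at using r d(2) by (intro exI[of _ r]) (auto simp: dist_commute)
  hence "(d \<longlongrightarrow> 0) (at z)" by (simp add: tendsto_eventually)
  moreover have "(d \<longlongrightarrow> d z) (at z)" using d(1) by (simp add: continuous_on_def)
  ultimately show ?thesis by (metis tendsto_unique trivial_limit_at)
qed (use d(2)[of z] in auto)

text \<open>With equal multipliers the quotient is doubly periodic, and it is entire because every
  zero of the denominator is simple and also a zero of the numerator.\<close>

lemma quasi_periodic_unique:
  assumes f: "f holomorphic_on UNIV" and g: "g holomorphic_on UNIV" and t: "Im \<tau> > 0"
    and f1: "\<And>z. f (z + 1) = f z" and g1: "\<And>z. g (z + 1) = g z"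
    and ft: "\<And>z. f (z + \<tau>) = m z * f z" and gt: "\<And>z. g (z + \<tau>) = m z * g z"
    and m: "\<And>z. m z \<noteq> 0"
    and z: "\<And>z. g z = 0 \<Longrightarrow> f z = 0" "\<And>z. g z = 0 \<Longrightarrow> deriv g z \<noteq> (0::complex)"
  shows "\<exists>c. \<forall>z. f z = c * g z"
proof -
  obtain k where k: "k holomorphic_on UNIV" and fk: "\<And>z. f z = g z * k z"
    using holomorphic_quotient_simple_zeros[OF f g z] by blast
  have cont: "continuous_on UNIV (\<lambda>z. k (z + w) - k z)" for w
  proof -
    have "(k \<circ> (\<lambda>z. z + w)) holomorphic_on UNIV"
      by (rule holomorphic_on_compose) (auto intro!: holomorphic_intros holomorphic_on_subset[OF k])
    hence "(\<lambda>z. k (z + w) - k z) holomorphic_on UNIV"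
      using k by (auto simp: o_def intro!: holomorphic_intros)
    thus ?thesis by (rule holomorphic_on_imp_continuous_on)
  qed
  have "g z * (k (z + 1) - k z) = 0" for z
    using fk[of z] fk[of "z + 1"] f1[of z] g1[of z] by (simp add: algebra_simps)
  from mult_eq_0_simple_zeros[OF g z(2) cont this] have p1: "k (z + 1) = k z" for z by (metis eq_iff_diff_eq_0)
  have "g z * (k (z + \<tau>) - k z) = 0" for z
  proof -
    have "m z * (g z * (k (z + \<tau>) - k z)) = 0"
      using fk[of z] fk[of "z + \<tau>"] ft[of z] gt[of z] by (simp add: algebra_simps)
    thus ?thesis using m by simp
  qed
  from mult_eq_0_simple_zeros[OF g z(2) cont this] have p2: "k (z + \<tau>) = k z" for z by (metis eq_iff_diff_eq_0)
  obtain c where "\<And>z. k z = c"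
    using doubly_periodic_entire_constant[OF k t p1 p2] by blast
  thus ?thesis using fk by (intro exI[of _ c]) (simp add: mult.commute)
qed

lemma quasi_periodic_zero_shift:
  fixes f :: "complex \<Rightarrow> complex"
  assumes f1: "\<And>z. f (z + 1) = f z" and ft: "\<And>z. f (z + \<tau>) = m z * f z" and m: "\<And>z. m z \<noteq> 0"
  shows "f (z + of_int n + of_int k * \<tau>) = 0 \<longleftrightarrow> f z = 0"
proof -
  have "(f (z + \<tau>) = 0) = (f z = 0)" for z using ft m by simp
  from periodic_int[of "\<lambda>z. f z = 0", OF this, of "z + of_int n" k]
  show ?thesis using periodic_int[of f 1 z n, OF f1] by simp
qed

text \<open>As a function of z this is, up to a constant, the even theta function of degree two that
  vanishes at a and -a.\<close>

definition theta_pair :: "complex \<Rightarrow> complex \<Rightarrow> complex \<Rightarrow> complex" where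
  "theta_pair \<tau> a z = theta0 (a + z) \<tau> * theta0 (a - z) \<tau>"

lemma theta_pair_swap:
  assumes "Im \<tau> > 0"
  shows "theta_pair \<tau> b a = - ee (b - a) * theta_pair \<tau> a b"
  using theta0_minus[OF assms, of "a - b"] by (simp add: theta_pair_def add.commute)

lemma theta_pair_shift:
  assumes "Im \<tau> > 0"
  shows "theta_pair \<tau> a (z + \<tau>) = ee (- 2 * z - \<tau>) * theta_pair \<tau> a z"
proof -
  have "theta0 (a - z - \<tau>) \<tau> = - ee (a - z - \<tau>) * theta0 (a - z) \<tau>"
    using theta0_eq_shift[OF assms, of "a - z - \<tau>"] by simp
  thus ?thesis
    using theta0_shift[OF assms, of "a + z"]
    using ee_double[of z]
    by (simp add: theta_pair_def algebra_simps ee_add ee_diff ee_minus power2_eq_square)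
qed

lemma holomorphic_theta_pair:
  assumes "Im \<tau> > 0"
  shows "theta_pair \<tau> a holomorphic_on A"
  unfolding theta_pair_def[abs_def] by (intro holomorphic_intros holomorphic_theta0 assms)

text \<open>The hypothesis on 2b keeps b and -b apart modulo the lattice; otherwise the two factors
  would share their zeros and double zeros would arise.\<close>

lemma theta_pair_simple_zeros:
  assumes t: "Im \<tau> > 0" and b: "theta0 (2 * b) \<tau> \<noteq> 0" and z: "theta_pair \<tau> b z = 0"
  shows "deriv (theta_pair \<tau> b) z \<noteq> 0"
    and "\<exists>n k. z = - b + of_int n + of_int k * \<tau> \<or> z = b + of_int n + of_int k * \<tau>"
proof -
  let ?th = "\<lambda>z. theta0 z \<tau>"
  have hol: "?th holomorphic_on UNIV" by (intro holomorphic_theta0 t holomorphic_intros)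
  have d: "(?th has_field_derivative deriv ?th w) (at w)" for w
    using hol by (simp add: holomorphic_derivI)
  have d1: "((\<lambda>z. ?th (b + z)) has_field_derivative deriv ?th (b + z)) (at z)"
    by (rule DERIV_chain'[OF _ d, of "\<lambda>z. b + z" 1, simplified]) (auto intro!: derivative_eq_intros)
  have d2: "((\<lambda>z. ?th (b - z)) has_field_derivative - deriv ?th (b - z)) (at z)"
    by (rule DERIV_chain'[OF _ d, of "\<lambda>z. b - z" "-1", simplified]) (auto intro!: derivative_eq_intros)
  have "(theta_pair \<tau> b has_field_derivative
     deriv ?th (b + z) * ?th (b - z) + - deriv ?th (b - z) * ?th (b + z)) (at z)"
    unfolding theta_pair_def[abs_def] by (rule DERIV_mult[OF d1 d2])
  hence eq: "deriv (theta_pair \<tau> b) z = deriv ?th (b + z) * ?th (b - z) - deriv ?th (b - z) * ?th (b + z)"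
    using DERIV_imp_deriv by fastforce
  have notboth: "\<not> (?th (b + z) = 0 \<and> ?th (b - z) = 0)"
  proof
    assume "?th (b + z) = 0 \<and> ?th (b - z) = 0"
    then obtain n k n' k' :: int where 1: "b + z = of_int n + of_int k * \<tau>" "b - z = of_int n' + of_int k' * \<tau>"
      using theta0_eq_0_iff[OF t] by meson
    have "2 * b = (b + z) + (b - z)" by simp
    also have "\<dots> = of_int (n + n') + of_int (k + k') * \<tau>" unfolding 1 by (simp add: algebra_simps)
    finally have "?th (2 * b) = 0" using theta0_eq_0_iff[OF t] by blast
    thus False using b by simp
  qed
  show "deriv (theta_pair \<tau> b) z \<noteq> 0"
    using z notboth theta0_simple_zero[OF t, of "b + z"] theta0_simple_zero[OF t, of "b - z"]
    unfolding eq by (auto simp: theta_pair_def)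
  from z have "?th (b + z) = 0 \<or> ?th (b - z) = 0" by (simp add: theta_pair_def)
  thus "\<exists>n k. z = - b + of_int n + of_int k * \<tau> \<or> z = b + of_int n + of_int k * \<tau>"
  proof
    assume "?th (b + z) = 0"
    then obtain n k :: int where 1: "b + z = of_int n + of_int k * \<tau>" using theta0_eq_0_iff[OF t] by meson
    hence "z = - b + of_int n + of_int k * \<tau>" by (metis add.commute add.left_commute add_minus_cancel)
    thus ?thesis by blast
  next
    assume "?th (b - z) = 0"
    then obtain n k :: int where 1: "b - z = of_int n + of_int k * \<tau>" using theta0_eq_0_iff[OF t] by meson
    have "z = b - (b - z)" by simp
    also have "\<dots> = b + of_int (- n) + of_int (- k) * \<tau>" unfolding 1 by (simp add: algebra_simps)
    finally show ?thesis by blast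
  qed
qed

text \<open>Even theta functions of degree two form a two-dimensional space; this is the Lagrange
  interpolation formula in it.\<close>

lemma even_theta_interpolation:
  assumes t: "Im \<tau> > 0" and f: "f holomorphic_on UNIV"
    and f1: "\<And>z. f (z + 1) = f z" and ft: "\<And>z. f (z + \<tau>) = ee (- 2 * z - \<tau>) * f z"
    and even: "\<And>z. f (- z) = f z"
    and b: "theta0 (2 * b) \<tau> \<noteq> 0" and ab: "theta_pair \<tau> a b \<noteq> 0"
  shows "theta_pair \<tau> a b * f z = f b * theta_pair \<tau> a z - ee (a - b) * f a * theta_pair \<tau> b z"
proof -
  \<comment> \<open>Subtracting a multiple of \<open>theta_pair \<tau> a\<close> creates zeros at b
    and -b, so the difference is a multiple of \<open>theta_pair \<tau> b\<close>; its coefficient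
    is read off at z = a, where \<open>theta_pair \<tau> a\<close> vanishes.\<close>
  define d where "d = (\<lambda>z. f z - f b / theta_pair \<tau> a b * theta_pair \<tau> a z)"
  have pair1: "theta_pair \<tau> a (z + 1) = theta_pair \<tau> a z" for a z
    using theta0_add_of_int[of "a + z" 1 \<tau>] theta0_add_of_int[of "a - z" "-1" \<tau>]
    by (simp add: theta_pair_def algebra_simps)
  have d1: "d (z + 1) = d z" for z using f1 pair1 by (simp add: d_def)
  have dt: "d (z + \<tau>) = ee (- 2 * z - \<tau>) * d z" for z
    unfolding d_def ft theta_pair_shift[OF t] by (simp add: right_diff_distrib)
  have "theta_pair \<tau> a (- b) = theta_pair \<tau> a b" by (simp add: theta_pair_def)
  hence db: "d b = 0" "d (- b) = 0" using ab by (auto simp: d_def even)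
  have db_shift: "d (b + of_int n + of_int k * \<tau>) = 0" "d (- b + of_int n + of_int k * \<tau>) = 0" for n k
    using db by (simp_all only: quasi_periodic_zero_shift[of d \<tau> "\<lambda>z. ee (- 2 * z - \<tau>)", OF d1 dt ee_nonzero])
  have "\<exists>c. \<forall>z. d z = c * theta_pair \<tau> b z"
  proof (rule quasi_periodic_unique[OF _ holomorphic_theta_pair[OF t] t d1 pair1 dt theta_pair_shift[OF t]])
    show "d holomorphic_on UNIV"
      unfolding d_def by (intro holomorphic_intros f holomorphic_theta_pair t)
    fix z assume z: "theta_pair \<tau> b z = 0"
    show "deriv (theta_pair \<tau> b) z \<noteq> 0"
      by (rule theta_pair_simple_zeros[OF t b z])
    show "d z = 0"
      using theta_pair_simple_zeros(2)[OF t b z] db_shift by metis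
  qed auto
  then obtain c where c: "\<And>z. d z = c * theta_pair \<tau> b z" by blast
  have "theta_pair \<tau> a a = 0" using t by (simp add: theta_pair_def)
  hence "f a = c * theta_pair \<tau> b a" using c[of a] by (simp add: d_def)
  hence "f a * ee (a - b) = - c * theta_pair \<tau> a b"
    unfolding theta_pair_swap[OF t, of b a] by (simp add: ee_diff)
  thus ?thesis
    using c[of z] ab by (simp add: d_def field_simps)
qed

text \<open>To be applied to the times at which a path passes through a given point with nonzero
  velocity.\<close>

lemma countable_isolated_points:
  fixes A :: "'a::second_countable_topology set"
  assumes "\<And>x. x \<in> A \<Longrightarrow> \<exists>U. open U \<and> U \<inter> A = {x}"
  shows "countable A"
proof -
  obtain B :: "'a set set" where B: "countable B" "topological_basis B"
    using ex_countable_basis by blast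
  have "\<exists>b. b \<in> B \<and> b \<inter> A = {x}" if x: "x \<in> A" for x
  proof -
    obtain U where U: "open U" "U \<inter> A = {x}" using assms[OF x] by blast
    then obtain b where "b \<in> B" "x \<in> b" "b \<subseteq> U"
      using topological_basisE[OF B(2) U(1), of x] by blast
    thus ?thesis using U(2) x by blast
  qed
  then obtain b where b: "\<And>x. x \<in> A \<Longrightarrow> b x \<in> B \<and> b x \<inter> A = {x}" by metis
  have "inj_on b A"
    by (rule inj_onI) (metis b the_elem_eq)
  moreover have "countable (b ` A)"
    using b by (intro countable_subset[OF _ B(1)]) auto
  ultimately show ?thesis using countable_image_inj_on by blast
qed

section \<open>Cycles in the cylinder\<close>

text \<open>A path may stay at a point for a set of times of positive measure, but almost all of
  these times are zeros of its derivative.\<close>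

lemma contour_integral_cong_countable:
  assumes g: "valid_path g" and S: "countable S"
    and eq: "\<And>z. z \<in> path_image g \<Longrightarrow> z \<notin> S \<Longrightarrow> f z = f' z"
  shows "contour_integral g f = contour_integral g f'"
proof -
  obtain N where N: "finite N" "\<And>x. x \<in> {0..1} - N \<Longrightarrow> g differentiable (at x)"
    using g unfolding valid_path_def piecewise_C1_differentiable_on_def C1_differentiable_on_eq by auto
  define A where "A = (\<lambda>p. {x \<in> {0..1} - N. g x = p \<and> vector_derivative g (at x) \<noteq> 0})"
  have "countable (A p)" for p
  proof (rule countable_isolated_points)
    fix x assume x: "x \<in> A p"
    define v where "v = vector_derivative g (at x)"
    have v: "v \<noteq> 0" "g x = p" using x by (auto simp: A_def v_def)
    have "(g has_vector_derivative v) (at x)"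
      using N(2)[of x] x by (auto simp: A_def v_def vector_derivative_works)
    \<comment> \<open>Near x the path deviates from its tangent by at most half of the linear term,
      so it cannot return to p.\<close>
    then obtain d where d: "d > 0"
      "\<And>y. norm (y - x) < d \<Longrightarrow> norm (g y - g x - (y - x) *\<^sub>R v) \<le> norm v / 2 * norm (y - x)"
      unfolding has_vector_derivative_def has_derivative_at_alt
      using v(1) by (elim conjE allE[of _ "norm v / 2"]) auto
    have "g y \<noteq> p" if "y \<noteq> x" "dist y x < d" for y
    proof
      assume "g y = p"
      hence "norm ((y - x) *\<^sub>R v) \<le> norm v / 2 * norm (y - x)"
        using d(2)[of y] that v(2) by (simp add: dist_norm)
      hence "norm v * \<bar>y - x\<bar> \<le> norm v / 2 * \<bar>y - x\<bar>" by (simp add: mult.commute)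
      thus False using v(1) that(1) by (simp add: mult_le_cancel_right)
    qed
    hence "ball x d \<inter> A p = {x}"
      using x d(1) \<open>\<And>y. y \<noteq> x \<Longrightarrow> dist y x < d \<Longrightarrow> g y \<noteq> p\<close> unfolding A_def
      by (force simp: dist_commute)
    thus "\<exists>U. open U \<and> U \<inter> A p = {x}" by blast
  qed
  hence c: "countable (N \<union> (\<Union>p\<in>S. A p))"
    using N(1) S by (auto intro: countable_finite)
  have neg: "negligible (N \<union> (\<Union>p\<in>S. A p))"
    using countable_imp_null_set_lborel[OF c] by (simp add: negligible_iff_null_sets null_sets_completionI)
  show ?thesis
    unfolding contour_integral_integral
  proof (rule integral_spike[OF neg])
    \<comment> \<open>Off the exceptional times either the point avoids S or the velocity is 0, and
      in the second case both integrands vanish.\<close>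
    fix x :: real assume x: "x \<in> {0..1} - (N \<union> (\<Union>p\<in>S. A p))"
    show "f' (g x) * vector_derivative g (at x) = f (g x) * vector_derivative g (at x)"
      using x eq[of "g x"] by (cases "g x \<in> S") (auto simp: A_def path_image_def)
  qed
qed

section \<open>Residue calculus for functions of period 1\<close>

definition lower :: "(complex \<Rightarrow> complex) \<Rightarrow> complex \<Rightarrow> complex" where
  "lower f x = f (Ln x / (2 * of_real pi * \<i>))"

lemma ee_Ln: "x \<noteq> 0 \<Longrightarrow> ee (Ln x / (2 * of_real pi * \<i>)) = x"
  by (simp add: ee_def)

lemma ee_eq_iff: "ee z = ee w \<longleftrightarrow> (\<exists>n::int. z = w + of_int n)"
proof -
  have "ee z = ee w \<longleftrightarrow> ee (z - w) = 1" by (simp add: ee_diff)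
  also have "\<dots> \<longleftrightarrow> (\<exists>n::int. z - w = of_int n)" by (rule ee_eq_1_iff)
  also have "\<dots> \<longleftrightarrow> (\<exists>n::int. z = w + of_int n)" by (simp add: diff_eq_eq add.commute)
  finally show ?thesis .
qed

lemma periodic_1_eq:
  assumes "\<And>z. f (z + 1) = f z" "ee z = ee w"
  shows "f z = f w"
proof -
  obtain n :: int where "z = w + of_int n * 1" using assms(2) by (auto simp: ee_eq_iff)
  thus ?thesis using periodic_int[of f 1 w n, OF assms(1)] by simp
qed

text \<open>After division by 2 \<pi> i the logarithm in \<open>lower\<close> is determined up to an
  integer, and period 1 absorbs this ambiguity.\<close>

lemma lower_ee:
  assumes "\<And>z. f (z + 1) = f z"
  shows "lower f (ee t) = f t"
  unfolding lower_def by (rule periodic_1_eq[of f, OF assms]) (simp add: ee_Ln)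

text \<open>The branch is centred at t, so it is differentiable at \<open>ee t\<close> even if this
  point lies on the cut of \<open>Ln\<close>.\<close>

lemma local_inverse_ee:
  defines "l \<equiv> (\<lambda>t x. t + Ln (x / ee t) / (2 * of_real pi * \<i>))"
  shows "x \<noteq> 0 \<Longrightarrow> ee (l t x) = x" "l t (ee t) = t"
    and "l t field_differentiable at (ee t)"
proof -
  show "x \<noteq> 0 \<Longrightarrow> ee (l t x) = x" using ee_Ln[of "x / ee t"] by (simp add: l_def ee_add)
  show "l t (ee t) = t" by (simp add: l_def)
  have "((\<lambda>x. t + Ln (x / ee t) / (2 * of_real pi * \<i>)) has_field_derivative
     (inverse (ee t / ee t) * (1 / ee t) / (2 * of_real pi * \<i>))) (at (ee t))"
    by (auto intro!: derivative_eq_intros simp: complex_nonpos_Reals_iff)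
  thus "l t field_differentiable at (ee t)"
    unfolding l_def field_differentiable_def by blast
qed

lemma lower_differentiable:
  assumes p: "\<And>z. f (z + 1) = f z" and f: "f field_differentiable at t"
  shows "lower f field_differentiable at (ee t)"
proof -
  define l where "l = (\<lambda>x. t + Ln (x / ee t) / (2 * of_real pi * \<i>))"
  have l: "\<And>x. x \<noteq> 0 \<Longrightarrow> ee (l x) = x" "l (ee t) = t" "l field_differentiable at (ee t)"
    unfolding l_def using local_inverse_ee(1)[of _ t] local_inverse_ee(2,3)[of t] by auto
  have "(f \<circ> l) field_differentiable at (ee t)"
    using f l by (intro field_differentiable_compose) auto
  moreover have "eventually (\<lambda>x. (f \<circ> l) x = lower f x) (nhds (ee t))"
  proof -
    have "eventually (\<lambda>x. x \<in> - {0}) (nhds (ee t))" by (intro eventually_nhds_in_open) auto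
    thus ?thesis
    proof eventually_elim
      case (elim x)
      thus ?case using lower_ee[of f "l x", OF p] l(1)[of x] by simp
    qed
  qed
  ultimately show ?thesis
    unfolding field_differentiable_def using DERIV_cong_ev by blast
qed

text \<open>The factor 1 / (2 \<pi> i x) is dt/dx for x = \<open>ee t\<close>, so the residue in x
  is the residue of f in t.\<close>

lemma residue_lower:
  assumes p: "\<And>z. f (z + 1) = f z" and r: "r > 0"
    and f: "\<And>z. z \<in> ball t r - {t} \<Longrightarrow> f field_differentiable at z"
    and lim: "((\<lambda>z. f z * (z - t)) \<longlongrightarrow> c) (at t)"
  shows "residue (\<lambda>x. lower f x / (2 * of_real pi * \<i> * x)) (ee t) = c"
proof -
  define l where "l = (\<lambda>x. t + Ln (x / ee t) / (2 * of_real pi * \<i>))"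
  have l: "\<And>x. x \<noteq> 0 \<Longrightarrow> ee (l x) = x" "l (ee t) = t" "l field_differentiable at (ee t)"
    unfolding l_def using local_inverse_ee(1)[of _ t] local_inverse_ee(2,3)[of t] by auto
  have cont: "isCont l (ee t)"
    using l(3) by (rule field_differentiable_imp_continuous_at)
  have low: "lower f x = f (l x)" if "x \<noteq> 0" for x
    using lower_ee[of f "l x", OF p] l(1)[OF that] by simp
  have ev0: "eventually (\<lambda>x. x \<noteq> 0) (at (ee t))"
    by (rule eventually_mono[OF eventually_at_in_open'[of "- {0}"]]) auto
  have evne: "eventually (\<lambda>x. x \<noteq> 0 \<and> l x \<noteq> t) (at (ee t))"
    using ev0 eventually_neq_at_within[of "ee t" "ee t" UNIV]
    by eventually_elim (use l(1) in metis)
  have "filterlim l (nhds t) (at (ee t))" using cont l(2) by (metis isCont_def)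
  hence fl: "filterlim l (at t) (at (ee t))"
    using evne by (auto simp: filterlim_at elim: eventually_mono)
  have "((\<lambda>z. (ee z - ee t) / (z - t)) \<longlongrightarrow> 2 * of_real pi * \<i> * ee t) (at t)"
    using has_field_derivative_ee[OF DERIV_ident, of t UNIV] unfolding has_field_derivative_iff by simp
  moreover have "((\<lambda>z. ee z) \<longlongrightarrow> ee t) (at t)"
    using continuous_on_ee[of UNIV "\<lambda>z. z"] by (simp add: continuous_on_def)
  ultimately have "((\<lambda>z. f z * (z - t) * ((ee z - ee t) / (z - t)) / (2 * of_real pi * \<i> * ee z)) \<longlongrightarrow>
     c * (2 * of_real pi * \<i> * ee t) / (2 * of_real pi * \<i> * ee t)) (at t)"
    by (intro tendsto_intros lim) auto
  hence "((\<lambda>z. f z * (z - t) * ((ee z - ee t) / (z - t)) / (2 * of_real pi * \<i> * ee z)) \<longlongrightarrow> c) (at t)"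
    by simp
  from filterlim_compose[OF this fl]
  have lim': "((\<lambda>x. f (l x) * (l x - t) * ((ee (l x) - ee t) / (l x - t)) / (2 * of_real pi * \<i> * ee (l x)))
     \<longlongrightarrow> c) (at (ee t))" .
  have "((\<lambda>x. lower f x / (2 * of_real pi * \<i> * x) * (x - ee t)) \<longlongrightarrow> c) (at (ee t))"
    by (rule Lim_transform_eventually[OF lim'])
       (use evne in eventually_elim, auto simp: low l(1) field_simps)
  moreover have "eventually (\<lambda>x. lower f field_differentiable at x \<and> x \<noteq> 0) (at (ee t))"
  proof -
    have "eventually (\<lambda>x. l x \<in> ball t r - {t}) (at (ee t))"
      using fl r by (auto simp: filterlim_def le_filter_def eventually_filtermap
          intro!: eventually_at_in_open elim!: allE[of _ "\<lambda>x. x \<in> ball t r - {t}"])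
    with ev0 show ?thesis
    proof eventually_elim
      case (elim x)
      thus ?case using lower_differentiable[of f "l x", OF p f] l(1)[of x] by auto
    qed
  qed
  then obtain d where d: "d > 0" "\<And>x. x \<noteq> ee t \<Longrightarrow> dist x (ee t) < d \<Longrightarrow> lower f field_differentiable at x \<and> x \<noteq> 0"
    unfolding eventually_at by auto
  have "(\<lambda>x. lower f x / (2 * of_real pi * \<i> * x)) holomorphic_on ball (ee t) d - {ee t}"
  proof (intro holomorphic_intros)
    show "lower f holomorphic_on ball (ee t) d - {ee t}"
      unfolding holomorphic_on_def
    proof
      fix x assume "x \<in> ball (ee t) d - {ee t}"
      hence "lower f field_differentiable at x" using d(2)[of x] by (simp add: dist_commute)
      thus "lower f field_differentiable at x within ball (ee t) d - {ee t}"
        by (rule field_differentiable_at_within)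
    qed
    fix x assume "x \<in> ball (ee t) d - {ee t}"
    thus "2 * of_real pi * \<i> * x \<noteq> 0" using d(2)[of x] by (simp add: dist_commute)
  qed
  ultimately show ?thesis
    using d(1) by (intro residue_simple'[of "ball (ee t) d"]) auto
qed

lemma contour_integral_ee:
  assumes p: "\<And>z. f (z + 1) = f z" and g: "valid_path g"
  shows "contour_integral (ee \<circ> g) (\<lambda>x. lower f x / (2 * of_real pi * \<i> * x)) = contour_integral g f"
proof -
  have "ee holomorphic_on UNIV" using holomorphic_ee[of "\<lambda>z. z" UNIV] by simp
  hence an: "ee analytic_on UNIV" by (simp add: analytic_on_open)
  have d: "deriv ee w = 2 * of_real pi * \<i> * ee w" for w
    using has_field_derivative_ee[of "\<lambda>z. z" 1 w UNIV] by (intro DERIV_imp_deriv) simp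
  show ?thesis
    unfolding contour_integral_comp_analyticW[OF an g subset_UNIV] d lower_ee[of f, OF p] by simp
qed

lemma valid_path_ee: "valid_path g \<Longrightarrow> valid_path (ee \<circ> g)"
  using valid_path_compose_holomorphic[of g ee UNIV] holomorphic_ee[of "\<lambda>z. z" UNIV] by simp

text \<open>The image of g1 followed by the reversed image of g2 is a loop in the plane of x =
  \<open>ee t\<close>, to which the residue theorem applies. Equality of the winding numbers off S,
  in particular around 0, takes the place of a homotopy between cycles in the cylinder.\<close>

lemma periodic_residue_theorem:
  assumes p: "\<And>z. f (z + 1) = f z"
    and g: "valid_path g1" "valid_path g2" "pathstart g1 = pathstart g2" "pathfinish g1 = pathfinish g2"
      "pathfinish g1 = pathstart g1 + 1"
    and S: "open S" "connected S" "0 \<notin> S" "finite P"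
    and f: "\<And>t. ee t \<in> S - P \<Longrightarrow> f field_differentiable at t"
    and im: "path_image (ee \<circ> g1) \<subseteq> S - P" "path_image (ee \<circ> g2) \<subseteq> S - P" "P \<subseteq> S"
    and w: "\<And>x. x \<notin> S \<Longrightarrow> winding_number (ee \<circ> g1) x = winding_number (ee \<circ> g2) x"
  shows "contour_integral g1 f - contour_integral g2 f = 2 * of_real pi * \<i> *
    (\<Sum>x\<in>P. (winding_number (ee \<circ> g1) x - winding_number (ee \<circ> g2) x) *
        residue (\<lambda>x. lower f x / (2 * of_real pi * \<i> * x)) x)"
proof -
  define F where "F = (\<lambda>x. lower f x / (2 * of_real pi * \<i> * x))"
  note v = valid_path_ee[OF g(1)] valid_path_ee[OF g(2)]
  have hol: "F holomorphic_on S - P"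
    unfolding F_def
  proof (intro holomorphic_intros)
    show "lower f holomorphic_on S - P"
      unfolding holomorphic_on_def
    proof
      fix x assume x: "x \<in> S - P"
      hence "x \<noteq> 0" using S(3) by auto
      hence "lower f field_differentiable at (ee (Ln x / (2 * of_real pi * \<i>)))"
        using x by (intro lower_differentiable p f) (simp add: ee_Ln)
      thus "lower f field_differentiable at x within S - P"
        using \<open>x \<noteq> 0\<close> by (simp add: ee_Ln field_differentiable_at_within)
    qed
  qed (use S(3) in auto)
  have op: "open (S - P)" using S by (simp add: finite_imp_closed open_Diff)
  have ci: "F contour_integrable_on (ee \<circ> g1)" "F contour_integrable_on (ee \<circ> g2)"
    using contour_integrable_holomorphic_simple[OF hol op] v im by auto
  let ?G = "(ee \<circ> g1) +++ reversepath (ee \<circ> g2)"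
  have ends: "pathstart (ee \<circ> g1) = pathstart (ee \<circ> g2)" "pathfinish (ee \<circ> g1) = pathfinish (ee \<circ> g2)"
    using g by (simp_all add: pathstart_compose pathfinish_compose)
  have wn: "winding_number ?G x = winding_number (ee \<circ> g1) x - winding_number (ee \<circ> g2) x"
    if "x \<notin> S - P" for x
  proof -
    have "x \<notin> path_image (ee \<circ> g1)" "x \<notin> path_image (ee \<circ> g2)" using that im by blast+
    thus ?thesis
      using v ends by (subst winding_number_join) (simp_all add: valid_path_imp_path winding_number_reversepath)
  qed
  have "contour_integral ?G F = 2 * pi * \<i> * (\<Sum>x\<in>P. winding_number ?G x * residue F x)"
  proof (rule Residue_theorem[OF S(1,2,4) hol])
    show "valid_path ?G" using v ends by (simp add: valid_path_join)
    show "path_image ?G \<subseteq> S - P" using im ends by (simp add: path_image_join)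
    show "\<forall>z. z \<notin> S \<longrightarrow> winding_number ?G z = 0" using wn w by auto
  qed (use ends in auto)
  moreover have "contour_integral ?G F = contour_integral (ee \<circ> g1) F - contour_integral (ee \<circ> g2) F"
    using ci v by (simp add: contour_integrable_reversepath contour_integral_reversepath)
  ultimately show ?thesis
    using im(3) wn unfolding F_def contour_integral_ee[of f, OF p g(1)] contour_integral_ee[of f, OF p g(2)]
    by (simp add: F_def cong: sum.cong)
qed

lemma ee_in_path_image_iff: "ee z \<in> path_image (ee \<circ> g) \<longleftrightarrow> z \<in> translates g"
proof
  assume "ee z \<in> path_image (ee \<circ> g)"
  then obtain x where "x \<in> path_image g" "ee z = ee x" by (auto simp: path_image_compose)
  thus "z \<in> translates g" by (auto simp: ee_eq_iff translates_def)
next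
  assume "z \<in> translates g"
  then obtain x n where "x \<in> path_image g" "z = x + of_int n" by (auto simp: translates_def)
  hence "ee z = ee x" by (simp add: ee_add)
  thus "ee z \<in> path_image (ee \<circ> g)" using \<open>x \<in> path_image g\<close> by (auto simp: path_image_compose)
qed

section \<open>Winding numbers and the two sides of a cycle\<close>

locale period_path =
  fixes g :: "real \<Rightarrow> complex"
  assumes valid: "valid_path g" and ends: "pathfinish g = pathstart g + 1"
begin

lemma valid_ee: "valid_path (ee \<circ> g)" and loop_ee: "pathfinish (ee \<circ> g) = pathstart (ee \<circ> g)"
  using valid_path_ee[OF valid] ends by (auto simp: pathfinish_compose pathstart_compose ee_add)

lemma zero_notin_path_image_ee: "0 \<notin> path_image (ee \<circ> g)"
  by (auto simp: path_image_compose)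

text \<open>The logarithmic derivative of \<open>ee\<close> is the constant 2 \<pi> i, and the path
  advances by 1.\<close>

lemma winding_number_ee_0: "winding_number (ee \<circ> g) 0 = 1"
proof -
  have "ee analytic_on UNIV" using holomorphic_ee[of "\<lambda>z. z" UNIV] by (simp add: analytic_on_open)
  from contour_integral_comp_analyticW[OF this valid subset_UNIV]
  have "contour_integral (ee \<circ> g) (\<lambda>w. 1 / (w - 0)) = contour_integral g (\<lambda>w. deriv ee w * (1 / (ee w - 0)))" .
  also have "(\<lambda>w. deriv ee w * (1 / (ee w - 0))) = (\<lambda>w. 2 * of_real pi * \<i>)"
  proof
    fix w
    have "deriv ee w = 2 * of_real pi * \<i> * ee w"
      using has_field_derivative_ee[OF DERIV_ident, of w UNIV] by (intro DERIV_imp_deriv) simp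
    thus "deriv ee w * (1 / (ee w - 0)) = 2 * of_real pi * \<i>" by simp
  qed
  also have "contour_integral g (\<lambda>w. 2 * of_real pi * \<i>) = 2 * of_real pi * \<i>"
  proof (rule contour_integral_unique)
    have "((\<lambda>w. 2 * of_real pi * \<i>) has_contour_integral
       (2 * of_real pi * \<i> * pathfinish g - 2 * of_real pi * \<i> * pathstart g)) g"
      by (rule contour_integral_primitive[OF _ valid subset_UNIV]) (auto intro!: derivative_eq_intros)
    thus "((\<lambda>w. 2 * of_real pi * \<i>) has_contour_integral 2 * of_real pi * \<i>) g"
      unfolding ends by (simp add: algebra_simps)
  qed
  finally show ?thesis
    using winding_number_valid_path[OF valid_ee zero_notin_path_image_ee] by (simp add: o_def)
qed

lemma winding_number_ee_connected:
  assumes "connected C" "C \<inter> translates g = {}" "z \<in> C" "w \<in> C"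
  shows "winding_number (ee \<circ> g) (ee z) = winding_number (ee \<circ> g) (ee w)"
proof (rule winding_number_eq[OF valid_path_imp_path[OF valid_ee] loop_ee])
  show "connected (ee ` C)"
    by (rule connected_continuous_image[OF _ assms(1)]) (intro continuous_intros)
  show "ee ` C \<inter> path_image (ee \<circ> g) = {}"
    using assms(2) by (auto simp: ee_in_path_image_iff)
qed (use assms in auto)

text \<open>Far down, \<open>ee\<close> is large and leaves a disc that contains the loop, so the
  winding number is 0 there; along the connected set C it does not change.\<close>

lemma winding_number_ee_below:
  assumes C: "connected C" "C \<inter> translates g = {}" "z \<in> C" and u: "\<And>y. \<exists>w\<in>C. Im w < y"
  shows "winding_number (ee \<circ> g) (ee z) = 0"
proof -
  have "bounded (path_image (ee \<circ> g))"
    using valid_ee valid_path_imp_path bounded_path_image by blast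
  then obtain B where B: "B > 0" "path_image (ee \<circ> g) \<subseteq> ball 0 B"
    by (metis bounded_subset_ballD)
  obtain w where w: "w \<in> C" "Im w < - ln B / (2 * pi)" using u by blast
  have "ln B < - 2 * pi * Im w" using w(2) by (simp add: field_simps)
  hence "B < norm (ee w)"
    using B(1) by (metis exp_less_cancel_iff exp_ln norm_ee)
  hence "winding_number (ee \<circ> g) (ee w) = 0"
    using B by (intro winding_number_zero_outside[of _ "ball 0 B"] valid_path_imp_path valid_ee loop_ee) auto
  thus ?thesis using winding_number_ee_connected[OF C w(1)] by simp
qed

text \<open>Far up, \<open>ee\<close> is close to 0, around which the loop winds once.\<close>

lemma winding_number_ee_above:
  assumes C: "connected C" "C \<inter> translates g = {}" "z \<in> C" and u: "\<And>y. \<exists>w\<in>C. y < Im w"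
  shows "winding_number (ee \<circ> g) (ee z) = 1"
proof -
  have "open (- path_image (ee \<circ> g))"
    using valid_ee valid_path_imp_path closed_path_image by blast
  then obtain r where r: "r > 0" "ball 0 r \<subseteq> - path_image (ee \<circ> g)"
    using zero_notin_path_image_ee by (metis ComplI open_contains_ball)
  obtain w where w: "w \<in> C" "- ln r / (2 * pi) < Im w" using u by blast
  have "- 2 * pi * Im w < ln r" using w(2) by (simp add: field_simps)
  hence "norm (ee w) < r"
    using r(1) by (metis exp_less_cancel_iff exp_ln norm_ee)
  hence "winding_number (ee \<circ> g) (ee w) = winding_number (ee \<circ> g) 0"
    using r by (intro winding_number_eq[of _ _ "ball 0 r"] valid_path_imp_path valid_ee loop_ee) auto
  thus ?thesis using winding_number_ee_connected[OF C w(1)] winding_number_ee_0 by simp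
qed

text \<open>Turns the topological condition on a cycle into the information that the residue theorem
  takes.\<close>

lemma lies_below_winding:
  assumes "lies_below p g"
  shows "p \<notin> translates g" "winding_number (ee \<circ> g) (ee p) = 0"
proof -
  let ?C = "connected_component_set (- translates g) p"
  have u: "\<exists>w\<in>?C. Im w < y" for y using assms by (auto simp: lies_below_def)
  then obtain w where "connected_component (- translates g) p w" by auto
  hence p: "p \<in> - translates g" using connected_component_in by blast
  thus "p \<notin> translates g" by simp
  show "winding_number (ee \<circ> g) (ee p) = 0"
    by (rule winding_number_ee_below[of ?C])
       (use u p connected_component_subset[of "- translates g" p] in \<open>auto simp: connected_component_refl\<close>)
qed

lemma lies_above_winding:
  assumes "lies_above p g"
  shows "p \<notin> translates g" "winding_number (ee \<circ> g) (ee p) = 1"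
proof -
  let ?C = "connected_component_set (- translates g) p"
  have u: "\<exists>w\<in>?C. Im w > y" for y using assms by (auto simp: lies_above_def)
  then obtain w where "connected_component (- translates g) p w" by auto
  hence p: "p \<in> - translates g" using connected_component_in by blast
  thus "p \<notin> translates g" by simp
  show "winding_number (ee \<circ> g) (ee p) = 1"
    by (rule winding_number_ee_above[of ?C])
       (use u p connected_component_subset[of "- translates g" p] in \<open>auto simp: connected_component_refl\<close>)
qed

end

section \<open>Moving cycles to the real period and to a parallel line\<close>

definition rseg :: "real \<Rightarrow> complex" where "rseg = linepath (-1/2) (1/2)"

lemma rseg_props [simp]: "valid_path rseg" "pathstart rseg = -1/2" "pathfinish rseg = 1/2"
  by (simp_all add: rseg_def)

lemma Im_rseg: "z \<in> path_image rseg \<Longrightarrow> Im z = 0"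
  by (auto simp: rseg_def closed_segment_def)

lemma Im_translates_rseg: "z \<in> translates rseg \<Longrightarrow> Im z = 0"
  by (auto simp: translates_def dest: Im_rseg)

interpretation rseg: period_path rseg
  by unfold_locales auto

lemma rseg_winding:
  "Im z > 0 \<Longrightarrow> winding_number (ee \<circ> rseg) (ee z) = 1"
  "Im z < 0 \<Longrightarrow> winding_number (ee \<circ> rseg) (ee z) = 0"
proof -
  assume "Im z > 0"
  thus "winding_number (ee \<circ> rseg) (ee z) = 1"
  proof (intro rseg.winding_number_ee_above[of "{w. Im w > 0}"])
    show "\<exists>w\<in>{w. Im w > 0}. y < Im w" for y
      by (rule bexI[of _ "of_real (max y 0 + 1) * \<i>"]) auto
  qed (auto dest: Im_translates_rseg intro: convex_connected convex_halfspace_Im_gt)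
next
  assume "Im z < 0"
  thus "winding_number (ee \<circ> rseg) (ee z) = 0"
  proof (intro rseg.winding_number_ee_below[of "{w. Im w < 0}"])
    show "\<exists>w\<in>{w. Im w < 0}. Im w < y" for y
      by (rule bexI[of _ "of_real (min y 0 - 1) * \<i>"]) auto
  qed (auto dest: Im_translates_rseg intro: convex_connected convex_halfspace_Im_lt)
qed

text \<open>The points lie on a logarithmic spiral. Their moduli form a geometric progression, so
  the only finite accumulation point is 0.\<close>

lemma closed_spiral:
  assumes h: "Im h > 0"
  shows "closed (insert 0 {ee (of_int k * h) |k. k \<in> K})"
proof -
  define A where "A = insert 0 {ee (of_int k * h) |k. k \<in> K}"
  have "open (- A)"
  proof (rule openI)
    fix x assume x: "x \<in> - A"
    hence x0: "x \<noteq> 0" by (auto simp: A_def)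
    \<comment> \<open>This annulus around x contains finitely many of the points, because its two
      radii bound k from both sides.\<close>
    define U where "U = {w :: complex. norm x / 2 < norm w} \<inter> {w. norm w < 2 * norm x}"
    define F where "F = {ee (of_int k * h) |k. k \<in> K \<and> ee (of_int k * h) \<in> U}"
    define a b where "a = - ln (2 * norm x) / (2 * pi * Im h)" and "b = - ln (norm x / 2) / (2 * pi * Im h)"
    have "k \<in> {\<lfloor>a\<rfloor>..\<lceil>b\<rceil>}" if "ee (of_int k * h) \<in> U" for k
    proof -
      have n: "norm x / 2 < exp (- 2 * pi * (of_int k * Im h))" "exp (- 2 * pi * (of_int k * Im h)) < 2 * norm x"
        using that by (simp_all add: U_def norm_ee)
      have "ln (norm x / 2) < - 2 * pi * (of_int k * Im h)" "- 2 * pi * (of_int k * Im h) < ln (2 * norm x)"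
        using n x0 ln_less_cancel_iff[of "norm x / 2" "exp (- 2 * pi * (of_int k * Im h))"]
          ln_less_cancel_iff[of "exp (- 2 * pi * (of_int k * Im h))" "2 * norm x"] by auto
      hence "of_int k < b" "a < of_int k"
        using h unfolding a_def b_def by (simp_all add: field_simps)
      thus ?thesis by (simp add: floor_le_iff le_ceiling_iff)
    qed
    hence "F \<subseteq> (\<lambda>k. ee (of_int k * h)) ` {\<lfloor>a\<rfloor>..\<lceil>b\<rceil>}" by (auto simp: F_def)
    hence "finite F" by (rule finite_subset) auto
    hence "open (U - F)" unfolding U_def
      by (intro open_Diff finite_imp_closed open_Int open_Collect_less continuous_intros)
    moreover have "x \<in> U - F" using x x0 by (auto simp: U_def F_def A_def)
    moreover have "U - F \<subseteq> - A"  using x0 by (auto simp: U_def F_def A_def)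
    ultimately show "\<exists>e>0. ball x e \<subseteq> - A"
      by (meson open_contains_ball subset_trans)
  qed
  thus ?thesis unfolding A_def by (simp add: closed_def)
qed

lemma ee_mult_eq_iff:
  assumes "Im h > 0"
  shows "ee (of_int k * h) = ee (of_int l * h) \<longleftrightarrow> k = l"
proof
  assume "ee (of_int k * h) = ee (of_int l * h)"
  then obtain n :: int where "of_int k * h = of_int l * h + of_int n" by (auto simp: ee_eq_iff)
  hence "Im (of_int k * h) = Im (of_int l * h + of_int n)" by simp
  thus "k = l" using assms by simp
qed auto

text \<open>The cycle and the real period disagree only about h and -h: h is below the cycle but
  above the real line, and -h conversely. All other poles lie on the same side of both, since the
  remaining indices in \<open>Ka\<close> exceed 1 and those in \<open>Kb\<close> are less than -1.
  The numbers \<open>cp\<close> and \<open>cm\<close> are the residues at h and -h.\<close>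

lemma cycle_integral:
  assumes h: "Im h > 0" and p: "\<And>z. f (z + 1) = f z"
    and g: "valid_path g" "pathstart g = -1/2" "pathfinish g = 1/2"
    and Ka: "\<And>k. k \<in> Ka \<Longrightarrow> lies_above (of_int k * h) g" "-1 \<in> Ka" "\<And>k. k \<in> Ka \<Longrightarrow> k \<noteq> -1 \<Longrightarrow> k > 1"
    and Kb: "\<And>k. k \<in> Kb \<Longrightarrow> lies_below (of_int k * h) g" "1 \<in> Kb" "\<And>k. k \<in> Kb \<Longrightarrow> k \<noteq> 1 \<Longrightarrow> k < -1"
    and f: "\<And>t. (\<And>k n. k \<in> Ka \<union> Kb \<Longrightarrow> t \<noteq> of_int n + of_int k * h) \<Longrightarrow> f field_differentiable at t"
    and lim: "((\<lambda>z. f z * (z - h)) \<longlongrightarrow> cp) (at h)" "((\<lambda>z. f z * (z + h)) \<longlongrightarrow> cm) (at (-h))"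
  shows "contour_integral g f = contour_integral rseg f + 2 * of_real pi * \<i> * (cm - cp)"
    and "f contour_integrable_on g"
proof -
  interpret period_path g by unfold_locales (use g in auto)
  define K where "K = Ka \<union> Kb - {1, -1}"
  \<comment> \<open>The plane of x = \<open>ee t\<close> without 0 and without the poles other than
    \<open>ee h\<close> and \<open>ee (- h)\<close>; it is connected because only countably many
    points are removed.\<close>
  define S where "S = - (insert 0 {ee (of_int k * h) |k. k \<in> K})"
  define P where "P = {ee h, ee (- h)}"
  have inP: "ee (of_int k * h) \<in> P" if "k \<in> Ka \<union> Kb" "k \<notin> K" for k
    using that by (auto simp: P_def K_def)
  have hne: "ee h \<noteq> ee (- h)" using ee_mult_eq_iff[OF h, of 1 "-1"] by simp
  have PS: "P \<subseteq> S"
    using ee_mult_eq_iff[OF h, of 1] ee_mult_eq_iff[OF h, of "-1"] by (auto simp: P_def S_def K_def)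
  have diff: "f field_differentiable at t" if "ee t \<in> S - P" for t
  proof (rule f)
    fix k n assume k: "k \<in> Ka \<union> Kb"
    show "t \<noteq> of_int n + of_int k * h"
    proof
      assume "t = of_int n + of_int k * h"
      hence "ee t = ee (of_int k * h)" by (simp add: ee_add)
      thus False using that k inP[OF k] by (cases "k \<in> K") (auto simp: S_def)
    qed
  qed
  have "countable {ee (of_int k * h) |k. k \<in> K}"
    by (rule countable_subset[of _ "range (\<lambda>k::int. ee (of_int k * h))"]) auto
  hence conS: "connected S"
    unfolding S_def Compl_eq_Diff_UNIV
    by (intro connected_open_diff_countable) auto
  have opS: "open S" unfolding S_def using closed_spiral[OF h] by (simp add: open_Compl)
  have notin: "ee (of_int k * h) \<notin> path_image (ee \<circ> g)" if "k \<in> Ka \<union> Kb" for k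
    using that lies_above_winding(1)[OF Ka(1)] lies_below_winding(1)[OF Kb(1)]
    by (auto simp: ee_in_path_image_iff)
  have im1: "path_image (ee \<circ> g) \<subseteq> S - P"
    using notin zero_notin_path_image_ee notin[of 1] notin[of "-1"] Ka(2) Kb(2)
    by (auto simp: S_def P_def K_def)
  have ne0: "k \<noteq> 0" if "k \<in> Ka \<union> Kb" for k using that Ka(3)[of k] Kb(3)[of k] by force
  have notin2: "ee (of_int k * h) \<notin> path_image (ee \<circ> rseg)" if "k \<in> Ka \<union> Kb" for k
    using that Im_translates_rseg[of "of_int k * h"] ne0[of k] h by (auto simp: ee_in_path_image_iff)
  have im2: "path_image (ee \<circ> rseg) \<subseteq> S - P"
    using notin2 rseg.zero_notin_path_image_ee notin2[of 1] notin2[of "-1"] Ka(2) Kb(2)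
    by (auto simp: S_def P_def K_def)
  have wa: "winding_number (ee \<circ> rseg) (ee (of_int k * h)) = 1" if "k > 0" for k
    using that h by (intro rseg_winding) simp
  have wb: "winding_number (ee \<circ> rseg) (ee (of_int k * h)) = 0" if "k < 0" for k
    using that h by (intro rseg_winding) (simp add: mult_neg_pos)
  have w: "winding_number (ee \<circ> g) x = winding_number (ee \<circ> rseg) x" if xS: "x \<notin> S" for x
  proof -
    consider "x = 0" | k where "k \<in> K" "x = ee (of_int k * h)" using xS by (auto simp: S_def)
    thus ?thesis
    proof cases
      case 1
      thus ?thesis using winding_number_ee_0 rseg.winding_number_ee_0 by simp
    next
      case (2 k)
      show ?thesis
      proof (cases "k \<in> Ka")
        case True
        thus ?thesis using 2 Ka(3)[of k] lies_above_winding(2)[OF Ka(1)[OF True]] wa[of k] by (auto simp: K_def)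
      next
        case False
        hence "k \<in> Kb" "k \<noteq> 1" using 2 by (auto simp: K_def)
        thus ?thesis using 2 Kb(3)[of k] lies_below_winding(2)[OF Kb(1)[of k]] wb[of k] by auto
      qed
    qed
  qed
  have op: "open (ee -` (S - Q))" if "finite Q" for Q
    using opS that continuous_on_ee[of UNIV "\<lambda>z. z"]
    by (intro open_vimage open_Diff finite_imp_closed) auto
  have finP: "finite P" by (simp add: P_def)
  have res: "residue (\<lambda>x. lower f x / (2 * of_real pi * \<i> * x)) (ee t) = c"
    if t: "ee t \<in> P" and lim: "((\<lambda>z. f z * (z - t)) \<longlongrightarrow> c) (at t)" for t c
  proof -
    have "t \<in> ee -` (S - (P - {ee t}))" using t PS by auto
    then obtain r where r: "r > 0" "ball t r \<subseteq> ee -` (S - (P - {ee t}))"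
      using op[of "P - {ee t}"] finite_Diff[OF finP] unfolding open_contains_ball by blast
    show ?thesis
    \<comment> \<open>A radius of at most 1 excludes the other integer translates of t, which have
      the same image under \<open>ee\<close>.\<close>
    proof (rule residue_lower[OF p _ _ lim, of "min r 1"])
      fix z assume z: "z \<in> ball t (min r 1) - {t}"
      have "ee z \<noteq> ee t"
      proof
        assume "ee z = ee t"
        then obtain n :: int where n: "z = t + of_int n" by (auto simp: ee_eq_iff)
        hence "\<bar>of_int n :: real\<bar> < 1" using z by (simp add: dist_norm)
        thus False using n z by auto
      qed
      thus "f field_differentiable at z" using z r(2) by (intro diff) auto
    qed (use r in auto)
  qed
  have wh: "winding_number (ee \<circ> g) (ee h) = 0" "winding_number (ee \<circ> g) (ee (- h)) = 1"
    "winding_number (ee \<circ> rseg) (ee h) = 1" "winding_number (ee \<circ> rseg) (ee (- h)) = 0"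
    using lies_below_winding(2)[OF Kb(1)[OF Kb(2)]] lies_above_winding(2)[OF Ka(1)[OF Ka(2)]]
      wa[of 1] wb[of "-1"] by simp_all
  have "contour_integral g f - contour_integral rseg f = 2 * of_real pi * \<i> *
    (\<Sum>x\<in>P. (winding_number (ee \<circ> g) x - winding_number (ee \<circ> rseg) x) *
        residue (\<lambda>x. lower f x / (2 * of_real pi * \<i> * x)) x)"
    by (rule periodic_residue_theorem[OF p g(1) _ _ _ _ opS conS _ _ diff im1 im2 PS w])
       (use g in \<open>auto simp: P_def S_def\<close>)
  also have "(\<Sum>x\<in>P. (winding_number (ee \<circ> g) x - winding_number (ee \<circ> rseg) x) *
        residue (\<lambda>x. lower f x / (2 * of_real pi * \<i> * x)) x) = cm - cp"
    using hne res[OF _ lim(1)] res[of "- h" cm] lim(2) by (simp add: P_def wh)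
  finally show "contour_integral g f = contour_integral rseg f + 2 * of_real pi * \<i> * (cm - cp)"
    by (simp add: algebra_simps)
  have "f holomorphic_on ee -` (S - P)"
    unfolding holomorphic_on_def by (auto intro!: field_differentiable_at_within diff)
  thus "f contour_integrable_on g"
    by (rule contour_integrable_holomorphic_simple) (use im1 op[of P] g in \<open>auto simp: P_def path_image_compose\<close>)
qed

text \<open>The real period is pushed down to the line through -2h, and -h is the only pole passed
  modulo 1. The strip in the hypothesis exceeds the swept region by Im h / 2 at both ends.\<close>

lemma line_shift_integral:
  assumes h: "Im h > 0" and p: "\<And>z. f (z + 1) = f z"
    and f: "\<And>t. - (5/2) * Im h < Im t \<Longrightarrow> Im t < Im h / 2 \<Longrightarrow> (\<And>n. t \<noteq> of_int n - h) \<Longrightarrow> f field_differentiable at t"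
    and lim: "((\<lambda>z. f z * (z + h)) \<longlongrightarrow> cm) (at (-h))"
  shows "contour_integral (linepath (-1/2 - 2 * h) (1/2 - 2 * h)) f = contour_integral rseg f + 2 * of_real pi * \<i> * cm"
proof -
  define g1 g2 g3 where "g1 = linepath (-1/2) (-1/2 - 2 * h)" and "g2 = linepath (-1/2 - 2 * h) (1/2 - 2 * h)"
    and "g3 = linepath (1/2 - 2 * h) (1/2)"
  define g where "g = g1 +++ (g2 +++ g3)"
  have gv: "valid_path g" "pathstart g = -1/2" "pathfinish g = 1/2"
    unfolding g_def g1_def g2_def g3_def by (auto intro!: valid_path_join)
  interpret period_path g by unfold_locales (use gv in auto)
  have pg: "path_image g = closed_segment (-1/2) (-1/2 - 2 * h) \<union>
      (closed_segment (-1/2 - 2 * h) (1/2 - 2 * h) \<union> closed_segment (1/2 - 2 * h) (1/2))"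
    unfolding g_def g1_def g2_def g3_def by (simp add: path_image_join)
  have cases: "\<exists>x y. z = of_real x + of_real y * h \<and> -2 \<le> y \<and> y \<le> 0 \<and> (x = -1/2 \<or> x = 1/2 \<or> y = -2)"
    if z: "z \<in> path_image g" for z
  proof -
    consider u where "z = (1 - of_real u) * (-1/2) + of_real u * (-1/2 - 2 * h)" "0 \<le> u" "u \<le> 1"
      | u where "z = (1 - of_real u) * (-1/2 - 2 * h) + of_real u * (1/2 - 2 * h)" "0 \<le> u" "u \<le> 1"
      | u where "z = (1 - of_real u) * (1/2 - 2 * h) + of_real u * (1/2)" "0 \<le> u" "u \<le> 1"
      using z unfolding pg closed_segment_def scaleR_conv_of_real by auto
    thus ?thesis
    proof cases
      case (1 u)
      have "z = of_real (-1/2) + of_real (-2 * u) * h" unfolding 1(1) by (simp add: field_simps)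
      moreover have "-2 \<le> -2 * u" "-2 * u \<le> 0" using 1 by auto
      ultimately show ?thesis by blast
    next
      case (2 u)
      have "z = of_real (u - 1/2) + of_real (-2) * h" unfolding 2(1) by (simp add: field_simps)
      moreover have "-2 \<le> (-2::real)" "-2 \<le> (0::real)" by auto
      ultimately show ?thesis by blast
    next
      case (3 u)
      have "z = of_real (1/2) + of_real (2 * u - 2) * h" unfolding 3(1) by (simp add: field_simps)
      moreover have "-2 \<le> 2 * u - 2" "2 * u - 2 \<le> 0" using 3 by auto
      ultimately show ?thesis by blast
    qed
  qed
  have notmul: "z \<notin> translates g" if z: "z = of_real y * h" "y > -2" for z y
  proof
    assume "z \<in> translates g"
    then obtain w n where "w \<in> path_image g" and w: "z = w + of_int n" by (auto simp: translates_def)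
    then obtain x y' where c: "w = of_real x + of_real y' * h" "x = -1/2 \<or> x = 1/2 \<or> y' = -2"
      using cases by blast
    have "Im z = Im (w + of_int n)" using w by simp
    hence "y = y'" using z(1) c(1) h by simp
    have "Re z = Re (w + of_int n)" using w by simp
    hence "x + of_int n = 0" using z(1) c(1) \<open>y = y'\<close> by simp
    hence "2 * x = of_int (- 2 * n)" by simp
    with c(2) \<open>y = y'\<close> z(2) have "of_int (2 * n) = (1::real) \<or> of_int (2 * n) = (-1 :: real)" by auto
    hence "2 * n = 1 \<or> 2 * n = -1" by linarith
    thus False by presburger
  qed
  \<comment> \<open>The moduli of \<open>ee t\<close> on the lines Im t = Im h / 2 and Im t = -(5/2)
    Im h that bound the strip.\<close>
  define r R where "r = exp (- pi * Im h)" and "R = exp (5 * pi * Im h)"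
  have rR: "0 < r" "r < 1" "1 < R" using h by (auto simp: r_def R_def)
  define S where "S = {x :: complex. r < norm (x - 0) \<and> norm (x - 0) < R}"
  have eeS: "ee t \<in> S \<longleftrightarrow> - (5/2) * Im h < Im t \<and> Im t < Im h / 2" for t
  proof -
    have "- pi * Im h < - 2 * pi * Im t \<longleftrightarrow> pi * (2 * Im t) < pi * Im h"
      "- 2 * pi * Im t < 5 * pi * Im h \<longleftrightarrow> pi * (- 5 * Im h) < pi * (2 * Im t)"
      by (auto simp: algebra_simps)
    thus ?thesis
      unfolding S_def r_def R_def mem_Collect_eq diff_0_right norm_ee exp_less_cancel_iff
        mult_less_cancel_left_pos[OF pi_gt_zero] by auto
  qed
  have imz: "Im z = y * Im h" if "z = of_real x + of_real y * h" for z x y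
    using that by simp
  have im1: "path_image (ee \<circ> g) \<subseteq> S - {ee (- h)}"
  proof
    fix x assume x: "x \<in> path_image (ee \<circ> g)"
    then obtain z where z: "z \<in> path_image g" "x = ee z" by (auto simp: path_image_compose)
    obtain x' y where c: "z = of_real x' + of_real y * h" "-2 \<le> y" "y \<le> 0" using cases[OF z(1)] by blast
    have "-2 * Im h \<le> Im z" "Im z \<le> 0" unfolding imz[OF c(1)]
      using c h mult_right_mono[of "-2" y "Im h"] by (auto simp: mult_nonpos_nonneg)
    hence "x \<in> S" unfolding z(2) eeS using h by auto
    moreover have "x \<noteq> ee (- h)" using notmul[of "-h" "-1"] x by (auto simp: ee_in_path_image_iff)
    ultimately show "x \<in> S - {ee (- h)}" by simp
  qed
  have im2: "path_image (ee \<circ> rseg) \<subseteq> S - {ee (- h)}"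
  proof
    fix x assume x: "x \<in> path_image (ee \<circ> rseg)"
    then obtain z where z: "z \<in> path_image rseg" "x = ee z" by (auto simp: path_image_compose)
    hence "x \<in> S" unfolding z(2) eeS using h Im_rseg[OF z(1)] by auto
    moreover have "x \<noteq> ee (- h)" using Im_translates_rseg[of "-h"] x h by (auto simp: ee_in_path_image_iff)
    ultimately show "x \<in> S - {ee (- h)}" by simp
  qed
  have w: "winding_number (ee \<circ> g) x = winding_number (ee \<circ> rseg) x" if xS: "x \<notin> S" for x
  proof (cases "norm x \<le> r")
    case True
    have "winding_number (ee \<circ> g) x = winding_number (ee \<circ> g) 0"
      by (rule winding_number_eq[of _ _ "cball 0 r"])
         (use valid_ee loop_ee True rR im1 in \<open>force simp: valid_path_imp_path S_def\<close>)+
    moreover have "winding_number (ee \<circ> rseg) x = winding_number (ee \<circ> rseg) 0"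
      by (rule winding_number_eq[of _ _ "cball 0 r"])
         (use rseg.valid_ee rseg.loop_ee True rR im2 in \<open>force simp: valid_path_imp_path S_def\<close>)+
    ultimately show ?thesis using winding_number_ee_0 rseg.winding_number_ee_0 by simp
  next
    case False
    hence xR: "x \<notin> ball 0 R" using xS by (auto simp: S_def)
    have "winding_number (ee \<circ> g) x = 0"
      by (rule winding_number_zero_outside[of _ "ball 0 R"])
         (use valid_ee loop_ee xR im1 in \<open>force simp: valid_path_imp_path S_def\<close>)+
    moreover have "winding_number (ee \<circ> rseg) x = 0"
      by (rule winding_number_zero_outside[of _ "ball 0 R"])
         (use rseg.valid_ee rseg.loop_ee xR im2 in \<open>force simp: valid_path_imp_path S_def\<close>)+
    ultimately show ?thesis by simp
  qed
  have diff: "f field_differentiable at t" if t: "ee t \<in> S - {ee (- h)}" for t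
  proof (rule f)
    show "- (5/2) * Im h < Im t" "Im t < Im h / 2" using t unfolding Diff_iff eeS by auto
    show "t \<noteq> of_int n - h" for n using t by (auto simp: ee_diff ee_minus)
  qed
  \<comment> \<open>In the real basis 1, h of the plane, the ray from -h in the direction of h has
    abscissa 0 and ordinates at least -1, whereas the sides of the translated path have
    half-integral abscissas and its bottom has ordinate -2.\<close>
  have wg: "winding_number (ee \<circ> g) (ee (- h)) = 1"
  proof (rule winding_number_ee_above[of "(\<lambda>y. of_real y * h) ` {-1..}"])
    show "connected ((\<lambda>y. complex_of_real y * h) ` {-1..})"
      by (intro connected_continuous_image continuous_intros) auto
    show "(\<lambda>y. complex_of_real y * h) ` {-1..} \<inter> translates g = {}"
      using notmul by fastforce
    show "- h \<in> (\<lambda>y. complex_of_real y * h) ` {-1..}" by (rule image_eqI[of _ _ "-1"]) auto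
    fix y
    have "y < Im (complex_of_real (\<bar>y\<bar> / Im h + 1) * h)"
    proof -
      have "Im (complex_of_real (\<bar>y\<bar> / Im h + 1) * h) = (\<bar>y\<bar> / Im h + 1) * Im h"
        by (simp only: times_complex.sel Im_complex_of_real Re_complex_of_real)
      also have "\<dots> = \<bar>y\<bar> + Im h" using h by (simp add: field_simps)
      finally show ?thesis using h by linarith
    qed
    moreover have "\<bar>y\<bar> / Im h + 1 \<in> {-1..}" using h by (auto intro!: order.trans[of "-1" 0] add_nonneg_nonneg)
    ultimately show "\<exists>w\<in>(\<lambda>y. complex_of_real y * h) ` {-1..}. y < Im w" by blast
  qed
  have wr: "winding_number (ee \<circ> rseg) (ee (- h)) = 0" using h by (intro rseg_winding) simp
  have conS: "connected S" unfolding S_def by (intro connected_annulus) auto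
  have opS: "open S" unfolding S_def by (intro open_Collect_conj open_Collect_less continuous_intros)
  have mS: "ee (- h) \<in> S" unfolding eeS using h by simp
  have res: "residue (\<lambda>x. lower f x / (2 * of_real pi * \<i> * x)) (ee (- h)) = cm"
  proof -
    have "open (ee -` S)" using opS continuous_on_ee[of UNIV "\<lambda>z. z"] by (intro open_vimage) auto
    then obtain r where r: "r > 0" "ball (-h) r \<subseteq> ee -` S"
      using mS unfolding open_contains_ball by blast
    show ?thesis
    proof (rule residue_lower[of f "min r 1", OF p])
    show "((\<lambda>z. f z * (z - - h)) \<longlongrightarrow> cm) (at (- h))" using lim by simp
    show "min r 1 > 0" using r by simp
    fix z assume z: "z \<in> ball (- h) (min r 1) - {- h}"
    have "ee z \<noteq> ee (- h)"
    proof
      assume "ee z = ee (- h)"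
      then obtain n :: int where n: "z = - h + of_int n" by (auto simp: ee_eq_iff)
      hence "\<bar>of_int n :: real\<bar> < 1" using z by (simp add: dist_norm)
      thus False using n z by auto
    qed
    thus "f field_differentiable at z" using z r(2) by (intro diff) auto
    qed
  qed
  have "contour_integral g f - contour_integral rseg f = 2 * of_real pi * \<i> *
    (\<Sum>x\<in>{ee (- h)}. (winding_number (ee \<circ> g) x - winding_number (ee \<circ> rseg) x) *
        residue (\<lambda>x. lower f x / (2 * of_real pi * \<i> * x)) x)"
    by (rule periodic_residue_theorem[OF p gv(1) _ _ _ _ opS conS _ _ diff im1 im2 _ w])
       (use gv mS rR in \<open>auto simp: S_def\<close>)
  hence "contour_integral g f - contour_integral rseg f = 2 * of_real pi * \<i> * cm"
    by (simp add: wg wr res)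
  hence main: "contour_integral g f = contour_integral rseg f + 2 * of_real pi * \<i> * cm"
    by (simp add: algebra_simps)
  have "f holomorphic_on ee -` (S - {ee (- h)})"
    unfolding holomorphic_on_def by (auto intro!: field_differentiable_at_within diff)
  hence cont: "continuous_on (path_image g) f"
    using im1 by (intro continuous_on_subset[OF holomorphic_on_imp_continuous_on]) (auto simp: path_image_compose)
  have ci: "f contour_integrable_on g1" "f contour_integrable_on g2" "f contour_integrable_on g3"
    unfolding g1_def g2_def g3_def
    by (intro contour_integrable_continuous_linepath continuous_on_subset[OF cont]; unfold pg; blast)+
  have "contour_integral g f = contour_integral g1 f + (contour_integral g2 f + contour_integral g3 f)"
    unfolding g_def using ci by (subst contour_integral_join contour_integrable_joinI |
      simp add: g1_def g2_def g3_def)+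
  \<comment> \<open>The two sides differ by the period 1 and are traversed in opposite
    directions.\<close>
  moreover have "contour_integral g3 f = - contour_integral g1 f"
  proof -
    have "contour_integral g3 f = contour_integral (linepath (-1/2 - 2 * h) (-1/2)) f"
      unfolding contour_integral_integral g3_def
    proof (rule arg_cong[where f="integral {0..1}"], rule ext)
      fix x
      have "linepath (1/2 - 2 * h) (1/2) x = linepath (-1/2 - 2 * h) (-1/2) x + 1"
        by (simp add: linepath_def scaleR_conv_of_real algebra_simps)
      thus "f (linepath (1/2 - 2 * h) (1/2) x) * vector_derivative (linepath (1/2 - 2 * h) (1/2)) (at x) =
            f (linepath (-1/2 - 2 * h) (-1/2) x) * vector_derivative (linepath (-1/2 - 2 * h) (-1/2)) (at x)"
        using p by simp
    qed
    also have "\<dots> = - contour_integral g1 f"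
      unfolding g1_def by (rule contour_integral_reverse_linepath, rule continuous_on_subset[OF cont])
        (simp add: pg closed_segment_commute)
    finally show ?thesis .
  qed
  ultimately show ?thesis using main by (simp add: g2_def)
qed

lemma contour_integral_odd_segment:
  assumes odd: "\<And>z. f (2 * c - z) = - f z" and cont: "continuous_on (closed_segment (c - a) (c + a)) f"
  shows "contour_integral (linepath (c - a) (c + a)) f = 0"
proof -
  let ?r = "\<lambda>z. 2 * c - z"
  have "?r holomorphic_on UNIV" by (intro holomorphic_intros)
  hence an: "?r analytic_on UNIV" by (simp add: analytic_on_open)
  have d: "deriv ?r w = - 1" for w by (rule DERIV_imp_deriv) (auto intro!: derivative_eq_intros)
  have "contour_integral (?r \<circ> linepath (c - a) (c + a)) f = contour_integral (linepath (c - a) (c + a)) (\<lambda>w. - f (2 * c - w))"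
    using contour_integral_comp_analyticW[OF an valid_path_linepath subset_UNIV, of "c - a" "c + a" f] unfolding d by simp
  also have "(\<lambda>w. - f (2 * c - w)) = f" using odd by simp
  also have "?r \<circ> linepath (c - a) (c + a) = linepath (c + a) (c - a)"
    by (auto simp: linepath_def scaleR_conv_of_real algebra_simps)
  also have "contour_integral (linepath (c + a) (c - a)) f = - contour_integral (linepath (c - a) (c + a)) f"
    by (rule contour_integral_reverse_linepath) (use cont in \<open>simp add: closed_segment_commute\<close>)
  finally show ?thesis by simp
qed

text \<open>In the real basis \<open>1\<close>, \<open>h + 1/4\<close> of the plane the points \<open>\<plusminus>h\<close> have abscissas \<open>\<mp>1/4\<close>,
  so a graph can pass above the one and below the other.\<close>

lemma separating_cycle_exists:
  assumes h: "Im h > 0"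
  shows "\<exists>g. valid_path g \<and> pathstart g = -1/2 \<and> pathfinish g = 1/2 \<and>
     (\<forall>(k::int) (n::int). k = -1 \<or> k \<ge> 3 \<longrightarrow> lies_above (of_int n + of_int k * h) g) \<and>
     (\<forall>(k::int) (n::int). k = 1 \<or> k \<le> -3 \<longrightarrow> lies_below (of_int n + of_int k * h) g)"
proof -
  define v where "v = h + 1/4"
  \<comment> \<open>At the abscissas -1/4 of h and 1/4 of -h the graph has the heights 2 and -2,
    beyond the ordinates 1 and -1 of these points; the amplitude 2 keeps it away from all ordinates
    of modulus at least 3.\<close>
  define F where "F = (\<lambda>x::real. - 2 * sin (2 * pi * x))"
  define g where "g = (\<lambda>s::real. of_real (s - 1/2) + of_real (F (s - 1/2)) * v)"
  have "valid_path ((\<lambda>x. x + (- 2 * sin (2 * of_real pi * x)) * v) \<circ> linepath (-1/2) (1/2))"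
    by (rule valid_path_compose_holomorphic[of _ _ UNIV]) (auto intro!: holomorphic_intros)
  also have "(\<lambda>x. x + (- 2 * sin (2 * of_real pi * x)) * v) \<circ> linepath (-1/2) (1/2) = g"
  proof
    fix s :: real
    have "linepath (-1/2) (1/2) s = (of_real (s - 1/2) :: complex)"
      by (simp add: linepath_def scaleR_conv_of_real field_simps)
    moreover have "sin (2 * of_real pi * (of_real (s - 1/2) :: complex)) = of_real (sin (2 * pi * (s - 1/2)))"
      unfolding sin_of_real[symmetric] by (rule arg_cong[of _ _ sin]) simp
    ultimately show "((\<lambda>x. x + (- 2 * sin (2 * of_real pi * x)) * v) \<circ> linepath (-1/2) (1/2)) s = g s"
      by (simp add: g_def F_def)
  qed
  finally have valid: "valid_path g" .
  have st: "pathstart g = -1/2" "pathfinish g = 1/2"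
    by (simp_all add: g_def F_def pathstart_def pathfinish_def v_def)
  have F1: "F (x + of_int n) = F x" for x n
    using sin_int_2pin[of n] cos_int_2pin[of n] by (simp add: F_def distrib_left sin_add mult_ac)
  have uniq: "x = x' \<and> y = y'" if "of_real x + of_real y * v = of_real x' + of_real y' * v" for x y x' y'
  proof -
    have "Im (of_real x + of_real y * v) = Im (of_real x' + of_real y' * v)" using that by simp
    hence "y = y'" using h by (simp add: v_def)
    thus ?thesis using that by simp
  qed
  have tr: "y = F x" if t: "of_real x + of_real y * v \<in> translates g" for x y
  proof -
    obtain s n where "of_real x + of_real y * v = g s + of_int n"
      using t by (auto simp: translates_def path_image_def)
    also have "\<dots> = of_real (s - 1/2 + of_int n) + of_real (F (s - 1/2)) * v" by (simp add: g_def)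
    finally have "x = s - 1/2 + of_int n" "y = F (s - 1/2)" using uniq by blast+
    thus ?thesis using F1 by simp
  qed
  have above: "lies_above (of_real x + of_real y * v) g" if xy: "y > F x" for x y
    unfolding lies_above_def
  proof
    fix b
    define z where "z = of_real x + of_real (\<bar>y\<bar> + \<bar>b\<bar> / Im h + 1) * v"
    have "b < Im z"
    proof -
      have "Im z = (\<bar>y\<bar> + \<bar>b\<bar> / Im h + 1) * Im h"
        by (simp add: z_def v_def del: of_real_add of_real_divide)
      also have "\<dots> = \<bar>y\<bar> * Im h + \<bar>b\<bar> + Im h" using h by (simp add: field_simps)
      also have "\<dots> > b" using h mult_nonneg_nonneg[of "\<bar>y\<bar>" "Im h"] by linarith
      finally show ?thesis .
    qed
    moreover have "connected_component (- translates g) (of_real x + of_real y * v) z"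
      unfolding connected_component_def
    proof (intro exI conjI)
      show "connected ((\<lambda>y. of_real x + of_real y * v) ` {y..})"
        by (intro connected_continuous_image continuous_intros) auto
      show "(\<lambda>y. of_real x + of_real y * v) ` {y..} \<subseteq> - translates g"
        using tr xy by fastforce
      show "z \<in> (\<lambda>y. of_real x + of_real y * v) ` {y..}"
        unfolding z_def using h by (intro imageI) (auto intro: add_nonneg_nonneg order.trans[OF abs_ge_self])
    qed auto
    ultimately show "\<exists>z. connected_component (- translates g) (of_real x + of_real y * v) z \<and> b < Im z" by blast
  qed
  have below: "lies_below (of_real x + of_real y * v) g" if xy: "y < F x" for x y
    unfolding lies_below_def
  proof
    fix b
    define z where "z = of_real x + of_real (- (\<bar>y\<bar> + \<bar>b\<bar> / Im h + 1)) * v"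
    have "Im z < b"
    proof -
      have "Im z = - (\<bar>y\<bar> + \<bar>b\<bar> / Im h + 1) * Im h"
        by (simp add: z_def v_def del: of_real_add of_real_divide of_real_minus)
      also have "\<dots> = - (\<bar>y\<bar> * Im h + \<bar>b\<bar> + Im h)" using h by (simp add: field_simps)
      also have "\<dots> < b" using h mult_nonneg_nonneg[of "\<bar>y\<bar>" "Im h"] by linarith
      finally show ?thesis .
    qed
    moreover have "connected_component (- translates g) (of_real x + of_real y * v) z"
      unfolding connected_component_def
    proof (intro exI conjI)
      show "connected ((\<lambda>y. of_real x + of_real y * v) ` {..y})"
        by (intro connected_continuous_image continuous_intros) auto
      show "(\<lambda>y. of_real x + of_real y * v) ` {..y} \<subseteq> - translates g"
        using tr xy by fastforce
      have "- y \<le> \<bar>y\<bar> + \<bar>b\<bar> / Im h + 1" using h abs_ge_minus_self[of y]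
        by (intro order.trans[OF abs_ge_minus_self]) simp
      thus "z \<in> (\<lambda>y. of_real x + of_real y * v) ` {..y}"
        unfolding z_def by (intro imageI) auto
    qed auto
    ultimately show "\<exists>z. connected_component (- translates g) (of_real x + of_real y * v) z \<and> Im z < b" by blast
  qed
  have conv: "of_int n + of_int k * h = of_real (of_int n - of_int k / 4) + of_real (of_int k) * v" for n k
    by (simp add: v_def field_simps)
  have bd: "F x \<le> 2" "F x \<ge> -2" for x
    using sin_ge_minus_one[of "2 * pi * x"] sin_le_one[of "2 * pi * x"] unfolding F_def by linarith+
  have val: "F (of_int n - of_int k / 4) = 2 * sin (of_int k * pi / 2)" for n k
    using F1[of "- of_int k / 4" n] by (simp add: F_def add.commute mult_ac)
  have "lies_above (of_int n + of_int k * h) g" if "k = -1 \<or> k \<ge> 3" for k n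
    unfolding conv
  proof (rule above)
    show "of_int k > F (of_int n - of_int k / 4)"
    proof (cases "k = -1")
      case True
      thus ?thesis using val[of n k] by simp
    next
      case False
      hence "3 \<le> real_of_int k" using that by simp
      thus ?thesis using bd(1)[of "of_int n - of_int k / 4"] by linarith
    qed
  qed
  moreover have "lies_below (of_int n + of_int k * h) g" if "k = 1 \<or> k \<le> -3" for k n
    unfolding conv
  proof (rule below)
    show "of_int k < F (of_int n - of_int k / 4)"
    proof (cases "k = 1")
      case True
      thus ?thesis using val[of n k] by simp
    next
      case False
      hence "real_of_int k \<le> -3" using that by simp
      thus ?thesis using bd(2)[of "of_int n - of_int k / 4"] by linarith
    qed
  qed
  ultimately show ?thesis using valid st by blast
qed

section \<open>Strips without zeros, and the basic pole of the Gamma function\<close>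

lemma theta0_nonzero:
  assumes "0 < Im z" "Im z < Im \<tau>"
  shows "theta0 z \<tau> \<noteq> 0"
  using assms qpoch_nonzero[of \<tau> z] qpoch_nonzero[of \<tau> "\<tau> - z"] by (simp add: theta0_def)

lemma qpoch_nonzero_between:
  assumes "- Im \<tau> < Im z" "Im z < 0"
  shows "qpoch z \<tau> \<noteq> 0"
proof -
  have t: "Im \<tau> > 0" using assms by linarith
  have "1 - ee z \<noteq> 0"
  proof
    assume "1 - ee z = 0"
    then obtain k :: int where "z = of_int k" using ee_eq_1_iff[of z] by auto
    thus False using assms by simp
  qed
  thus ?thesis using assms t qpoch_rec[OF t, of z] qpoch_nonzero[OF t, of "z + \<tau>"] by simp
qed

lemma theta0_add_1 [simp]: "theta0 (z + 1) \<tau> = theta0 z \<tau>" "theta0 (z - 1) \<tau> = theta0 z \<tau>"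
  using theta0_add_of_int[of z 1 \<tau>] theta0_add_of_int[of z "-1" \<tau>] by simp_all

context two_periods begin

lemma ell_Gamma_add_1: "ell_Gamma (z + 1) \<tau> \<sigma> = ell_Gamma z \<tau> \<sigma>" "ell_Gamma (z - 1) \<tau> \<sigma> = ell_Gamma z \<tau> \<sigma>"
  using ell_Gamma_add_of_int[of z 1] ell_Gamma_add_of_int[of z "-1"] by simp_all

lemma holomorphic_ell_Gamma_upper:
  assumes "f holomorphic_on A" "\<And>z. z \<in> A \<Longrightarrow> Im (f z) > 0"
  shows "(\<lambda>z. ell_Gamma (f z) \<tau> \<sigma>) holomorphic_on A"
  using assms qpoch2_nonzero by (intro holomorphic_ell_Gamma) auto

lemma ell_Gamma_shift_upper:
  "Im z > 0 \<Longrightarrow> ell_Gamma (z + \<tau>) \<tau> \<sigma> = theta0 z \<sigma> * ell_Gamma z \<tau> \<sigma>"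
  by (intro ell_Gamma_shift qpoch_nonzero sigma)

text \<open>The pole comes from the factor 1 - \<open>ee z\<close> in the denominator, whose
  derivative at 0 accounts for the sign and for 2 \<pi> i.\<close>

lemma ell_Gamma_pole:
  "((\<lambda>z. ell_Gamma (z - p) \<tau> \<sigma> * (z - p)) \<longlongrightarrow> - 1 / (2 * of_real pi * \<i> * (qpoch \<tau> \<tau> * qpoch \<sigma> \<sigma>))) (at p)"
proof -
  define r where "r = (\<lambda>z. qpoch2 (\<tau> + \<sigma> - z) \<tau> \<sigma> / (qpoch (z + \<sigma>) \<sigma> * qpoch2 (z + \<tau>) \<tau> \<sigma>))"
  define A where "A = {z. Im z > - Im \<sigma>} \<inter> {z. Im z > - Im \<tau>}"
  have A: "open A" "0 \<in> A" unfolding A_def using tau sigma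
    by (auto intro!: open_Int open_halfspace_Im_gt)
  have "r holomorphic_on A"
    unfolding r_def A_def
    by (intro holomorphic_intros holomorphic_qpoch2 holomorphic_qpoch sigma)
       (auto simp: qpoch_nonzero sigma qpoch2_nonzero)
  hence "isCont r 0" using A by (metis holomorphic_on_imp_continuous_on continuous_on_eq_continuous_at)
  moreover have "r 0 = 1 / (qpoch \<tau> \<tau> * qpoch \<sigma> \<sigma>)"
    using ell_Gamma_residue_factor by (simp add: r_def)
  ultimately have r: "(r \<longlongrightarrow> 1 / (qpoch \<tau> \<tau> * qpoch \<sigma> \<sigma>)) (at 0)" by (metis isCont_def)
  have "((\<lambda>z. (ee z - ee 0) / (z - 0)) \<longlongrightarrow> 2 * of_real pi * \<i> * 1 * ee 0) (at 0)"
    using has_field_derivative_ee[OF DERIV_ident, of 0 UNIV] unfolding has_field_derivative_iff .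
  hence "((\<lambda>z. r z * - inverse ((ee z - ee 0) / (z - 0))) \<longlongrightarrow>
     1 / (qpoch \<tau> \<tau> * qpoch \<sigma> \<sigma>) * - inverse (2 * of_real pi * \<i> * 1 * ee 0)) (at 0)"
    by (intro tendsto_intros r) auto
  moreover have "r z * - inverse ((ee z - ee 0) / (z - 0)) = ell_Gamma z \<tau> \<sigma> * z" for z
  proof -
    have E: "ell_Gamma z \<tau> \<sigma> = r z / (1 - ee z)"
      by (simp add: ell_Gamma_eq_over_one_minus[of z] r_def)
    show ?thesis unfolding E by (cases "ee z = 1") (auto simp: field_simps)
  qed
  ultimately have "((\<lambda>z. ell_Gamma z \<tau> \<sigma> * z) \<longlongrightarrow>
     1 / (qpoch \<tau> \<tau> * qpoch \<sigma> \<sigma>) * - inverse (2 * of_real pi * \<i> * 1 * ee 0)) (at 0)"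
    by simp
  hence "((\<lambda>z. ell_Gamma z \<tau> \<sigma> * z) \<longlongrightarrow> - 1 / (2 * of_real pi * \<i> * (qpoch \<tau> \<tau> * qpoch \<sigma> \<sigma>))) (at 0)"
    by (simp add: field_simps)
  thus ?thesis
    by (intro LIM_offset_zero_cancel[of _ p]) simp
qed

end

section \<open>An elliptic beta integral\<close>

text \<open>In the application s = \<kappa> h with \<kappa> \<ge> 4; the beta integral is treated
  for every s with this bound on its imaginary part.\<close>

locale beta_setup =
  fixes h s :: complex
  assumes h: "Im h > 0" and s: "Im s \<ge> 4 * Im h"
begin

sublocale two_periods "4 * h" "2 * s"
  by unfold_locales (use h s in auto)

sublocale half: two_periods "4 * h" s
  by unfold_locales (use h s in auto)

abbreviation "G z \<equiv> ell_Gamma z (4 * h) (2 * s)"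
abbreviation "th z \<equiv> theta0 z (2 * s)"
abbreviation "th4 z \<equiv> theta0 z (4 * h)"
abbreviation "ths z \<equiv> theta0 z s"

lemma positive: "Im (4 * h) > 0" "Im (2 * s) > 0" "Im s > 0"
  using h s by auto

text \<open>As a meromorphic function this is G(z) G(-z) G(2h + 1/2 + z) G(2h + 1/2 - z) G(s + z)
  G(s - z) / (G(2z) G(-2z)), by the duplication formula and reflection. Thus it hides the three
  half-period parameters of the beta integral.\<close>

definition T :: "complex \<Rightarrow> complex" where
  "T z = ee (- z) * th4 (z + 1/2) * th4 (z + 2 * h) * ths (z + 1/2)"

definition W :: "complex \<Rightarrow> complex \<Rightarrow> complex \<Rightarrow> complex" where
  "W a b z = G (z - h) * G (- z - h) * (G (a + z) * G (a - z)) * (G (b + z) * G (b - z)) * T z"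

text \<open>\<open>W a b\<close> is even, so the residues at h and -h contribute equally to
  \<open>J\<close>; hence the factor 2.\<close>

definition C where "C = 2 / (qpoch (4 * h) (4 * h) * qpoch (2 * s) (2 * s))"

text \<open>The integral of \<open>W a b\<close> over a cycle separating the sequences of poles, written as an integral over
  the real period plus the residues at \<open>\<plusminus>h\<close>.\<close>

definition J :: "complex \<Rightarrow> complex \<Rightarrow> complex" where
  "J a b = contour_integral rseg (W a b) + C * (G (- 2 * h) * (G (a + h) * G (a - h)) * (G (b + h) * G (b - h)) * T h)"

definition X :: "complex \<Rightarrow> complex" where
  "X c = th (c - h) * th (c + 2 * h + 1/2) * ths c"

text \<open>The Gamma functions at c plus one of the parameters -h, 2h + 1/2, 0, s, where those for
  0 and s merge into one of period s by \<open>ell_Gamma_dissect\<close>. For fixed a + b the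
  evaluation of the elliptic beta integral predicts a constant multiple of
  \<open>Pf a * Pf b\<close>.\<close>

definition Pf :: "complex \<Rightarrow> complex" where
  "Pf c = G (c - h) * G (c + 2 * h + 1/2) * ell_Gamma c (4 * h) s"

lemma Pf_shift: "Im c > Im h \<Longrightarrow> Pf (c + 4 * h) = X c * Pf c"
  using ell_Gamma_shift_upper[of "c - h"] ell_Gamma_shift_upper[of "c + 2 * h + 1/2"]
    half.ell_Gamma_shift_upper[of c] h
  by (simp add: Pf_def X_def algebra_simps)

lemma W_shift_fst:
  assumes "\<bar>Im z\<bar> < Im c"
  shows "W (c + 4 * h) d z = W c d z * theta_pair (2 * s) c z"
  using ell_Gamma_shift_upper[of "c + z"] ell_Gamma_shift_upper[of "c - z"] assms
  by (simp add: W_def theta_pair_def algebra_simps)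

lemma W_shift_snd:
  assumes "\<bar>Im z\<bar> < Im d"
  shows "W c (d + 4 * h) z = W c d z * theta_pair (2 * s) d z"
  using ell_Gamma_shift_upper[of "d + z"] ell_Gamma_shift_upper[of "d - z"] assms
  by (simp add: W_def theta_pair_def algebra_simps)

lemma G_real_line:
  assumes "Im z = 0"
  shows "qpoch2 (z - h) (4 * h) (2 * s) \<noteq> 0" "qpoch (z - h) (2 * s) \<noteq> 0"
proof -
  show 1: "qpoch (z - h) (2 * s) \<noteq> 0" using assms h s by (intro qpoch_nonzero_between) auto
  show "qpoch2 (z - h) (4 * h) (2 * s) \<noteq> 0"
    using 1 qpoch2_rec[of "z - h"] qpoch2_nonzero[of "z - h + 4 * h"] assms h by simp
qed

lemma continuous_W:
  assumes "Im a > 0" "Im b > 0"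
  shows "continuous_on (path_image rseg) (W a b)"
proof -
  have "W a b holomorphic_on {z. qpoch2 (z - h) (4 * h) (2 * s) \<noteq> 0 \<and> qpoch2 (- z - h) (4 * h) (2 * s) \<noteq> 0 \<and>
     Im (a + z) > 0 \<and> Im (a - z) > 0 \<and> Im (b + z) > 0 \<and> Im (b - z) > 0}"
    unfolding W_def[abs_def] T_def
    by (intro holomorphic_intros holomorphic_theta0 positive holomorphic_ell_Gamma_upper holomorphic_ell_Gamma) auto
  thus ?thesis
    by (rule continuous_on_subset[OF holomorphic_on_imp_continuous_on])
       (use assms G_real_line in \<open>auto dest!: Im_rseg\<close>)
qed

lemma contour_integral_rseg_reflect: "contour_integral rseg (\<lambda>z. f (- z)) = contour_integral rseg f"
proof -
  have "(\<lambda>z::complex. - z) holomorphic_on UNIV" by (intro holomorphic_intros)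
  hence an: "(\<lambda>z::complex. - z) analytic_on UNIV" by (simp add: analytic_on_open)
  have d: "deriv (\<lambda>z::complex. - z) w = - 1" for w by (rule DERIV_imp_deriv) (auto intro!: derivative_eq_intros)
  have "contour_integral ((\<lambda>z. - z) \<circ> linepath (-1/2) (1/2)) f = contour_integral rseg (\<lambda>w. - f (- w))"
    using contour_integral_comp_analyticW[OF an valid_path_linepath subset_UNIV, of "-1/2" "1/2" f]
    unfolding d rseg_def by simp
  also have "(\<lambda>z. - z) \<circ> linepath (-1/2) (1/2) = reversepath rseg"
    by (rule ext) (simp add: rseg_def linepath_def reversepath_def scaleR_conv_of_real field_simps)
  also have "contour_integral (reversepath rseg) f = - contour_integral rseg f"
    by (rule contour_integral_reversepath) simp
  finally show ?thesis by (simp add: contour_integral_neg)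
qed

text \<open>The part \<open>W c d z * A z\<close> of the integrand in the contiguous relation, where \<open>A\<close> is half of an
  even theta function; it is odd about \<open>-2 h\<close>.\<close>

definition Hodd :: "complex \<Rightarrow> complex \<Rightarrow> complex \<Rightarrow> complex" where
  "Hodd c d z = G (z + 3 * h) * G (- h - z) * (G (c + z + 4 * h) * G (c - z)) * (G (d + z + 4 * h) * G (d - z)) *
      (ee (- 2 * z) * th4 (z + 1/2) * th4 (z + 2 * h) * th (z + 2 * h + 1/2))"

lemma Hodd_periodic: "Hodd c d (z + 1) = Hodd c d z"
proof -
  have eq: "z + 1 + 3 * h = (z + 3 * h) + 1" "- h - (z + 1) = (- h - z) - 1" "c + (z + 1) + 4 * h = (c + z + 4 * h) + 1"
    "c - (z + 1) = (c - z) - 1" "d + (z + 1) + 4 * h = (d + z + 4 * h) + 1" "d - (z + 1) = (d - z) - 1"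
    "z + 1 + 1/2 = (z + 1/2) + 1" "z + 1 + 2 * h = (z + 2 * h) + 1" "z + 2 * h + 1 + 1/2 = (z + 2 * h + 1/2) + 1"
    by simp_all
  have e: "ee (- 2 * (z + 1)) = ee (- 2 * z)" using ee_of_int[of 2] by (simp add: ee_diff distrib_left)
  show ?thesis unfolding Hodd_def e unfolding eq ell_Gamma_add_1 theta0_add_1 ..
qed

lemma Hodd_odd: "Hodd c d (2 * (- 2 * h) - z) = - Hodd c d z"
proof -
  have a: "th4 (2 * (- 2 * h) - z + 1/2) = ee (- 2 * z - 4 * h) * th4 (z + 1/2)"
  proof -
    have "th4 (2 * (- 2 * h) - z + 1/2) = th4 (1/2 - (z + 4 * h))" by (simp add: algebra_simps)
    also have "\<dots> = ee (- (z + 4 * h)) * th4 (z + 4 * h + 1/2)" by (rule theta0_half_minus[OF positive(1)])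
    also have "th4 (z + 4 * h + 1/2) = th4 (z + 1/2 + 4 * h)" by (simp add: algebra_simps)
    also have "\<dots> = - ee (- (z + 1/2)) * th4 (z + 1/2)" by (rule theta0_shift[OF positive(1)])
    also have "ee (- (z + 1/2)) = - ee (- z)" by (subst ee_minus) (simp add: ee_add ee_minus)
    finally show ?thesis using ee_double[of z] by (simp add: ee_diff ee_add ee_minus power2_eq_square)
  qed
  have b: "th4 (2 * (- 2 * h) - z + 2 * h) = - ee (- (z + 2 * h)) * th4 (z + 2 * h)"
  proof -
    have "2 * (- 2 * h) - z + 2 * h = - (z + 2 * h)" by simp
    thus ?thesis using theta0_minus[OF positive(1), of "z + 2 * h"] by (simp only:)
  qed
  have c: "th (2 * (- 2 * h) - z + 2 * h + 1/2) = ee (- (z + 2 * h)) * th (z + 2 * h + 1/2)"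
    using theta0_half_minus[OF positive(2), of "z + 2 * h"] by (simp add: algebra_simps)
  have e: "ee (- 2 * (2 * (- 2 * h) - z)) * ee (- 2 * z - 4 * h) * (ee (- (z + 2 * h)) * ee (- (z + 2 * h))) = ee (- 2 * z)"
    unfolding ee_add[symmetric] by (rule arg_cong[of _ _ ee]) (simp add: algebra_simps)
  have g: "2 * (- 2 * h) - z + 3 * h = - h - z" "- h + z + 4 * h = z + 3 * h"
    "\<And>c. c + (2 * (- 2 * h) - z) + 4 * h = c - z" "\<And>c. c - (2 * (- 2 * h) - z) = c + z + 4 * h"
    by (simp_all add: algebra_simps)
  show ?thesis
    unfolding Hodd_def a b c g e[symmetric] by (simp only: mult_ac mult_minus_left mult_minus_right)
qed

text \<open>In the strip only \<open>G (- h - z)\<close> can have poles, and only at -h modulo 1: a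
  further period raises the pole by at least 4 Im h.\<close>

lemma Hodd_differentiable:
  assumes "Im c > Im h" "Im d > Im h" "- (5/2) * Im h < Im z" "Im z < Im h / 2" "\<And>n. z \<noteq> of_int n - h"
  shows "Hodd c d field_differentiable at z"
proof -
  define A where "A = ({z. Im z > - (5/2) * Im h} \<inter> {z. Im z < Im h / 2}) \<inter>
    ((\<lambda>z. qpoch2 (- h - z) (4 * h) (2 * s)) -` (- {0}))"
  have op: "open A"
  proof -
    have "(\<lambda>z. qpoch2 (- h - z) (4 * h) (2 * s)) holomorphic_on UNIV"
      by (intro holomorphic_qpoch2 holomorphic_intros)
    thus ?thesis unfolding A_def
      by (intro open_Int open_halfspace_Im_gt open_halfspace_Im_lt open_vimage holomorphic_on_imp_continuous_on) auto
  qed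
  have "qpoch2 (- h - z) (4 * h) (2 * s) \<noteq> 0"
  proof
    assume "qpoch2 (- h - z) (4 * h) (2 * s) = 0"
    then obtain n m :: nat and k :: int where nm: "- h - z + of_nat n * (4 * h) + of_nat m * (2 * s) = of_int k"
      using qpoch2_eq_0_iff by blast
    hence "Im (- h - z + of_nat n * (4 * h) + of_nat m * (2 * s)) = 0" by simp
    hence I: "Im z = - Im h + real n * (4 * Im h) + real m * (2 * Im s)" by simp
    have "n = 0"
    proof (rule ccontr)
      assume "n \<noteq> 0"
      hence "1 * (4 * Im h) \<le> real n * (4 * Im h)" using h by (intro mult_right_mono) auto
      moreover have "real m * (2 * Im s) \<ge> 0" using h s by simp
      ultimately show False using I assms(4) h by linarith
    qed
    moreover have "m = 0"
    proof (rule ccontr)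
      assume "m \<noteq> 0"
      hence "1 * (2 * Im s) \<le> real m * (2 * Im s)" using h s by (intro mult_right_mono) auto
      moreover have "real n * (4 * Im h) \<ge> 0" using h by simp
      ultimately show False using I assms(4) h s by linarith
    qed
    ultimately have nm': "- h - z = of_int k" using nm by simp
    have "z = - h - (- h - z)" by simp
    also have "\<dots> = of_int (- k) - h" unfolding nm' by simp
    finally have "z = of_int (- k) - h" .
    thus False using assms(5) by blast
  qed
  hence zA: "z \<in> A" using assms by (simp add: A_def)
  have "Hodd c d holomorphic_on A"
    unfolding Hodd_def[abs_def] A_def using assms(1,2) h
    by (intro holomorphic_intros holomorphic_theta0 positive holomorphic_ell_Gamma_upper holomorphic_ell_Gamma) auto
  thus ?thesis using op zA by (rule holomorphic_on_imp_differentiable_at)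
qed

lemma Hodd_residue:
  assumes "Im c > Im h" "Im d > Im h"
  shows "((\<lambda>z. Hodd c d z * (z + h)) \<longlongrightarrow>
     C / (4 * of_real pi * \<i>) * (G (2 * h) * (G (c + 3 * h) * G (c + h)) * (G (d + 3 * h) * G (d + h)) *
        (ee (2 * h) * th4 (1/2 - h) * th4 h * th (h + 1/2)))) (at (- h))"
proof -
  define K where "K = (\<lambda>z. G (z + 3 * h) * (G (c + z + 4 * h) * G (c - z)) * (G (d + z + 4 * h) * G (d - z)) *
      (ee (- 2 * z) * th4 (z + 1/2) * th4 (z + 2 * h) * th (z + 2 * h + 1/2)))"
  let ?A = "{z. Im z > - 2 * Im h} \<inter> {z. Im z < 0}"
  have "K holomorphic_on ?A"
    unfolding K_def using assms h
    by (intro holomorphic_intros holomorphic_theta0 positive holomorphic_ell_Gamma_upper) auto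
  moreover have "open ?A" by (intro open_Int open_halfspace_Im_gt open_halfspace_Im_lt)
  moreover have "- h \<in> ?A" using h by auto
  ultimately have "isCont K (- h)"
    by (metis holomorphic_on_imp_continuous_on continuous_on_eq_continuous_at)
  hence K: "(K \<longlongrightarrow> K (- h)) (at (- h))" by (simp add: isCont_def)
  have "((\<lambda>z. G (- z - h) * (- z - h)) \<longlongrightarrow> - 1 / (2 * of_real pi * \<i> * (qpoch (4 * h) (4 * h) * qpoch (2 * s) (2 * s)))) (at (- h))"
  proof -
    have "filterlim (\<lambda>z::complex. - z) (at h) (at (- h))"
      by (auto simp: filterlim_at eventually_at_filter minus_equation_iff[of _ h] intro!: tendsto_eq_intros always_eventually)
    from filterlim_compose[OF ell_Gamma_pole[of h] this] show ?thesis .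
  qed
  hence "((\<lambda>z. K z * - (G (- z - h) * (- z - h))) \<longlongrightarrow>
     K (- h) * - (- 1 / (2 * of_real pi * \<i> * (qpoch (4 * h) (4 * h) * qpoch (2 * s) (2 * s))))) (at (- h))"
    by (intro tendsto_intros K)
  moreover have "K z * - (G (- z - h) * (- z - h)) = Hodd c d z * (z + h)" for z
  proof -
    have e: "- h - z = - z - h" by simp
    show ?thesis unfolding K_def Hodd_def e by (simp add: algebra_simps)
  qed
  moreover have "K (- h) * - (- 1 / (2 * of_real pi * \<i> * (qpoch (4 * h) (4 * h) * qpoch (2 * s) (2 * s)))) =
    C / (4 * of_real pi * \<i>) * (G (2 * h) * (G (c + 3 * h) * G (c + h)) * (G (d + 3 * h) * G (d + h)) *
        (ee (2 * h) * th4 (1/2 - h) * th4 h * th (h + 1/2)))"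
    by (simp add: K_def C_def field_simps)
  ultimately show ?thesis by simp
qed

text \<open>The integral over the line through -2h vanishes by oddness, so only the residue passed
  on the way down from the real line remains.\<close>

lemma integral_Hodd:
  assumes "Im c > Im h" "Im d > Im h"
  shows "2 * contour_integral rseg (Hodd c d) =
     - C * (G (2 * h) * (G (c + 3 * h) * G (c + h)) * (G (d + 3 * h) * G (d + h)) *
        (ee (2 * h) * th4 (1/2 - h) * th4 h * th (h + 1/2)))"
proof -
  have forw: "2 * I = - C * Q" if "0 = I + 2 * of_real pi * \<i> * (C / (4 * of_real pi * \<i>) * Q)" for I Q :: complex
  proof -
    have "2 * of_real pi * \<i> * (C / (4 * of_real pi * \<i>) * Q) = C * Q / 2" by simp
    hence "I + C * Q / 2 = 0" using that by (simp only:)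
    hence "I = - (C * Q / 2)" by (rule add_eq_0_iff2[THEN iffD1])
    thus ?thesis by simp
  qed
  have "contour_integral (linepath (- 2 * h - 1/2) (- 2 * h + 1/2)) (Hodd c d) = 0"
  proof (rule contour_integral_odd_segment[of "Hodd c d" "- 2 * h", OF Hodd_odd])
    have "Hodd c d field_differentiable at z" if z: "z \<in> closed_segment (- 2 * h - 1/2) (- 2 * h + 1/2)" for z
    proof -
      obtain u :: real where u: "z = (1 - of_real u) * (- 2 * h - 1/2) + of_real u * (- 2 * h + 1/2)"
        using z by (auto simp: closed_segment_def scaleR_conv_of_real)
      have "Im z = - 2 * Im h" unfolding u by (simp add: algebra_simps)
      thus ?thesis using h assms by (intro Hodd_differentiable) auto
    qed
    thus "continuous_on (closed_segment (- 2 * h - 1/2) (- 2 * h + 1/2)) (Hodd c d)"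
      by (intro continuous_at_imp_continuous_on ballI field_differentiable_imp_continuous_at)
  qed
  moreover have "- 2 * h - 1/2 = - 1/2 - 2 * h" "- 2 * h + 1/2 = 1/2 - 2 * h" by simp_all
  ultimately have "contour_integral (linepath (-1/2 - 2 * h) (1/2 - 2 * h)) (Hodd c d) = 0" by (simp only:)
  moreover have "contour_integral (linepath (-1/2 - 2 * h) (1/2 - 2 * h)) (Hodd c d) =
    contour_integral rseg (Hodd c d) + 2 * of_real pi * \<i> * (C / (4 * of_real pi * \<i>) *
     (G (2 * h) * (G (c + 3 * h) * G (c + h)) * (G (d + 3 * h) * G (d + h)) *
        (ee (2 * h) * th4 (1/2 - h) * th4 h * th (h + 1/2))))"
    by (rule line_shift_integral[OF h Hodd_periodic _ Hodd_residue[OF assms]]) (rule Hodd_differentiable[OF assms])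
  ultimately have "0 = contour_integral rseg (Hodd c d) + 2 * of_real pi * \<i> * (C / (4 * of_real pi * \<i>) *
     (G (2 * h) * (G (c + 3 * h) * G (c + h)) * (G (d + 3 * h) * G (d + h)) *
        (ee (2 * h) * th4 (1/2 - h) * th4 h * th (h + 1/2))))"
    by (simp only:)
  thus ?thesis
    by (rule forw)
qed

section \<open>The contiguous relation\<close>

definition GG :: "complex \<Rightarrow> complex \<Rightarrow> complex \<Rightarrow> complex" where
  "GG c d z = G (z - h) * G (- z - h) * (G (c + z) * G (c - z)) * (G (d + z) * G (d - z))"

text \<open>Three theta functions produced by the shifts by 4h in \<open>Hodd\<close>, together with
  the one of period 2s that \<open>Hodd\<close> contains already; the product of Gamma functions
  \<open>GG\<close> that is left is even.\<close>

definition Nf :: "complex \<Rightarrow> complex \<Rightarrow> complex \<Rightarrow> complex" where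
  "Nf c d z = th (z - h) * th (z + 2 * h + 1/2) * th (z + c) * th (z + d)"

lemma Hodd_real_line:
  assumes z: "Im z = 0" and cd: "Im c > 0" "Im d > 0"
  shows "Hodd c d z = GG c d z * (ee (- 2 * z) * th4 (z + 1/2) * th4 (z + 2 * h) * Nf c d z)"
proof -
  have "G (z + 3 * h) = th (z - h) * G (z - h)"
    using ell_Gamma_shift[OF G_real_line(2)[OF z]] by (simp add: algebra_simps)
  moreover have "G (c + z + 4 * h) = th (c + z) * G (c + z)" "G (d + z + 4 * h) = th (d + z) * G (d + z)"
    using z cd by (auto intro!: ell_Gamma_shift_upper)
  moreover have "- h - z = - z - h" by simp
  ultimately show ?thesis unfolding Hodd_def GG_def Nf_def by (simp only: mult_ac add.commute[of z])
qed

lemma Hodd_sum_real_line: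
  assumes z: "Im z = 0" and cd: "Im c > 0" "Im d > 0"
  shows "Hodd c d z + Hodd c d (- z) =
    GG c d z * (ee (- z) * th4 (z + 1/2) * th4 (z + 2 * h) * (ee (- z) * Nf c d z + ee (2 * z) * Nf c d (- z)))"
proof -
  have "GG c d (- z) = GG c d z" by (simp add: GG_def)
  moreover have "th4 (- z + 1/2) = ee (- z) * th4 (z + 1/2)"
    using theta0_half_minus[OF positive(1), of z] by (simp add: algebra_simps)
  moreover have "th4 (- z + 2 * h) = th4 (z + 2 * h)"
    using theta0_reflect[of "4 * h" "z + 2 * h"] by (simp add: algebra_simps)
  moreover have "ee (- 2 * z) = ee (- z) * ee (- z)" by (simp flip: ee_add)
  moreover have "ee (- 2 * - z) * ee (- z) = ee (- z) * ee (2 * z)" by simp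
  ultimately show ?thesis
    using z Hodd_real_line[OF z cd] Hodd_real_line[of "- z", OF _ cd] by (simp add: algebra_simps)
qed

lemma continuous_Hodd:
  assumes "Im c > Im h" "Im d > Im h"
  shows "continuous_on (path_image rseg) (Hodd c d)" "continuous_on (path_image rseg) (\<lambda>z. Hodd c d (- z))"
proof -
  have d: "Hodd c d field_differentiable at z" if "Im z = 0" for z
    using that assms h by (intro Hodd_differentiable) auto
  show "continuous_on (path_image rseg) (Hodd c d)"
    using d Im_rseg by (intro continuous_at_imp_continuous_on ballI field_differentiable_imp_continuous_at) auto
  have "continuous_on (uminus ` path_image rseg) (Hodd c d)"
    using d Im_rseg by (intro continuous_at_imp_continuous_on ballI field_differentiable_imp_continuous_at) auto
  thus "continuous_on (path_image rseg) (\<lambda>z. Hodd c d (- z))"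
    by (rule continuous_on_compose2[OF _ continuous_on_minus[OF continuous_on_id]]) auto
qed

lemma rseg_integrable: "continuous_on (path_image rseg) f \<Longrightarrow> f contour_integrable_on rseg"
  unfolding rseg_def by (intro contour_integrable_continuous_linepath) simp

text \<open>The function \<open>phi\<close> below is an even theta function of degree two for which
  \<open>W c d z * phi z\<close> equals \<open>Hodd c d z + Hodd c d (- z)\<close> on the real line
  and therefore has a known integral. By interpolation \<open>phi\<close> is also a combination of
  \<open>theta_pair\<close> at c and at d, and these factors raise c or d by 4h. The condition on c
  + d makes the multipliers fit.\<close>

lemma contiguous_relation:
  assumes cd: "c + d = s - h + 1/2" and c: "Im h < Im c" "Im c < Im d"
  shows "J (c + 4 * h) d * X d = J c (d + 4 * h) * X c"
proof -
  have "Im (c + d) = Im (s - h + 1/2)" using cd by simp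
  hence Imd: "Im d = Im s - Im h - Im c" by simp
  have c0: "Im c > 0" "Im d > 0" "Im d > Im h" using c h by auto
  define N where "N = Nf c d"
  define q where "q = (\<lambda>z. ths (z + 1/2))"
  define Psi where "Psi = (\<lambda>z. ee (- z) * N z + ee (2 * z) * N (- z))"
  have N_shift: "N (z + 2 * s) = ee (- 4 * z - s) * N z" for z
  proof -
    have e: "z + 2 * s - h = (z - h) + 2 * s" "z + 2 * s + 2 * h + 1/2 = (z + 2 * h + 1/2) + 2 * s"
      "z + 2 * s + c = (z + c) + 2 * s" "z + 2 * s + d = (z + d) + 2 * s" by simp_all
    have "- (z - h) + (- (z + 2 * h + 1/2)) + (- (z + c)) + (- (z + d)) = - 4 * z - h - 1/2 - (c + d)"
      by (simp add: algebra_simps)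
    also have "\<dots> = - 4 * z - s + of_int (-1)" unfolding cd by simp
    finally have "ee (- (z - h)) * ee (- (z + 2 * h + 1/2)) * ee (- (z + c)) * ee (- (z + d)) = ee (- 4 * z - s + of_int (-1))"
      unfolding ee_add[symmetric] by (simp only:)
    also have "\<dots> = ee (- 4 * z - s)" by (subst ee_add) (simp only: ee_of_int mult_1_right)
    finally have E: "ee (- (z - h)) * ee (- (z + 2 * h + 1/2)) * ee (- (z + c)) * ee (- (z + d)) = ee (- 4 * z - s)" .
    show ?thesis unfolding N_def Nf_def e theta0_shift[OF positive(2)] E[symmetric]
      by (simp only: mult_minus_left mult_minus_right minus_minus mult_ac)
  qed
  have N1: "N (z + 1) = N z" "N (z - 1) = N z" for z
  proof -
    have e: "z + 1 - h = (z - h) + 1" "z + 1 + 2 * h + 1/2 = (z + 2 * h + 1/2) + 1"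
      "z + 1 + c = (z + c) + 1" "z + 1 + d = (z + d) + 1" by simp_all
    show "N (z + 1) = N z" unfolding N_def Nf_def e theta0_add_1 ..
    have e: "z - 1 - h = (z - h) - 1" "z - 1 + 2 * h + 1/2 = (z + 2 * h + 1/2) - 1"
      "z - 1 + c = (z + c) - 1" "z - 1 + d = (z + d) - 1" by simp_all
    show "N (z - 1) = N z" unfolding N_def Nf_def e theta0_add_1 ..
  qed
  have N_shift': "N (z - 2 * s) = ee (4 * z - 7 * s) * N z" for z
  proof -
    have "N z = ee (- 4 * (z - 2 * s) - s) * N (z - 2 * s)" using N_shift[of "z - 2 * s"] by simp
    moreover have "ee (4 * z - 7 * s) * ee (- 4 * (z - 2 * s) - s) = 1"
      unfolding ee_add[symmetric] by (simp add: algebra_simps)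
    ultimately show ?thesis by (metis mult.assoc mult_1)
  qed
  have holPsi: "Psi holomorphic_on UNIV"
    unfolding Psi_def N_def Nf_def by (intro holomorphic_intros holomorphic_theta0 positive)
  have holq: "q holomorphic_on UNIV"
    unfolding q_def by (intro holomorphic_intros holomorphic_theta0 positive)
  have Psi1: "Psi (z + 1) = Psi z" for z
  proof -
    have "N (- (z + 1)) = N (- z)" using N1(2)[of "- z"] by simp
    moreover have "ee (- (z + 1)) = ee (- z)" "ee (2 * (z + 1)) = ee (2 * z)"
      using ee_of_int[of 2] by (simp_all add: ee_diff ee_add distrib_left)
    ultimately show ?thesis using N1(1)[of z] by (simp add: Psi_def)
  qed
  have Psi_shift: "Psi (z + 2 * s) = ee (- 4 * z - 3 * s) * Psi z" for z
  proof -
    have "N (- (z + 2 * s)) = ee (- 4 * z - 7 * s) * N (- z)" using N_shift'[of "- z"] by (simp add: algebra_simps)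
    moreover have "ee (- (z + 2 * s)) * ee (- 4 * z - s) = ee (- 4 * z - 3 * s) * ee (- z)"
      "ee (2 * (z + 2 * s)) * ee (- 4 * z - 7 * s) = ee (- 4 * z - 3 * s) * ee (2 * z)"
      unfolding ee_add[symmetric] by (rule arg_cong[of _ _ ee], simp add: algebra_simps)+
    ultimately show ?thesis
      unfolding Psi_def N_shift distrib_left by (simp only: mult.assoc[symmetric])
  qed
  have Psi_neg: "Psi (- z) = ee (- z) * Psi z" for z
  proof -
    have "ee (- (- z)) = ee (- z) * ee (2 * z)" "ee (2 * (- z)) = ee (- z) * ee (- z)"
      unfolding ee_add[symmetric] by simp_all
    thus ?thesis unfolding Psi_def by (simp add: algebra_simps)
  qed
  have q1: "q (z + 1) = q z" for z
    using theta0_add_1(1)[of "z + 1/2" s] by (simp add: q_def algebra_simps)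
  have q_s: "q (z + s) = ee (- z) * q z" for z
  proof -
    have "q (z + s) = - ee (- (z + 1/2)) * q z"
      using theta0_shift[OF positive(3), of "z + 1/2"] by (simp add: q_def algebra_simps)
    thus ?thesis by (subst (asm) ee_minus) (simp add: ee_add ee_minus)
  qed
  have q_shift: "q (z + 2 * s) = ee (- 2 * z - s) * q z" for z
  proof -
    have "q (z + 2 * s) = ee (- (z + s)) * ee (- z) * q z" using q_s[of "z + s"] q_s[of z] by (simp add: add.assoc)
    also have "ee (- (z + s)) * ee (- z) = ee (- 2 * z - s)" unfolding ee_add[symmetric] by (rule arg_cong[of _ _ ee]) (simp add: algebra_simps)
    finally show ?thesis .
  qed
  have q_neg: "q (- z) = ee (- z) * q z" for z
    using theta0_half_minus[OF positive(3), of z] by (simp add: q_def algebra_simps)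
  have qd: "deriv q z \<noteq> 0" if "q z = 0" for z
  proof -
    have "((\<lambda>z. ths z) has_field_derivative deriv ths (z + 1/2)) (at (z + 1/2))"
      by (rule holomorphic_derivI[of _ UNIV]) (auto intro!: holomorphic_theta0 positive holomorphic_intros)
    hence "(q has_field_derivative deriv ths (z + 1/2)) (at z)"
      unfolding q_def by (simp add: DERIV_shift)
    thus ?thesis using theta0_simple_zero[OF positive(3), of "z + 1/2"] that DERIV_imp_deriv
      by (metis q_def)
  qed
  \<comment> \<open>Modulo 1 and 2s the zeros of q are -1/2 and s - 1/2. At each of them the two
    terms of \<open>Psi\<close> cancel, so q divides \<open>Psi\<close>, and the degree drops from
    four to two.\<close>
  have Psi0: "Psi (-1/2) = 0" "Psi (s - 1/2) = 0"
  proof -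
    have "N (1/2) = N (-1/2)" using N1(1)[of "-1/2"] by simp
    thus "Psi (-1/2) = 0" using ee_1 by (simp add: Psi_def ee_minus)
    have "N (- (s - 1/2)) = ee (4 * (s + 1/2) - 7 * s) * N (s + 1/2)"
      using N_shift'[of "s + 1/2"] by (simp add: algebra_simps)
    moreover have "N (s + 1/2) = N (s - 1/2)" using N1(2)[of "s + 1/2"] by (simp add: algebra_simps)
    moreover have "ee (2 * (s - 1/2)) * ee (4 * (s + 1/2) - 7 * s) = ee (- s) * ee 1"
      unfolding ee_add[symmetric] by (rule arg_cong[of _ _ ee]) (simp add: algebra_simps)
    moreover have "ee (- (s - 1/2)) = - ee (- s)"
    proof -
      have "- (s - 1/2) = - s + 1/2" by simp
      thus ?thesis by (simp only: ee_add ee_half) simp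
    qed
    ultimately show "Psi (s - 1/2) = 0"
      unfolding Psi_def by (simp add: ee_1 flip: mult.assoc)
  qed
  have Psiz: "Psi z = 0" if qz: "q z = 0" for z
  proof -
    obtain n k :: int where nk: "z + 1/2 = of_int n + of_int k * s"
      using qz theta0_eq_0_iff[OF positive(3)] unfolding q_def by meson
    have z: "z = (z + 1/2) - 1/2" by simp
    note zs = quasi_periodic_zero_shift[of Psi "2 * s" "\<lambda>z. ee (- 4 * z - 3 * s)", OF Psi1 Psi_shift ee_nonzero]
    show ?thesis
    proof (cases "even k")
      case True
      then obtain j where "k = 2 * j" by (elim evenE)
      hence "z = -1/2 + of_int n + of_int j * (2 * s)" by (subst z, unfold nk) simp
      thus ?thesis using zs[of "-1/2" n j] Psi0(1) by (simp only:)
    next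
      case False
      then obtain j where "k = 2 * j + 1" by (elim oddE)
      hence "z = (s - 1/2) + of_int n + of_int j * (2 * s)" by (subst z, unfold nk) (simp add: algebra_simps)
      thus ?thesis using zs[of "s - 1/2" n j] Psi0(2) by (simp only:)
    qed
  qed
  obtain phi where hol: "phi holomorphic_on UNIV" and phi: "\<And>z. Psi z = q z * phi z"
    using holomorphic_quotient_simple_zeros[OF holPsi holq Psiz qd] by blast
  have holc: "(\<lambda>z. phi (f z)) holomorphic_on UNIV" if "f holomorphic_on UNIV" for f
    using holomorphic_on_compose_gen[OF that hol] by (simp add: o_def)
  have cancel: "u z = v z" if "u holomorphic_on UNIV" "v holomorphic_on UNIV" "\<And>z. q z * u z = q z * v z" for u v z
  proof -
    have "continuous_on UNIV (\<lambda>z. u z - v z)"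
      using that(1,2) by (intro continuous_intros holomorphic_on_imp_continuous_on)
    from mult_eq_0_simple_zeros[OF holq qd this] that(3) show ?thesis
      by (simp add: right_diff_distrib)
  qed
  have phi1: "phi (z + 1) = phi z" for z
    by (rule cancel[of "\<lambda>z. phi (z + 1)" phi])
       (use phi q1 Psi1 in \<open>auto intro!: holc hol holomorphic_intros simp flip: phi, metis\<close>)
  have phi_shift: "phi (z + 2 * s) = ee (- 2 * z - 2 * s) * phi z" for z
  proof (rule cancel[of "\<lambda>z. phi (z + 2 * s)" "\<lambda>z. ee (- 2 * z - 2 * s) * phi z"])
    fix z
    have "ee (- 2 * z - s) * (q z * phi (z + 2 * s)) = ee (- 4 * z - 3 * s) * (q z * phi z)"
      using phi[of "z + 2 * s"] phi[of z] Psi_shift[of z] q_shift[of z] by (simp add: mult_ac)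
    moreover have "ee (- 4 * z - 3 * s) = ee (- 2 * z - s) * ee (- 2 * z - 2 * s)"
      unfolding ee_add[symmetric] by (rule arg_cong[of _ _ ee]) (simp add: algebra_simps)
    ultimately have "ee (- 2 * z - s) * (q z * phi (z + 2 * s)) = ee (- 2 * z - s) * (q z * (ee (- 2 * z - 2 * s) * phi z))"
      by (simp only: mult_ac)
    thus "q z * phi (z + 2 * s) = q z * (ee (- 2 * z - 2 * s) * phi z)" by simp
  qed (auto intro!: holc hol holomorphic_intros)
  have phi_even: "phi (- z) = phi z" for z
  proof (rule cancel[of "\<lambda>z. phi (- z)" phi])
    fix z
    show "q z * phi (- z) = q z * phi z"
      using phi[of "- z"] phi[of z] Psi_neg[of z] q_neg[of z] by (auto simp: mult_ac)
  qed (auto intro!: holc hol holomorphic_intros)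
  define E where "E = theta_pair (2 * s) c d"
  have thcd: "th (c + d) \<noteq> 0" using c0 Imd s h by (intro theta0_nonzero) auto
  have "th (d - c) \<noteq> 0" using c c0 Imd s h by (intro theta0_nonzero) auto
  hence "th (c - d) \<noteq> 0" using theta0_minus[OF positive(2), of "d - c"] by simp
  hence E: "E \<noteq> 0" using thcd by (simp add: E_def theta_pair_def)
  have th2d: "th (2 * d) \<noteq> 0" using c c0 Imd s h by (intro theta0_nonzero) auto
  have interp: "E * phi z = phi d * theta_pair (2 * s) c z - ee (c - d) * phi c * theta_pair (2 * s) d z" for z
    unfolding E_def using even_theta_interpolation[OF positive(2) hol phi1 _ phi_even th2d] phi_shift E
    by (simp add: E_def)
  \<comment> \<open>\<open>Nf c d\<close> vanishes at -c and at -d, so at both nodes a single term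
    of \<open>Psi\<close> survives.\<close>
  have phival: "phi x = ee (- x) * th (c + d) * X x" if x: "x = c \<or> x = d" for x
  proof -
    have "Nf c d (- x) = 0" using x positive(2) by (auto simp: Nf_def)
    hence "Psi x = ee (- x) * Nf c d x" by (simp add: Psi_def N_def)
    also have "Nf c d x = th (x - h) * th (x + 2 * h + 1/2) * th (c + d) * th (2 * x)"
      using x by (auto simp: Nf_def add.commute)
    also have "th (2 * x) = ths x * q x" unfolding q_def by (rule theta0_double[OF positive(3)])
    finally have "q x * phi x = q x * (ee (- x) * th (c + d) * X x)"
      unfolding phi X_def by (simp add: mult_ac)
    moreover have "q x \<noteq> 0" unfolding q_def using x c c0 Imd h by (intro theta0_nonzero) auto
    ultimately show ?thesis by simp
  qed
  define B where "B = (\<lambda>a b. C * (G (- 2 * h) * (G (a + h) * G (a - h)) * (G (b + h) * G (b - h)) * T h))"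
  have Jeq: "J a b = contour_integral rseg (W a b) + B a b" for a b by (simp add: J_def B_def)
  have Bc: "B (c + 4 * h) d = B c d * theta_pair (2 * s) c h" "B c (d + 4 * h) = B c d * theta_pair (2 * s) d h"
    using ell_Gamma_shift_upper[of "c + h"] ell_Gamma_shift_upper[of "c - h"]
      ell_Gamma_shift_upper[of "d + h"] ell_Gamma_shift_upper[of "d - h"] c c0 h
    by (simp_all add: B_def theta_pair_def algebra_simps)
  define I where "I = (\<lambda>a. contour_integral rseg (\<lambda>z. W c d z * theta_pair (2 * s) a z))"
  have J1: "J (c + 4 * h) d = I c + B c d * theta_pair (2 * s) c h"
    unfolding Jeq Bc I_def using W_shift_fst c0 by (intro arg_cong2[of _ _ _ _ "(+)"] contour_integral_eq) (auto dest!: Im_rseg)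
  have J2: "J c (d + 4 * h) = I d + B c d * theta_pair (2 * s) d h"
    unfolding Jeq Bc I_def using W_shift_snd c0 by (intro arg_cong2[of _ _ _ _ "(+)"] contour_integral_eq) (auto dest!: Im_rseg)
  have int: "(\<lambda>z. W c d z * theta_pair (2 * s) a z) contour_integrable_on rseg" for a
    by (intro rseg_integrable continuous_intros continuous_W c0
         holomorphic_on_imp_continuous_on[OF holomorphic_theta_pair[OF positive(2)]])
  have "contour_integral rseg (\<lambda>z. phi d * (W c d z * theta_pair (2 * s) c z) -
      ee (c - d) * phi c * (W c d z * theta_pair (2 * s) d z)) = phi d * I c - ee (c - d) * phi c * I d"
    unfolding I_def
    by (subst contour_integral_diff) (auto intro!: contour_integrable_lmul int simp: contour_integral_lmul int)
  also have "(\<lambda>z. phi d * (W c d z * theta_pair (2 * s) c z) -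
      ee (c - d) * phi c * (W c d z * theta_pair (2 * s) d z)) = (\<lambda>z. E * (W c d z * phi z))"
  proof
    fix z
    show "phi d * (W c d z * theta_pair (2 * s) c z) -
      ee (c - d) * phi c * (W c d z * theta_pair (2 * s) d z) = E * (W c d z * phi z)"
      using interp[of z] by algebra
  qed
  also have "contour_integral rseg (\<lambda>z. E * (W c d z * phi z)) = E * contour_integral rseg (\<lambda>z. W c d z * phi z)"
    by (intro contour_integral_lmul rseg_integrable continuous_intros continuous_W c0
         continuous_on_subset[OF holomorphic_on_imp_continuous_on[OF hol]]) auto
  finally have key: "phi d * J (c + 4 * h) d - ee (c - d) * phi c * J c (d + 4 * h) =
     E * (contour_integral rseg (\<lambda>z. W c d z * phi z) + B c d * phi h)"
    unfolding J1 J2 using interp[of h] by algebra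
  have "contour_integral rseg (\<lambda>z. W c d z * phi z) = contour_integral rseg (\<lambda>z. Hodd c d z + Hodd c d (- z))"
  proof (rule contour_integral_eq)
    fix z assume "z \<in> path_image rseg"
    hence z: "Im z = 0" by (rule Im_rseg)
    have "W c d z * phi z = GG c d z * (ee (- z) * th4 (z + 1/2) * th4 (z + 2 * h) * (q z * phi z))"
      by (simp add: W_def GG_def T_def q_def mult_ac)
    also have "\<dots> = Hodd c d z + Hodd c d (- z)"
      unfolding Hodd_sum_real_line[OF z c0(1,2)] phi[symmetric] by (simp add: Psi_def N_def)
    finally show "W c d z * phi z = Hodd c d z + Hodd c d (- z)" .
  qed
  also have "\<dots> = 2 * contour_integral rseg (Hodd c d)"
    using continuous_Hodd[OF c(1) c0(3)] contour_integral_rseg_reflect[of "Hodd c d"]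
    by (subst contour_integral_add) (auto intro: rseg_integrable)
  \<comment> \<open>The integral is exactly the negative of the residue term at h, so the right-hand
    side of \<open>key\<close> becomes 0.\<close>
  also have "\<dots> = - (B c d * phi h)"
  proof -
    have T: "T h * phi h = ee (- h) * th4 (h + 1/2) * th4 h * Psi h"
      using theta0_reflect[of "4 * h" h] by (simp add: T_def q_def phi mult_ac)
    have "Psi h = ee (2 * h) * (th (- 2 * h) * th (h + 1/2) * th (c - h) * th (d - h))"
      using positive(2) by (simp add: Psi_def N_def Nf_def algebra_simps)
    moreover have "th4 (1/2 - h) = ee (- h) * th4 (h + 1/2)" by (rule theta0_half_minus[OF positive(1)])
    moreover have "G (2 * h) = th (- 2 * h) * G (- 2 * h)"
      using ell_Gamma_shift[of "- 2 * h"] qpoch_nonzero_between[of "2 * s" "- 2 * h"] h s by simp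
    moreover have "G (c + 3 * h) = th (c - h) * G (c - h)" "G (d + 3 * h) = th (d - h) * G (d - h)"
      using ell_Gamma_shift_upper[of "c - h"] ell_Gamma_shift_upper[of "d - h"] c c0 by (simp_all add: algebra_simps)
    moreover have "B c d * phi h = C * (G (- 2 * h) * (G (c + h) * G (c - h)) * (G (d + h) * G (d - h)) * (T h * phi h))"
      by (simp add: B_def mult_ac)
    ultimately show ?thesis
      unfolding integral_Hodd[OF c(1) c0(3)] T by (simp only: mult_ac mult_minus_left mult_minus_right)
  qed
  finally have "phi d * J (c + 4 * h) d - ee (c - d) * phi c * J c (d + 4 * h) = 0" unfolding key by simp
  hence "ee (- d) * th (c + d) * (J (c + 4 * h) d * X d) - ee (c - d) * ee (- c) * th (c + d) * (J c (d + 4 * h) * X c) = 0"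
    by (simp add: phival mult_ac)
  also have "ee (c - d) * ee (- c) = ee (- d)" by (simp flip: ee_add)
  finally show ?thesis using thcd by (simp flip: right_diff_distrib)
qed

end

section \<open>The normalised beta integral as a function of its parameter\<close>

lemma contour_integral_rseg: "contour_integral rseg f = integral {0..1} (\<lambda>x. f (of_real (x - 1/2)))"
proof -
  have "linepath (-1/2) (1/2) x = (of_real (x - 1/2) :: complex)" for x
    by (simp add: linepath_def scaleR_conv_of_real field_simps)
  thus ?thesis by (simp add: rseg_def contour_integral_integral)
qed

context beta_setup begin

abbreviation "hG z \<equiv> ell_Gamma z (4 * h) s"

text \<open>The parameters -h, a, b, 0, 2h + 1/2, s are balanced, modulo 1, when a + b has this
  value.\<close>

definition S0 :: complex where "S0 = s + 3 * h + 1/2"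

lemma Im_S0: "Im S0 = Im s + 3 * Im h"
  by (simp add: S0_def)

text \<open>Differentiation under the integral sign; the derivative in a is written out as
  \<open>fx\<close> because its joint continuity is what has to be checked.\<close>

lemma holomorphic_integral_W:
  "(\<lambda>a. contour_integral rseg (W a (S0 - a))) holomorphic_on {a. 0 < Im a \<and> Im a < Im s + 3 * Im h}"
proof -
  define U where "U = {a. 0 < Im a \<and> Im a < Im s + 3 * Im h}"
  define Gd where "Gd = deriv (\<lambda>w. G w)"
  let ?H = "{w. Im w > 0}"
  have op: "open ?H" by (rule open_halfspace_Im_gt)
  have hol: "(\<lambda>w. G w) holomorphic_on ?H" by (intro holomorphic_ell_Gamma_upper holomorphic_intros) auto
  have holGd: "Gd holomorphic_on ?H" unfolding Gd_def by (rule holomorphic_deriv[OF hol op])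
  have D: "((\<lambda>a. G (f a)) has_field_derivative Gd (f a) * f') (at a within U)"
    if "(f has_field_derivative f') (at a within U)" "Im (f a) > 0" for f f' a
  proof -
    have "((\<lambda>w. G w) has_field_derivative Gd (f a)) (at (f a))"
      unfolding Gd_def by (rule holomorphic_derivI[OF hol op]) (use that in auto)
    from DERIV_chain2[OF this that(1)] show ?thesis .
  qed
  have cG: "continuous_on A (\<lambda>p. G (f p))" "continuous_on A (\<lambda>p. Gd (f p))"
    if "continuous_on A f" "\<And>p. p \<in> A \<Longrightarrow> Im (f p) > 0" for A :: "(complex \<times> real) set" and f
  proof -
    have "f ` A \<subseteq> ?H" using that(2) by auto
    thus "continuous_on A (\<lambda>p. G (f p))" "continuous_on A (\<lambda>p. Gd (f p))"
      using continuous_on_compose2[OF holomorphic_on_imp_continuous_on[OF hol] that(1)]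
        continuous_on_compose2[OF holomorphic_on_imp_continuous_on[OF holGd] that(1)] by auto
  qed
  define z :: "real \<Rightarrow> complex" where "z = (\<lambda>x. of_real (x - 1/2))"
  define K where "K = (\<lambda>x. G (z x - h) * G (- z x - h) * T (z x))"
  define fx where "fx = (\<lambda>a x. K x * ((Gd (a + z x) * G (a - z x) + Gd (a - z x) * G (a + z x)) * (G (S0 - a + z x) * G (S0 - a - z x))
      - (Gd (S0 - a + z x) * G (S0 - a - z x) + Gd (S0 - a - z x) * G (S0 - a + z x)) * (G (a + z x) * G (a - z x))))"
  have Imz: "Im (z x) = 0" for x by (simp add: z_def)
  have cz: "continuous_on A (\<lambda>p. z (snd p))" for A :: "(complex \<times> real) set"
    unfolding z_def by (intro continuous_intros)
  have cK: "continuous_on A (\<lambda>p. K (snd p))" for A :: "(complex \<times> real) set"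
  proof -
    let ?B = "{w. qpoch2 (w - h) (4 * h) (2 * s) \<noteq> 0 \<and> qpoch2 (- w - h) (4 * h) (2 * s) \<noteq> 0}"
    have "(\<lambda>w. G (w - h) * G (- w - h) * T w) holomorphic_on ?B"
      unfolding T_def by (intro holomorphic_intros holomorphic_theta0 positive holomorphic_ell_Gamma) auto
    hence "continuous_on ?B (\<lambda>w. G (w - h) * G (- w - h) * T w)" by (rule holomorphic_on_imp_continuous_on)
    moreover have "(\<lambda>p. z (snd p)) ` A \<subseteq> ?B"
      using G_real_line Imz by auto
    ultimately show ?thesis unfolding K_def by (intro continuous_on_compose2[OF _ cz]) auto
  qed
  have cfx: "continuous_on (U \<times> cbox 0 1) (\<lambda>(a, x). fx a x)"
    unfolding fx_def case_prod_unfold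
    by (intro continuous_intros cG cK cz) (auto simp: U_def Imz Im_S0)
  have cf: "continuous_on (U \<times> cbox 0 1) (\<lambda>p. K (snd p) * ((G (fst p + z (snd p)) * G (fst p - z (snd p))) *
       (G (S0 - fst p + z (snd p)) * G (S0 - fst p - z (snd p)))))"
    by (intro continuous_intros cG cK cz) (auto simp: U_def Imz Im_S0)
  define f where "f = (\<lambda>a x. K x * ((G (a + z x) * G (a - z x)) * (G (S0 - a + z x) * G (S0 - a - z x))))"
  have "(\<lambda>a. integral (cbox 0 1) (f a)) holomorphic_on U"
  proof (rule leibniz_rule_holomorphic[OF _ _ cfx])
    fix a x assume a: "a \<in> U"
    show "((\<lambda>a. f a x) has_field_derivative fx a x) (at a within U)"
    proof -
      have i: "Im (a + z x) > 0" "Im (a - z x) > 0" "Im (S0 - a + z x) > 0" "Im (S0 - a - z x) > 0"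
        using a by (auto simp: U_def Imz Im_S0)
      have d: "((\<lambda>a. a + z x) has_field_derivative 1) (at a within U)" "((\<lambda>a. a - z x) has_field_derivative 1) (at a within U)"
        "((\<lambda>a. S0 - a + z x) has_field_derivative -1) (at a within U)" "((\<lambda>a. S0 - a - z x) has_field_derivative -1) (at a within U)"
        by (auto intro!: derivative_eq_intros)
      note D' = DERIV_cmult[OF DERIV_mult[OF DERIV_mult[OF D[OF d(1) i(1)] D[OF d(2) i(2)]]
          DERIV_mult[OF D[OF d(3) i(3)] D[OF d(4) i(4)]]], of "K x"]
      show ?thesis
        unfolding f_def fx_def by (rule DERIV_cong[OF D']) (simp add: algebra_simps)
    qed
  next
    fix a assume a: "a \<in> U"
    have "continuous_on (cbox 0 1) (\<lambda>x. (a, x))" by (intro continuous_intros)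
    from continuous_on_compose2[OF cf this] have "continuous_on (cbox 0 1) (f a)"
      unfolding f_def using a by auto
    thus "f a integrable_on cbox 0 1" by (rule integrable_continuous)
  next
    have "U = {a. Im a > 0} \<inter> {a. Im a < Im s + 3 * Im h}" by (auto simp: U_def)
    thus "convex U" by (simp add: convex_Int convex_halfspace_Im_gt convex_halfspace_Im_lt)
  qed
  moreover have "f a = (\<lambda>x. W a (S0 - a) (of_real (x - 1/2)))" for a
    unfolding f_def K_def W_def z_def by (simp only: mult_ac)
  ultimately show ?thesis
    unfolding U_def contour_integral_rseg by simp
qed

lemma Pf_nonzero:
  assumes "Im h < Im c" "Im c < Im s + 4 * Im h"
  shows "Pf c \<noteq> 0"
  using assms h s ell_Gamma_nonzero[of "c - h"] ell_Gamma_nonzero[of "c + 2 * h + 1/2"] half.ell_Gamma_nonzero[of c]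
  by (simp add: Pf_def)

lemma holomorphic_Pf:
  assumes "f holomorphic_on A" "\<And>z. z \<in> A \<Longrightarrow> Im (f z) > Im h"
  shows "(\<lambda>z. Pf (f z)) holomorphic_on A"
  unfolding Pf_def using h assms(2)
  by (intro holomorphic_intros assms(1) holomorphic_ell_Gamma_upper half.holomorphic_ell_Gamma_upper) force+

definition Rf :: "complex \<Rightarrow> complex" where
  "Rf a = J a (S0 - a) / (Pf a * Pf (S0 - a))"

lemma Rf_add_1: "Rf (a + 1) = Rf a"
proof -
  have W1: "W (a + 1) (b - 1) = W a b" for a b
  proof
    fix z
    have e: "a + 1 + z = (a + z) + 1" "a + 1 - z = (a - z) + 1" "b - 1 + z = (b + z) - 1" "b - 1 - z = (b - z) - 1" by simp_all
    show "W (a + 1) (b - 1) z = W a b z" unfolding W_def e ell_Gamma_add_1 ..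
  qed
  have J1: "J (a + 1) (b - 1) = J a b" for b
  proof -
    have e: "a + 1 + h = (a + h) + 1" "a + 1 - h = (a - h) + 1" "b - 1 + h = (b + h) - 1" "b - 1 - h = (b - h) - 1" by simp_all
    show ?thesis unfolding J_def W1 unfolding e ell_Gamma_add_1 ..
  qed
  have P1: "Pf (c + 1) = Pf c" "Pf (c - 1) = Pf c" for c
  proof -
    have e: "c + 1 - h = (c - h) + 1" "c + 1 + 2 * h = (c + 2 * h) + 1" "c + 2 * h + 1 + 1/2 = (c + 2 * h + 1/2) + 1" by simp_all
    show "Pf (c + 1) = Pf c" unfolding Pf_def e ell_Gamma_add_1 half.ell_Gamma_add_1 ..
    have e: "c - 1 - h = (c - h) - 1" "c - 1 + 2 * h = (c + 2 * h) - 1" "c + 2 * h - 1 + 1/2 = (c + 2 * h + 1/2) - 1" by simp_all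
    show "Pf (c - 1) = Pf c" unfolding Pf_def e ell_Gamma_add_1 half.ell_Gamma_add_1 ..
  qed
  have "S0 - (a + 1) = (S0 - a) - 1" by simp
  thus ?thesis unfolding Rf_def by (simp only: J1 P1)
qed

text \<open>The contiguous relation is used with d = S0 - a - 4h and requires Im a < Im d = Im s -
  Im h - Im a. Since Im s \<ge> 4 Im h, this holds for Im a < (3/2) Im h, and the bound 7/5 leaves
  some room.\<close>

lemma Rf_shift:
  assumes "Im h < Im a" "Im a < (7/5) * Im h"
  shows "Rf (a + 4 * h) = Rf a"
proof -
  define d where "d = S0 - a - 4 * h"
  have Imd: "Im d = Im s - Im h - Im a" by (simp add: d_def S0_def)
  have ad: "a + d = s - h + 1/2" by (simp add: d_def S0_def)
  have rel: "J (a + 4 * h) d * X d = J a (d + 4 * h) * X a"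
    using assms s h Imd by (intro contiguous_relation[OF ad]) auto
  have Xn: "X a \<noteq> 0" "X d \<noteq> 0"
    unfolding X_def using assms s h Imd theta0_nonzero[of "a - h" "2 * s"] theta0_nonzero[of "a + 2 * h + 1/2" "2 * s"]
      theta0_nonzero[of a s] theta0_nonzero[of "d - h" "2 * s"] theta0_nonzero[of "d + 2 * h + 1/2" "2 * s"]
      theta0_nonzero[of d s] by simp_all
  have P: "Pf (a + 4 * h) = X a * Pf a" "Pf (d + 4 * h) = X d * Pf d"
    using assms s h Imd by (auto intro!: Pf_shift)
  have "J (a + 4 * h) d / (Pf (a + 4 * h) * Pf d) = J a (d + 4 * h) / (Pf a * Pf (d + 4 * h))"
    unfolding P using rel Xn by (simp add: divide_eq_eq eq_divide_eq mult_ac)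
  moreover have "S0 - (a + 4 * h) = d" "S0 - a = d + 4 * h" by (simp_all add: d_def)
  ultimately show ?thesis unfolding Rf_def by (simp only:)
qed

text \<open>As 27/5 = 7/5 + 4, the shift by 4h takes the strip of \<open>Rf_shift\<close> onto the
  upper end of this one: \<open>Om\<close> is a little wider than one period.\<close>

definition Om :: "complex set" where "Om = {a. Im h < Im a} \<inter> {a. Im a < (27/5) * Im h}"

lemma holomorphic_Rf: "Rf holomorphic_on Om"
proof -
  have "(\<lambda>a. contour_integral rseg (W a (S0 - a))) holomorphic_on Om"
    by (rule holomorphic_on_subset[OF holomorphic_integral_W]) (use h s in \<open>auto simp: Om_def\<close>)
  thus ?thesis
    unfolding Rf_def J_def
    by (intro holomorphic_intros holomorphic_ell_Gamma_upper holomorphic_Pf)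
       (use h s in \<open>auto simp: Om_def Im_S0 Pf_nonzero\<close>)
qed

text \<open>Periodicity is known only inside \<open>Om\<close>. Rather than extending
  \<open>Rf\<close> to the plane for Liouville's theorem, the proof shows that all its values on
  \<open>Om\<close> are attained on a compact subset, and the maximum modulus principle
  applies.\<close>

lemma Rf_constant:
  assumes "a \<in> Om" "b \<in> Om"
  shows "Rf a = Rf b"
proof -
  define F where "F = (\<lambda>(x::real,y::real). of_real x + of_real y * h)"
  \<comment> \<open>The ordinates cover one full period 4 strictly inside the interval from 1 to
    27/5.\<close>
  define K where "K = F ` ({0..1} \<times> {6/5..26/5})"
  have KOm: "K \<subseteq> Om"
  proof
    fix a assume "a \<in> K"
    then obtain x y where a: "a = of_real x + of_real y * h" "6/5 \<le> y" "y \<le> 26/5" by (auto simp: K_def F_def)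
    hence "Im a = y * Im h" by simp
    moreover have "1 * Im h < y * Im h" "y * Im h < (27/5) * Im h"
      using a h by (auto intro!: mult_strict_right_mono)
    ultimately show "a \<in> Om" by (simp add: Om_def)
  qed
  have "compact K" unfolding K_def F_def
    by (intro compact_continuous_image compact_Times) (auto intro!: continuous_intros simp: case_prod_unfold)
  moreover have "continuous_on K (\<lambda>a. norm (Rf a))"
    by (intro continuous_intros holomorphic_on_imp_continuous_on holomorphic_on_subset[OF holomorphic_Rf KOm])
  moreover have "F (0, 2) \<in> K" unfolding K_def by (rule imageI) auto
  hence "K \<noteq> {}" by auto
  ultimately obtain m where m: "m \<in> K" "\<And>a. a \<in> K \<Longrightarrow> norm (Rf a) \<le> norm (Rf m)"
    using continuous_attains_sup by metis
  have mid: "\<exists>a'\<in>K. Rf a' = Rf a" if "(6/5) * Im h \<le> Im a" "Im a \<le> (26/5) * Im h" for a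
  proof -
    define x y where "x = Re a - Im a / Im h * Re h" and "y = Im a / Im h"
    have a: "a = of_real x + of_real y * h"
      unfolding x_def y_def by (rule complex_basis_decomposition) (use h in auto)
    have "6/5 \<le> y" "y \<le> 26/5" using that h by (simp_all add: y_def field_simps)
    moreover have "frac x \<in> {0..1}" by (auto intro: less_imp_le frac_lt_1)
    ultimately have "F (frac x, y) \<in> K" unfolding K_def by (intro imageI) auto
    moreover have "F (frac x, y) = a + of_int (- \<lfloor>x\<rfloor>) * 1" by (simp add: F_def a frac_def)
    hence "Rf (F (frac x, y)) = Rf a" using periodic_int[of Rf 1 a "- \<lfloor>x\<rfloor>", OF Rf_add_1] by simp
    ultimately show ?thesis by blast
  qed
  have rep: "\<exists>a'\<in>K. Rf a' = Rf a" if a: "a \<in> Om" for a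
  proof -
    consider "Im a < (6/5) * Im h" | "(6/5) * Im h \<le> Im a" "Im a \<le> (26/5) * Im h" | "(26/5) * Im h < Im a" by linarith
    thus ?thesis
    proof cases
      case 1
      have "Rf (a + 4 * h) = Rf a" using a 1 h by (intro Rf_shift) (auto simp: Om_def)
      moreover have "\<exists>a'\<in>K. Rf a' = Rf (a + 4 * h)" using a 1 h by (intro mid) (auto simp: Om_def)
      ultimately show ?thesis by simp
    next
      case 3
      have "Rf (a - 4 * h + 4 * h) = Rf (a - 4 * h)" using a 3 h by (intro Rf_shift) (auto simp: Om_def)
      moreover have "\<exists>a'\<in>K. Rf a' = Rf (a - 4 * h)" using a 3 h by (intro mid) (auto simp: Om_def)
      ultimately show ?thesis by simp
    qed (rule mid)
  qed
  have "Rf constant_on Om"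
  proof (rule maximum_modulus_principle[OF holomorphic_Rf])
    show "open Om" "open Om" unfolding Om_def by (intro open_Int open_halfspace_Im_gt open_halfspace_Im_lt)+
    show "connected Om" unfolding Om_def
      by (intro convex_connected convex_Int convex_halfspace_Im_gt convex_halfspace_Im_lt)
    show "m \<in> Om" using m(1) KOm by auto
    show "norm (Rf z) \<le> norm (Rf m)" if "z \<in> Om" for z using rep[OF that] m(2) by metis
  qed simp
  thus ?thesis using assms by (auto simp: constant_on_def)
qed

text \<open>At a = h both \<open>J a (S0 - a)\<close> and \<open>Pf a\<close> become infinite
  through \<open>G (a - h)\<close>. With this factor divided out of both, they are regular at h; the
  integral over the real period then carries the factor \<open>Gi (a - h)\<close>, which vanishes at
  a = h, so the residue term alone determines the constant.\<close>

lemma J_evaluation: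
  "J (4 * h + 1/2) (s - h) = Pf (4 * h + 1/2) * Pf (s - h) *
     (C * (G (- 2 * h) * G (2 * h) * (G (s + 3 * h + 1/2) * G (s + h + 1/2)) * T h) /
      (G (3 * h + 1/2) * hG h * Pf (s + 2 * h + 1/2)))"
proof -
  \<comment> \<open>The reciprocal of the Gamma function, in a form that is regular, and 0, at its
    pole w = 0.\<close>
  define Gi where "Gi = (\<lambda>w. qpoch2 w (4 * h) (2 * s) / qpoch2 (4 * h + 2 * s - w) (4 * h) (2 * s))"
  define Jn where "Jn = (\<lambda>a. contour_integral rseg (W a (S0 - a)) * Gi (a - h) +
      C * (G (- 2 * h) * G (a + h) * (G (S0 - a + h) * G (S0 - a - h)) * T h))"
  define Pn where "Pn = (\<lambda>a. G (a + 2 * h + 1/2) * hG a * Pf (S0 - a))"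
  define V where "V = {a. 0 < Im a} \<inter> {a. Im a < 2 * Im h}"
  have Pne: "Pf (S0 - a) \<noteq> 0" if "a \<in> V" for a
    using that h s by (intro Pf_nonzero) (auto simp: V_def Im_S0)
  have Pnn: "Pn a \<noteq> 0" if "a \<in> V" for a
    using that h s Pne[OF that] ell_Gamma_nonzero[of "a + 2 * h + 1/2"] half.ell_Gamma_nonzero[of a]
    by (simp add: Pn_def V_def)
  have "(\<lambda>a. contour_integral rseg (W a (S0 - a))) holomorphic_on V"
    by (rule holomorphic_on_subset[OF holomorphic_integral_W]) (use h s in \<open>auto simp: V_def\<close>)
  moreover have "(\<lambda>a. Gi (a - h)) holomorphic_on V"
    unfolding Gi_def by (intro holomorphic_intros holomorphic_qpoch2 qpoch2_nonzero) (use h s in \<open>auto simp: V_def\<close>)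
  ultimately have "(\<lambda>a. Jn a / Pn a) holomorphic_on V"
    unfolding Jn_def
  proof (intro holomorphic_intros holomorphic_ell_Gamma_upper)
    show "Pn holomorphic_on V" unfolding Pn_def
      by (intro holomorphic_intros holomorphic_ell_Gamma_upper half.holomorphic_ell_Gamma_upper holomorphic_Pf)
         (use h s in \<open>auto simp: V_def Im_S0\<close>)
  qed (use h s Pnn in \<open>auto simp: V_def Im_S0\<close>)
  moreover have "open V" unfolding V_def by (intro open_Int open_halfspace_Im_gt open_halfspace_Im_lt)
  moreover have hV: "h \<in> V" using h by (simp add: V_def)
  ultimately have cont: "isCont (\<lambda>a. Jn a / Pn a) h"
    by (metis holomorphic_on_imp_continuous_on continuous_on_eq_continuous_at)
  have eq: "Rf a = Jn a / Pn a" if a: "a \<in> Om" for a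
  proof -
    have g: "G (a - h) \<noteq> 0" using a h s by (intro ell_Gamma_nonzero) (auto simp: Om_def)
    hence gi: "G (a - h) * Gi (a - h) = 1" by (auto simp: ell_Gamma_eq Gi_def)
    hence gn: "Gi (a - h) \<noteq> 0" by auto
    have "J a (S0 - a) * Gi (a - h) = Jn a"
      unfolding J_def Jn_def using gi by algebra
    moreover have "Pf a * Pf (S0 - a) * Gi (a - h) = Pn a"
      unfolding Pn_def Pf_def[of a] using gi by algebra
    ultimately show ?thesis
      unfolding Rf_def using gn by (metis mult_divide_mult_cancel_right)
  qed
  define a0 where "a0 = 4 * h + 1/2"
  have a0: "a0 \<in> Om" using h by (simp add: a0_def Om_def)
  \<comment> \<open>A sequence inside \<open>Om\<close> that tends to the boundary point h, along
    which the quotient is constant.\<close>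
  have "(\<lambda>n. h + of_real (1 / (real n + 2)) * h) \<longlonglongrightarrow> h + of_real 0 * h"
    by (intro tendsto_intros) real_asymp
  hence "(\<lambda>n. Jn (h + of_real (1 / (real n + 2)) * h) / Pn (h + of_real (1 / (real n + 2)) * h)) \<longlonglongrightarrow> Jn h / Pn h"
    using isCont_tendsto_compose[OF cont] by simp
  moreover have "Jn (h + of_real (1 / (real n + 2)) * h) / Pn (h + of_real (1 / (real n + 2)) * h) = Rf a0" for n
  proof -
    have "h + of_real (1 / (real n + 2)) * h \<in> Om"
    proof -
      have "Im (h + of_real (1 / (real n + 2)) * h) = Im h + 1 / (real n + 2) * Im h"
        by (simp only: plus_complex.sel times_complex.sel Re_complex_of_real Im_complex_of_real)
      moreover have "0 < 1 / (real n + 2) * Im h" using h by simp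
      moreover have "1 / (real n + 2) * Im h \<le> 1 * Im h" using h by (intro mult_right_mono) auto
      ultimately show ?thesis using h unfolding Om_def Int_iff mem_Collect_eq by linarith
    qed
    thus ?thesis using eq Rf_constant a0 by metis
  qed
  ultimately have "Rf a0 = Jn h / Pn h" by (simp add: LIMSEQ_const_iff)
  moreover have "Gi (h - h) = 0"
  proof -
    have "qpoch2 0 (4 * h) (2 * s) = 0" using qpoch2_eq_0_iff[of 0] by (auto intro!: exI[of _ 0])
    thus ?thesis by (simp add: Gi_def)
  qed
  moreover have "S0 - h = s + 2 * h + 1/2" "S0 - a0 = s - h" by (simp_all add: S0_def a0_def)
  moreover have "Pf a0 \<noteq> 0" "Pf (S0 - a0) \<noteq> 0"
    using h s Pf_nonzero[of a0] Pf_nonzero[of "S0 - a0"] by (simp_all add: a0_def S0_def)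
  ultimately have "J a0 (s - h) = Pf a0 * Pf (s - h) * (C * (G (- 2 * h) * G (h + h) *
      (G (s + 2 * h + 1/2 + h) * G (s + 2 * h + 1/2 - h)) * T h) / (G (h + 2 * h + 1/2) * hG h * Pf (s + 2 * h + 1/2)))"
    unfolding Rf_def Jn_def Pn_def by (simp only: mult_zero_right add_0 divide_eq_eq) (simp add: mult_ac)
  moreover have "h + h = 2 * h" "s + 2 * h + 1/2 + h = s + 3 * h + 1/2" "s + 2 * h + 1/2 - h = s + h + 1/2" "h + 2 * h + 1/2 = 3 * h + 1/2"
    by simp_all
  ultimately show ?thesis unfolding a0_def by (simp only:)
qed

end

section \<open>Special values and the closed form of the beta integral\<close>

lemma qpoch_euler:
  assumes "Im t > 0"
  shows "qpoch (1/2) t * qpoch t (2 * t) = 2"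
proof -
  \<comment> \<open>The identity is Euler's (-q; q) (q; q^2) = 1 for partitions into distinct and
    into odd parts; the factor 2 split off here is 1 - \<open>ee (1/2)\<close>.\<close>
  have "qpoch (1/2) t = 2 * qpoch (t + 1/2) t"
    using qpoch_rec[OF assms, of "1/2"] by (simp add: add.commute)
  moreover have "qpoch (2 * t) (2 * t) = qpoch t t * qpoch (t + 1/2) t" by (rule qpoch_double[OF assms])
  moreover have "qpoch t t = qpoch t (2 * t) * qpoch (2 * t) (2 * t)"
    using qpoch_dissect[OF assms, of t] by simp
  moreover have "qpoch (2 * t) (2 * t) \<noteq> 0" using assms by (intro qpoch_nonzero) auto
  ultimately show ?thesis by (simp add: mult_ac)
qed

lemma qpoch_diff_1: "qpoch (z - 1) \<tau> = qpoch z \<tau>"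
  using qpoch_add_of_int[of z "-1" \<tau>] by simp

lemma (in two_periods) qpoch2_add_1: "qpoch2 (z + 1) \<tau> \<sigma> = qpoch2 z \<tau> \<sigma>" "qpoch2 (z - 1) \<tau> \<sigma> = qpoch2 z \<tau> \<sigma>"
  using qpoch2_add_of_int[of z 1 \<tau> \<sigma>] qpoch2_add_of_int[of z "-1" \<tau> \<sigma>] by simp_all

context two_periods begin

lemma ell_Gamma_half_period_fst:
  assumes "2 * w = \<tau>"
  shows "ell_Gamma w \<tau> \<sigma> = 1 / qpoch w \<tau>"
proof -
  have w: "Im w > 0" using assms tau by (metis Im_complex_of_real add_cancel_right_left mult_2 plus_complex.sel(2) add_pos_pos linorder_neqE_linordered_idom not_less_iff_gr_or_eq add_neg_neg)
  have "\<tau> + \<sigma> - w = w + \<sigma>" using assms by (simp add: algebra_simps)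
  thus ?thesis
    unfolding ell_Gamma_eq qpoch2_rec'[of w] using qpoch2_nonzero[of "w + \<sigma>"] w sigma by simp
qed

lemma ell_Gamma_half_period_snd:
  assumes "2 * w = \<sigma>"
  shows "ell_Gamma w \<tau> \<sigma> = 1 / qpoch w \<sigma>"
  using two_periods.ell_Gamma_half_period_fst[OF two_periods.intro[OF sigma tau] assms]
  by (simp add: ell_Gamma_commute)

lemma ell_Gamma_half_sum:
  assumes "2 * w = \<tau> + \<sigma>"
  shows "ell_Gamma w \<tau> \<sigma> = 1"
proof -
  have "Im (2 * w) = Im (\<tau> + \<sigma>)" using assms by simp
  hence w: "Im w > 0" using tau sigma by simp
  have "\<tau> + \<sigma> - w = w" unfolding assms[symmetric] by simp
  thus ?thesis using qpoch2_nonzero[OF w] by (simp add: ell_Gamma_eq)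
qed

lemma ell_Gamma_one_half: "ell_Gamma (1/2) \<tau> \<sigma> = 2 / (qpoch (1/2) \<sigma> * qpoch (1/2) \<tau>)"
proof -
  have 1: "qpoch2 (\<tau> + \<sigma> - 1/2) \<tau> \<sigma> = qpoch2 (1/2 + \<tau> + \<sigma>) \<tau> \<sigma>"
    using qpoch2_add_1(1)[of "\<tau> + \<sigma> - 1/2"] by (simp add: algebra_simps)
  have "qpoch2 (1/2) \<tau> \<sigma> = qpoch (1/2) \<sigma> * (qpoch (1/2 + \<tau>) \<tau> * qpoch2 (1/2 + \<tau> + \<sigma>) \<tau> \<sigma>)"
    unfolding qpoch2_rec[of "1/2"] qpoch2_rec'[of "1/2 + \<tau>"] ..
  moreover have "qpoch (1/2) \<tau> = 2 * qpoch (1/2 + \<tau>) \<tau>"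
    using qpoch_rec[OF tau, of "1/2"] by simp
  moreover have "qpoch2 (1/2 + \<tau> + \<sigma>) \<tau> \<sigma> \<noteq> 0" using tau sigma by (intro qpoch2_nonzero) auto
  ultimately show ?thesis unfolding ell_Gamma_eq 1 by simp
qed

end

context beta_setup begin

lemma J_factored:
  "J (4 * h + 1/2) (s - h) = C * T h * (G (- 2 * h) * G (2 * h)) * (G (6 * h) * G (s - 2 * h) / G (s + 4 * h)) *
     (hG (4 * h + 1/2) / hG (s + 2 * h + 1/2)) * (hG (s - h) / hG h)"
proof -
  \<comment> \<open>Modulo 1 the two arguments add up to 4h + 2s, so reflection applies.\<close>
  have refl: "G (s + 3 * h + 1/2) * G (s + h + 1/2) = 1"
  proof -
    have "4 * h + 2 * s - (s + 3 * h + 1/2) = (s + h + 1/2) - 1" by simp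
    hence "G (4 * h + 2 * s - (s + 3 * h + 1/2)) = G (s + h + 1/2)" by (simp only: ell_Gamma_add_1)
    moreover have "G (s + 3 * h + 1/2) * G (4 * h + 2 * s - (s + 3 * h + 1/2)) = 1"
      using h s by (intro ell_Gamma_reflect qpoch2_nonzero) auto
    ultimately show ?thesis by simp
  qed
  have e: "4 * h + 1/2 - h = 3 * h + 1/2" "4 * h + 1/2 + 2 * h + 1/2 = 6 * h + 1" "s - h - h = s - 2 * h" "s - h + 2 * h + 1/2 = s + h + 1/2"
    "s + 2 * h + 1/2 - h = s + h + 1/2" "s + 2 * h + 1/2 + 2 * h + 1/2 = s + 4 * h + 1" by simp_all
  have nz: "G (3 * h + 1/2) \<noteq> 0" "G (s + h + 1/2) \<noteq> 0"
    using h s ell_Gamma_nonzero[of "3 * h + 1/2"] ell_Gamma_nonzero[of "s + h + 1/2"] by simp_all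
  show ?thesis
    unfolding J_evaluation refl mult_1_right Pf_def e ell_Gamma_add_1 using nz by (simp add: field_simps)
qed

text \<open>All arguments are half-periods of 4h and 2s or differ from one by 4h. At half-periods
  the two double products of the Gamma function cancel up to simple products.\<close>

lemma Gamma_values:
  "G (2 * h) = 1 / qpoch (2 * h) (4 * h)"
  "G (- 2 * h) * G (2 * h) = 1 / ((qpoch (2 * h) (4 * h))\<^sup>2 * th (- 2 * h))"
  "G (6 * h) = th (2 * h) / qpoch (2 * h) (4 * h)"
  "G (s - 2 * h) = 1 / th (s + 2 * h)"
  "G s = 1 / qpoch s (2 * s)"
  "G (s + 4 * h) = qpoch s (2 * s)"
proof -
  show 1: "G (2 * h) = 1 / qpoch (2 * h) (4 * h)" by (rule ell_Gamma_half_period_fst) simp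
  have 2: "G (2 * h) = th (- 2 * h) * G (- 2 * h)"
    using ell_Gamma_shift[of "- 2 * h"] qpoch_nonzero_between[of "2 * s" "- 2 * h"] h s by simp
  have "G (2 * h) \<noteq> 0" using h s by (intro ell_Gamma_nonzero) auto
  hence "th (- 2 * h) \<noteq> 0" "G (- 2 * h) \<noteq> 0" using 2 by auto
  hence "G (- 2 * h) = G (2 * h) / th (- 2 * h)" using 2 by (simp add: field_simps)
  thus "G (- 2 * h) * G (2 * h) = 1 / ((qpoch (2 * h) (4 * h))\<^sup>2 * th (- 2 * h))"
    unfolding 1 by (simp add: power2_eq_square)
  show "G (6 * h) = th (2 * h) / qpoch (2 * h) (4 * h)"
    using ell_Gamma_shift_upper[of "2 * h"] h 1 by simp
  have "G (s + 2 * h) = 1" by (rule ell_Gamma_half_sum) simp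
  moreover have "G (s + 2 * h) = th (s - 2 * h) * G (s - 2 * h)"
    using ell_Gamma_shift_upper[of "s - 2 * h"] h s by (simp add: add.commute)
  moreover have "th (s - 2 * h) = th (s + 2 * h)"
    using theta0_reflect[of "2 * s" "s + 2 * h"] by (simp add: algebra_simps)
  ultimately have n: "G (s - 2 * h) * th (s + 2 * h) = 1" by (simp add: mult.commute)
  hence "th (s + 2 * h) \<noteq> 0" by auto
  thus "G (s - 2 * h) = 1 / th (s + 2 * h)" using n by (simp add: eq_divide_eq)
  show 3: "G s = 1 / qpoch s (2 * s)" by (rule ell_Gamma_half_period_snd) simp
  have "qpoch s (2 * s) \<noteq> 0" using positive by (intro qpoch_nonzero)
  thus "G (s + 4 * h) = qpoch s (2 * s)"
    using ell_Gamma_shift_upper[of s] positive 3 by (simp add: theta0_def)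
qed

text \<open>For the second value, reflection gives hG(s - h) = 1 / hG(5h) and hG(s + h) = 1 /
  hG(3h), and the shifts by 4h and by s reduce 5h and s + h to h. The quotient hG(3h) / hG(h) stays;
  it is the one in the theorem.\<close>

lemma hGamma_values:
  "hG (4 * h + 1/2) / hG (s + 2 * h + 1/2) = 2 * ths (1/2) / (qpoch (1/2) s * qpoch (1/2) (4 * h) * qpoch (2 * h + 1/2) (4 * h))"
  "hG (s - h) / hG h = th4 h / ths h * (hG (3 * h) / hG h)"
proof -
  have ne: "qpoch (1/2) s \<noteq> 0"
  proof
    assume "qpoch (1/2) s = 0"
    moreover have "qpoch (1/2) s = 2 * qpoch (1/2 + s) s" using qpoch_rec[OF positive(3), of "1/2"] by simp
    ultimately show False using qpoch_nonzero[OF positive(3), of "1/2 + s"] positive by simp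
  qed
  have "hG (4 * h + 1/2) = ths (1/2) * hG (1/2)"
    using half.ell_Gamma_shift[OF ne] by (simp add: add.commute)
  moreover have "hG (s + 2 * h + 1/2) = qpoch (2 * h + 1/2) (4 * h)"
  proof -
    have "4 * h + s - (s + 2 * h + 1/2) = (2 * h + 1/2) - 1" by simp
    hence "hG (s + 2 * h + 1/2) = qpoch2 (2 * h + 1/2) (4 * h) s / qpoch2 (s + 2 * h + 1/2) (4 * h) s"
      unfolding half.ell_Gamma_eq by (simp only: half.qpoch2_add_1)
    moreover have "qpoch2 (2 * h + 1/2) (4 * h) s = qpoch (2 * h + 1/2) (4 * h) * qpoch2 (s + 2 * h + 1/2) (4 * h) s"
      using half.qpoch2_rec'[of "2 * h + 1/2"] by (simp add: algebra_simps)
    moreover have "qpoch2 (s + 2 * h + 1/2) (4 * h) s \<noteq> 0" using h s by (intro half.qpoch2_nonzero) auto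
    ultimately show ?thesis by simp
  qed
  ultimately show "hG (4 * h + 1/2) / hG (s + 2 * h + 1/2) = 2 * ths (1/2) / (qpoch (1/2) s * qpoch (1/2) (4 * h) * qpoch (2 * h + 1/2) (4 * h))"
    by (simp add: half.ell_Gamma_one_half)
  have a: "hG (s - h) * hG (5 * h) = 1"
  proof -
    have "hG (s - h) * hG (4 * h + s - (s - h)) = 1"
      using h s by (intro half.ell_Gamma_reflect half.qpoch2_nonzero) auto
    thus ?thesis by simp
  qed
  have b: "hG (3 * h) * hG (s + h) = 1"
  proof -
    have "hG (3 * h) * hG (4 * h + s - 3 * h) = 1"
      using h s by (intro half.ell_Gamma_reflect half.qpoch2_nonzero) auto
    moreover have "4 * h + s - 3 * h = s + h" by simp
    ultimately show ?thesis by (simp only:)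
  qed
  have c: "hG (5 * h) = ths h * hG h" using half.ell_Gamma_shift_upper[of h] h by simp
  have d: "hG (s + h) = th4 h * hG h"
    using two_periods.ell_Gamma_shift_upper[OF two_periods.intro[OF positive(3,1)], of h] h half.ell_Gamma_commute
    by (simp add: add.commute)
  have "hG (s - h) * ths h = hG (3 * h) * th4 h"
  proof -
    have "(hG (s - h) * ths h) * hG h = (hG (3 * h) * th4 h) * hG h"
      using a b unfolding c d by (simp add: mult_ac)
    moreover have "hG h \<noteq> 0" using a c by auto
    ultimately show ?thesis by simp
  qed
  moreover have "ths h \<noteq> 0" using a c by auto
  ultimately have "hG (s - h) = hG (3 * h) * th4 h / ths h" by (simp add: eq_divide_eq)
  thus "hG (s - h) / hG h = th4 h / ths h * (hG (3 * h) / hG h)" by simp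
qed

text \<open>The left-hand side collects the factors that surround \<open>J\<close> in the Macdonald
  polynomial. Once \<open>J\<close> is inserted, all theta functions and simple products of period s
  or 2s cancel, and s survives in the two Gamma functions only.\<close>

lemma J_closed_form:
  "- ee (- h) * ths (2 * h) * qpoch (2 * s) (2 * s) * J (4 * h + 1/2) (s - h) /
     ((ths (h + 1/2))\<^sup>2 * ths (1/2) * (qpoch (4 * h) (4 * h))\<^sup>2 * (th4 h)\<^sup>2 * th4 (2 * h)) =
   hG (3 * h) / hG h / ((qpoch (2 * h) (2 * h))\<^sup>2 * qpoch h h)"
proof -
  define A B D E where "A = qpoch (2 * h) (4 * h)" and "B = qpoch (4 * h) (4 * h)" and
    "D = qpoch (2 * h) (2 * h)" and "E = qpoch h h"
  define p1 p2 p3 p4 where "p1 = qpoch (1/2) s" and "p2 = qpoch s (2 * s)" and "p3 = qpoch (1/2) (4 * h)"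
    and "p4 = qpoch (2 * h + 1/2) (4 * h)"
  have pos: "Im (2 * h) > 0" using h by simp
  have r1: "p1 * p2 = 2" unfolding p1_def p2_def by (rule qpoch_euler[OF positive(3)])
  have r2: "p3 * p4 * A = 2"
    using qpoch_euler[OF pos] qpoch_dissect[OF pos, of "1/2"] unfolding p3_def p4_def A_def by (simp add: add.commute)
  have r3: "D = A * B" unfolding A_def B_def D_def using qpoch_dissect[OF pos, of "2 * h"] by simp
  have r4: "th4 (h + 1/2) * E = D * A"
  proof -
    have "qpoch (4 * h - (h + 1/2)) (4 * h) = qpoch (h + 1/2 + 2 * h) (4 * h)"
      using qpoch_diff_1[of "h + 1/2 + 2 * h" "4 * h"] by (simp add: algebra_simps)
    hence "th4 (h + 1/2) = qpoch (h + 1/2) (2 * h)"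
      using qpoch_dissect[OF pos, of "h + 1/2"] by (simp add: theta0_def)
    moreover have "E = qpoch h (2 * h) * D" using qpoch_dissect[OF h, of h] by (simp add: E_def D_def)
    moreover have "qpoch (2 * h) (2 * (2 * h)) = qpoch h (2 * h) * qpoch (h + 1/2) (2 * h)" by (rule qpoch_double[OF pos])
    ultimately show ?thesis by (simp add: A_def)
  qed
  have t1: "th4 (2 * h) = A\<^sup>2" by (simp add: theta0_def A_def power2_eq_square)
  have t2: "th4 (3 * h) = th4 h" using theta0_reflect[of "4 * h" h] by simp
  have t3: "ths h * ths (h + 1/2) = th (2 * h)" using theta0_double[OF positive(3), of h] by simp
  have t4: "ths (2 * h) = th (2 * h) * th (s + 2 * h)" using theta0_dissect[OF positive(3), of "2 * h"] by (simp add: add.commute)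
  have t5: "th (- 2 * h) = - ee (- 2 * h) * th (2 * h)" using theta0_minus[OF positive(2), of "2 * h"] by simp
  have t6: "ee (- h) * ee (- h) = ee (- 2 * h)" by (simp flip: ee_add)
  have nz: "A \<noteq> 0" "B \<noteq> 0" "D \<noteq> 0" "E \<noteq> 0" "th4 h \<noteq> 0" "th (2 * h) \<noteq> 0" "th (s + 2 * h) \<noteq> 0"
    "qpoch (2 * s) (2 * s) \<noteq> 0"
    unfolding A_def B_def D_def E_def by (rule qpoch_nonzero theta0_nonzero; use h s in simp)+
  have nz2: "p1 \<noteq> 0" "p2 \<noteq> 0" "p3 \<noteq> 0" "p4 \<noteq> 0" using r1 r2 by auto
  have nz3: "ths h \<noteq> 0" "ths (h + 1/2) \<noteq> 0" using t3 nz(6) by auto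
  have nz4: "ths (1/2) \<noteq> 0"
  proof -
    have "qpoch (s - 1/2) s \<noteq> 0" using positive by (intro qpoch_nonzero) auto
    thus ?thesis using nz2(1) by (simp add: theta0_def p1_def)
  qed
  have "J (4 * h + 1/2) (s - h) = C * T h * (1 / (A\<^sup>2 * th (- 2 * h))) * (th (2 * h) / A * (1 / th (s + 2 * h)) / p2) *
     (2 * ths (1/2) / (p1 * p3 * p4)) * (th4 h / ths h * (hG (3 * h) / hG h))"
    unfolding J_factored Gamma_values(2-6) hGamma_values A_def p1_def p2_def p3_def p4_def ..
  also have "\<dots> = (2 / (B * qpoch (2 * s) (2 * s))) * (ee (- h) * th4 (h + 1/2) * th4 h * ths (h + 1/2)) *
     (- 1 / (A ^ 3 * ee (- 2 * h))) * (1 / th (s + 2 * h)) *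
     (2 * ths (1/2) / ((p1 * p2) * (p3 * p4))) * (th4 h / ths h * (hG (3 * h) / hG h))"
    unfolding C_def B_def[symmetric] T_def t5 using nz t2 by (simp add: power2_eq_square power3_eq_cube)
  finally have J: "J (4 * h + 1/2) (s - h) = (2 / (B * qpoch (2 * s) (2 * s))) * (ee (- h) * th4 (h + 1/2) * th4 h * ths (h + 1/2)) *
     (- 1 / (A ^ 3 * ee (- 2 * h))) * (1 / th (s + 2 * h)) *
     (2 * ths (1/2) / (2 * (p3 * p4))) * (th4 h / ths h * (hG (3 * h) / hG h))"
    unfolding r1 .
  have p34: "p3 * p4 = 2 / A" using r2 nz(1) by (simp add: field_simps)
  have "- ee (- h) * ths (2 * h) * qpoch (2 * s) (2 * s) * J (4 * h + 1/2) (s - h) /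
     ((ths (h + 1/2))\<^sup>2 * ths (1/2) * B\<^sup>2 * (th4 h)\<^sup>2 * A\<^sup>2) =
     (th4 (h + 1/2) / (A ^ 4 * B ^ 3)) * (hG (3 * h) / hG h)"
    unfolding J t4 t3[symmetric] p34 t6[symmetric] using nz nz3 nz4
    by (simp add: power2_eq_square power3_eq_cube power4_eq_xxxx field_simps)
  also have "th4 (h + 1/2) / (A ^ 4 * B ^ 3) = 1 / (D\<^sup>2 * E)"
  proof -
    have "th4 (h + 1/2) = D * A / E" using r4 nz(4) by (simp add: field_simps)
    thus ?thesis unfolding r3 using nz by (simp add: power2_eq_square power3_eq_cube power4_eq_xxxx field_simps)
  qed
  finally show ?thesis unfolding t1 B_def D_def E_def by (simp add: field_simps)
qed

section \<open>The antisymmetrised integral\<close>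

text \<open>The integrands of \<open>Delta\<close> combine to a multiple of \<open>gf t * bf u t\<close>; \<open>rp\<close> is the residue of \<open>gf\<close> at \<open>h\<close>.\<close>

definition gf :: "complex \<Rightarrow> complex" where
  "gf t = hG (t - h) * hG (- t - h) * (ee (- t) * th4 (t - 2 * h))"

definition bf :: "complex \<Rightarrow> complex \<Rightarrow> complex" where
  "bf u t = ee (- t) * ths (t - u) * th (1/2 + 2 * u + t)"

definition rp :: complex where
  "rp = - 1 / (2 * of_real pi * \<i> * (qpoch (4 * h) (4 * h) * qpoch s s)) * (hG (- 2 * h) * (ee (- h) * th4 (- h)))"

text \<open>The integral of \<open>gf * \<phi>\<close> over a separating cycle, for entire \<open>\<phi>\<close>.\<close>

definition Lf :: "(complex \<Rightarrow> complex) \<Rightarrow> complex" where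
  "Lf \<phi> = contour_integral rseg (\<lambda>t. gf t * \<phi> t) - 2 * of_real pi * \<i> * rp * (\<phi> h + \<phi> (- h))"

lemma th4_flip: "th4 (- t - 2 * h) = ee (- 2 * t) * th4 (t - 2 * h)"
proof -
  have "th4 (- t - 2 * h) = th4 (- (t + 2 * h))" by (simp add: algebra_simps)
  also have "\<dots> = - ee (- (t + 2 * h)) * th4 (t - 2 * h + 4 * h)"
    using theta0_minus[OF positive(1), of "t + 2 * h"] by (simp add: algebra_simps)
  also have "\<dots> = ee (- (t + 2 * h)) * ee (- (t - 2 * h)) * th4 (t - 2 * h)"
    unfolding theta0_shift[OF positive(1)] by simp
  also have "ee (- (t + 2 * h)) * ee (- (t - 2 * h)) = ee (- 2 * t)"
    unfolding ee_add[symmetric] by (rule arg_cong[of _ _ ee]) (simp add: algebra_simps)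
  finally show ?thesis .
qed

lemma gf_even: "gf (- t) = gf t"
proof -
  have "ee (- (- t)) * ee (- 2 * t) = ee (- t)" unfolding ee_add[symmetric] by (rule arg_cong[of _ _ ee]) simp
  thus ?thesis unfolding gf_def th4_flip by (simp add: mult_ac)
qed

lemma gf_periodic: "gf (t + 1) = gf t"
proof -
  have e: "t + 1 - h = (t - h) + 1" "- (t + 1) - h = (- t - h) - 1" "t + 1 - 2 * h = (t - 2 * h) + 1" by simp_all
  have "ee (- (t + 1)) = ee (- t)" by (simp add: ee_diff)
  thus ?thesis unfolding gf_def e half.ell_Gamma_add_1 theta0_add_1 by simp
qed

lemma qpoch2_lattice:
  assumes "qpoch2 (t - h) (4 * h) s = 0"
  shows "\<exists>(j::nat) (k::nat) (n::int). t = h - of_nat j * (4 * h) - of_nat k * s + of_int n"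
proof -
  obtain n m :: nat and k :: int where "t - h + of_nat n * (4 * h) + of_nat m * s = of_int k"
    using assms half.qpoch2_eq_0_iff by blast
  hence "t = h - of_nat n * (4 * h) - of_nat m * s + of_int k" by (simp add: algebra_simps)
  thus ?thesis by blast
qed

lemma gf_differentiable:
  assumes "qpoch2 (t - h) (4 * h) s \<noteq> 0" "qpoch2 (- t - h) (4 * h) s \<noteq> 0"
  shows "gf field_differentiable at t"
proof -
  define A where "A = (\<lambda>t. qpoch2 (t - h) (4 * h) s * qpoch2 (- t - h) (4 * h) s) -` (- {0})"
  have "(\<lambda>t. qpoch2 (t - h) (4 * h) s * qpoch2 (- t - h) (4 * h) s) holomorphic_on UNIV"
    by (intro holomorphic_intros half.holomorphic_qpoch2)
  hence "open A" unfolding A_def by (intro open_vimage holomorphic_on_imp_continuous_on) auto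
  moreover have "gf holomorphic_on A"
    unfolding gf_def A_def
    by (intro holomorphic_intros half.holomorphic_ell_Gamma holomorphic_theta0 positive) auto
  moreover have "t \<in> A" using assms by (simp add: A_def)
  ultimately show ?thesis by (metis holomorphic_on_imp_differentiable_at)
qed

lemma half_real_line:
  assumes "Im z = 0"
  shows "qpoch2 (z - h) (4 * h) s \<noteq> 0" "qpoch (z - h) s \<noteq> 0"
proof -
  show 1: "qpoch (z - h) s \<noteq> 0" using assms h s by (intro qpoch_nonzero_between) auto
  show "qpoch2 (z - h) (4 * h) s \<noteq> 0"
    using 1 half.qpoch2_rec[of "z - h"] half.qpoch2_nonzero[of "z - h + 4 * h"] assms h by simp
qed

lemma continuous_gf: "continuous_on (path_image rseg) gf"
  using half_real_line half_real_line[of "- _"] gf_differentiable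
  by (intro continuous_at_imp_continuous_on ballI field_differentiable_imp_continuous_at) (auto dest!: Im_rseg)

lemma gf_residue: "((\<lambda>t. gf t * (t - h)) \<longlongrightarrow> rp) (at h)"
proof -
  define K where "K = (\<lambda>t. hG (- t - h) * (ee (- t) * th4 (t - 2 * h)))"
  define A where "A = (\<lambda>t. qpoch2 (- t - h) (4 * h) s) -` (- {0})"
  have "(\<lambda>t. qpoch2 (- t - h) (4 * h) s) holomorphic_on UNIV"
    by (intro holomorphic_intros half.holomorphic_qpoch2)
  hence "open A" unfolding A_def by (intro open_vimage holomorphic_on_imp_continuous_on) auto
  moreover have "K holomorphic_on A"
    unfolding K_def A_def
    by (intro holomorphic_intros half.holomorphic_ell_Gamma holomorphic_theta0 positive) auto
  moreover have "h \<in> A"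
  proof -
    have "qpoch (- 2 * h) s \<noteq> 0" using h s by (intro qpoch_nonzero_between) auto
    hence "qpoch2 (- 2 * h) (4 * h) s \<noteq> 0"
      using half.qpoch2_rec[of "- 2 * h"] half.qpoch2_nonzero[of "- 2 * h + 4 * h"] h by simp
    thus ?thesis by (simp add: A_def)
  qed
  ultimately have "isCont K h"
    by (metis holomorphic_on_imp_continuous_on continuous_on_eq_continuous_at)
  hence "(K \<longlongrightarrow> K h) (at h)" by (simp add: isCont_def)
  hence "((\<lambda>t. hG (t - h) * (t - h) * K t) \<longlongrightarrow>
      - 1 / (2 * of_real pi * \<i> * (qpoch (4 * h) (4 * h) * qpoch s s)) * K h) (at h)"
    by (intro tendsto_mult half.ell_Gamma_pole)
  moreover have "hG (t - h) * (t - h) * K t = gf t * (t - h)" for t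
    unfolding K_def gf_def by (simp only: mult_ac)
  moreover have "- 1 / (2 * of_real pi * \<i> * (qpoch (4 * h) (4 * h) * qpoch s s)) * K h = rp"
    by (simp add: K_def rp_def)
  ultimately show ?thesis by simp
qed

lemma gf_residue': "((\<lambda>t. gf t * (t + h)) \<longlongrightarrow> - rp) (at (- h))"
proof -
  have "filterlim (\<lambda>z::complex. - z) (at h) (at (- h))"
    by (auto simp: filterlim_at eventually_at_filter minus_equation_iff[of _ h] intro!: tendsto_eq_intros always_eventually)
  from tendsto_minus[OF filterlim_compose[OF gf_residue this]]
  show ?thesis by (simp add: gf_even algebra_simps)
qed

lemma Lf_linear:
  assumes "continuous_on UNIV \<phi>" "continuous_on UNIV \<psi>"
  shows "Lf (\<lambda>t. a * \<phi> t + b * \<psi> t) = a * Lf \<phi> + b * Lf \<psi>"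
proof -
  have i: "(\<lambda>t. gf t * f t) contour_integrable_on rseg" if "continuous_on UNIV f" for f
    by (intro rseg_integrable continuous_intros continuous_gf continuous_on_subset[OF that]) auto
  have "contour_integral rseg (\<lambda>t. gf t * (a * \<phi> t + b * \<psi> t)) =
      contour_integral rseg (\<lambda>t. a * (gf t * \<phi> t) + b * (gf t * \<psi> t))"
    by (simp add: algebra_simps)
  also have "\<dots> = a * contour_integral rseg (\<lambda>t. gf t * \<phi> t) + b * contour_integral rseg (\<lambda>t. gf t * \<psi> t)"
    using i assms by (subst contour_integral_add) (auto simp: contour_integral_lmul intro!: contour_integrable_lmul)
  finally show ?thesis unfolding Lf_def by (simp add: algebra_simps)
qed

text \<open>Hence \<open>Lf\<close> depends on the even part of its argument only; this is the sense
  of working modulo odd functions.\<close>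

lemma Lf_reflect: "Lf (\<lambda>t. \<phi> (- t)) = Lf \<phi>"
  using contour_integral_rseg_reflect[of "\<lambda>t. gf t * \<phi> t"] by (simp add: Lf_def gf_even add.commute)

lemma holomorphic_bf: "bf u holomorphic_on A"
  unfolding bf_def[abs_def] by (intro holomorphic_intros holomorphic_theta0 positive)

lemma continuous_bf: "continuous_on A (bf u)" "continuous_on A (\<lambda>t. bf u (- t))"
proof -
  have "continuous_on UNIV (bf u)" using holomorphic_bf by (rule holomorphic_on_imp_continuous_on)
  thus "continuous_on A (bf u)" "continuous_on A (\<lambda>t. bf u (- t))"
    by (auto intro!: continuous_on_compose2[of UNIV "bf u"] continuous_intros intro: continuous_on_subset)
qed

text \<open>The integrand is odd about \<open>-2 h\<close>, and there is no other pole between the line through this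
  point and the cycle.\<close>

lemma Lf_bf_h: "Lf (bf h) = 0"
proof -
  \<comment> \<open>On the real line \<open>hG (t - h)\<close> absorbs the factor
    \<open>ths (t - h)\<close> of \<open>bf h\<close> and becomes \<open>hG (t + 3 * h)\<close>.
    This moves its first pole from h to -3h, below the line through -2h, and makes the symmetry
    about -2h visible.\<close>
  define Z where "Z = (\<lambda>t. hG (t + 3 * h) * hG (- h - t) * (ee (- 2 * t) * th4 (t - 2 * h) * th (t + 2 * h + 1/2)))"
  have Zper: "Z (t + 1) = Z t" for t
  proof -
    have e: "t + 1 + 3 * h = (t + 3 * h) + 1" "- h - (t + 1) = (- h - t) - 1" "t + 1 - 2 * h = (t - 2 * h) + 1"
      "t + 1 + 2 * h + 1/2 = (t + 2 * h + 1/2) + 1" by simp_all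
    have "ee (- 2 * (t + 1)) = ee (- 2 * t)" using ee_of_int[of 2] by (simp add: ee_diff distrib_left)
    thus ?thesis unfolding Z_def by (simp only: e half.ell_Gamma_add_1 theta0_add_1)
  qed
  have Zodd: "Z (2 * (- 2 * h) - t) = - Z t" for t
  proof -
    have "ee (- t - 2 * h - 4 * h) * ee (- 2 * t) = ee (- 3 * t - 6 * h)"
      unfolding ee_add[symmetric] by (rule arg_cong[of _ _ ee]) simp
    moreover have "th4 (- t - 2 * h - 4 * h) = - ee (- t - 2 * h - 4 * h) * th4 (- t - 2 * h)"
      using theta0_eq_shift[OF positive(1), of "- t - 2 * h - 4 * h"] by (simp only: diff_add_cancel)
    ultimately have "th4 (- t - 2 * h - 4 * h) = - ee (- 3 * t - 6 * h) * th4 (t - 2 * h)"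
      unfolding th4_flip by (metis mult.assoc mult_minus_left)
    moreover have "2 * (- 2 * h) - t - 2 * h = - t - 2 * h - 4 * h" by simp
    ultimately have b: "th4 (2 * (- 2 * h) - t - 2 * h) = - ee (- 3 * t - 6 * h) * th4 (t - 2 * h)" by (simp only:)
    have c: "th (2 * (- 2 * h) - t + 2 * h + 1/2) = ee (- (t + 2 * h)) * th (t + 2 * h + 1/2)"
      using theta0_half_minus[OF positive(2), of "t + 2 * h"] by (simp add: algebra_simps)
    have e: "ee (- 2 * (2 * (- 2 * h) - t)) * ee (- 3 * t - 6 * h) * ee (- (t + 2 * h)) = ee (- 2 * t)"
      unfolding ee_add[symmetric] by (rule arg_cong[of _ _ ee]) (simp add: algebra_simps)
    have g: "2 * (- 2 * h) - t + 3 * h = - h - t" "- h - (2 * (- 2 * h) - t) = t + 3 * h"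
      by (simp_all add: algebra_simps)
    show ?thesis
      unfolding Z_def b c g e[symmetric] by (simp only: mult_ac mult_minus_left mult_minus_right)
  qed
  have Zdiff: "Z field_differentiable at z"
    if z: "- (5/2) * Im h < Im z" "Im z < Im h / 2" "\<And>n. z \<noteq> of_int n - h" for z
  proof -
    define A where "A = ({z. Im z > - (5/2) * Im h} \<inter> {z. Im z < Im h / 2}) \<inter>
      ((\<lambda>z. qpoch2 (- h - z) (4 * h) s) -` (- {0}))"
    have op: "open A"
    proof -
      have "(\<lambda>z. qpoch2 (- h - z) (4 * h) s) holomorphic_on UNIV"
        by (intro half.holomorphic_qpoch2 holomorphic_intros)
      thus ?thesis unfolding A_def
        by (intro open_Int open_halfspace_Im_gt open_halfspace_Im_lt open_vimage holomorphic_on_imp_continuous_on) auto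
    qed
    have "qpoch2 (- h - z) (4 * h) s \<noteq> 0"
    proof
      assume "qpoch2 (- h - z) (4 * h) s = 0"
      then obtain n m :: nat and k :: int where nm: "- h - z + of_nat n * (4 * h) + of_nat m * s = of_int k"
        using half.qpoch2_eq_0_iff by blast
      hence "Im (- h - z + of_nat n * (4 * h) + of_nat m * s) = 0" by simp
      hence I: "Im z = - Im h + real n * (4 * Im h) + real m * Im s" by simp
      have "n = 0"
      proof (rule ccontr)
        assume "n \<noteq> 0"
        hence "1 * (4 * Im h) \<le> real n * (4 * Im h)" using h by (intro mult_right_mono) auto
        moreover have "real m * Im s \<ge> 0" using h s by simp
        ultimately show False using I z(2) h by linarith
      qed
      moreover have "m = 0"
      proof (rule ccontr)
        assume "m \<noteq> 0"
        hence "1 * Im s \<le> real m * Im s" using h s by (intro mult_right_mono) auto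
        moreover have "real n * (4 * Im h) \<ge> 0" using h by simp
        ultimately show False using I z(2) h s by linarith
      qed
      ultimately have nm': "- h - z = of_int k" using nm by simp
      have "z = - h - (- h - z)" by simp
      also have "\<dots> = of_int (- k) - h" unfolding nm' by simp
      finally have "z = of_int (- k) - h" .
      thus False using z(3) by blast
    qed
    hence zA: "z \<in> A" using z by (simp add: A_def)
    have "Z holomorphic_on A"
      unfolding Z_def A_def using h
      by (intro holomorphic_intros holomorphic_theta0 positive half.holomorphic_ell_Gamma_upper half.holomorphic_ell_Gamma) auto
    thus ?thesis using op zA by (rule holomorphic_on_imp_differentiable_at)
  qed
  define c where "c = 1 / (2 * of_real pi * \<i> * (qpoch (4 * h) (4 * h) * qpoch s s))"
  have Zres: "((\<lambda>z. Z z * (z + h)) \<longlongrightarrow> c * (hG (2 * h) * (ee (2 * h) * th4 (- 3 * h) * th (h + 1/2)))) (at (- h))"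
  proof -
    define K where "K = (\<lambda>t. hG (t + 3 * h) * (ee (- 2 * t) * th4 (t - 2 * h) * th (t + 2 * h + 1/2)))"
    let ?A = "{z. Im z > - 2 * Im h}"
    have "K holomorphic_on ?A"
      unfolding K_def using h
      by (intro holomorphic_intros holomorphic_theta0 positive half.holomorphic_ell_Gamma_upper) auto
    moreover have "open ?A" by (intro open_halfspace_Im_gt)
    moreover have "- h \<in> ?A" using h by auto
    ultimately have "isCont K (- h)"
      by (metis holomorphic_on_imp_continuous_on continuous_on_eq_continuous_at)
    hence K: "(K \<longlongrightarrow> K (- h)) (at (- h))" by (simp add: isCont_def)
    have "filterlim (\<lambda>z::complex. - z) (at h) (at (- h))"
      by (auto simp: filterlim_at eventually_at_filter minus_equation_iff[of _ h] intro!: tendsto_eq_intros always_eventually)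
    from filterlim_compose[OF half.ell_Gamma_pole[of h] this]
    have "((\<lambda>z. K z * - (hG (- z - h) * (- z - h))) \<longlongrightarrow> K (- h) * - (- c)) (at (- h))"
      unfolding c_def by (intro tendsto_intros K) simp
    moreover have "K z * - (hG (- z - h) * (- z - h)) = Z z * (z + h)" for z
    proof -
      have e: "- h - z = - z - h" by simp
      show ?thesis unfolding K_def Z_def e by (simp add: algebra_simps)
    qed
    moreover have "K (- h) * - (- c) = c * (hG (2 * h) * (ee (2 * h) * th4 (- 3 * h) * th (h + 1/2)))"
      by (simp add: K_def)
    ultimately show ?thesis by (simp only:)
  qed
  have "contour_integral (linepath (- 2 * h - 1/2) (- 2 * h + 1/2)) Z = 0"
  proof (rule contour_integral_odd_segment[of Z "- 2 * h", OF Zodd])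
    have "Z field_differentiable at z" if z: "z \<in> closed_segment (- 2 * h - 1/2) (- 2 * h + 1/2)" for z
    proof -
      obtain u :: real where u: "z = (1 - of_real u) * (- 2 * h - 1/2) + of_real u * (- 2 * h + 1/2)"
        using z by (auto simp: closed_segment_def scaleR_conv_of_real)
      have "Im z = - 2 * Im h" unfolding u by (simp add: algebra_simps)
      thus ?thesis using h by (intro Zdiff) auto
    qed
    thus "continuous_on (closed_segment (- 2 * h - 1/2) (- 2 * h + 1/2)) Z"
      by (intro continuous_at_imp_continuous_on ballI field_differentiable_imp_continuous_at)
  qed
  moreover have "- 2 * h - 1/2 = - 1/2 - 2 * h" "- 2 * h + 1/2 = 1/2 - 2 * h" by simp_all
  ultimately have "contour_integral (linepath (-1/2 - 2 * h) (1/2 - 2 * h)) Z = 0" by (simp only:)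
  moreover have "contour_integral (linepath (-1/2 - 2 * h) (1/2 - 2 * h)) Z =
     contour_integral rseg Z + 2 * of_real pi * \<i> * (c * (hG (2 * h) * (ee (2 * h) * th4 (- 3 * h) * th (h + 1/2))))"
    by (rule line_shift_integral[OF h Zper _ Zres]) (rule Zdiff)
  ultimately have int: "contour_integral rseg Z = - (2 * of_real pi * \<i> * (c * (hG (2 * h) * (ee (2 * h) * th4 (- 3 * h) * th (h + 1/2)))))"
    by (metis add_eq_0_iff2)
  have "contour_integral rseg (\<lambda>t. gf t * bf h t) = contour_integral rseg Z"
  proof (rule contour_integral_eq)
    fix t assume "t \<in> path_image rseg"
    hence t: "Im t = 0" by (rule Im_rseg)
    have "hG (t - h + 4 * h) = ths (t - h) * hG (t - h)" by (rule half.ell_Gamma_shift[OF half_real_line(2)[OF t]])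
    moreover have "t - h + 4 * h = t + 3 * h" "- t - h = - h - t" "1/2 + 2 * h + t = t + 2 * h + 1/2" by simp_all
    moreover have "ee (- 2 * t) = ee (- t) * ee (- t)" unfolding ee_add[symmetric] by (rule arg_cong[of _ _ ee]) simp
    ultimately show "gf t * bf h t = Z t" unfolding gf_def bf_def Z_def by (simp only: mult_ac)
  qed
  \<comment> \<open>The residue term at h vanishes with \<open>bf h h\<close>; the one at -h cancels
    the residue collected by moving the line.\<close>
  moreover have "bf h h = 0" using positive(3) by (simp add: bf_def)
  moreover have "rp * bf h (- h) = - c * (hG (2 * h) * (ee (2 * h) * th4 (- 3 * h) * th (h + 1/2)))"
  proof -
    have "hG (- 2 * h + 4 * h) = ths (- 2 * h) * hG (- 2 * h)"
      by (intro half.ell_Gamma_shift qpoch_nonzero_between) (use h s in auto)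
    hence 1: "hG (2 * h) = ths (- 2 * h) * hG (- 2 * h)" by simp
    have "th4 (- (3 * h)) = - ee (- (3 * h)) * th4 (3 * h)" "th4 (- h) = - ee (- h) * th4 h"
      by (rule theta0_minus[OF positive(1)])+
    moreover have "th4 (3 * h) = th4 h" using theta0_reflect[of "4 * h" h] by simp
    moreover have "ee (2 * h) * ee (- (3 * h)) = ee (- h)" unfolding ee_add[symmetric] by simp
    ultimately have 2: "ee (2 * h) * th4 (- 3 * h) = th4 (- h)" by (simp flip: mult.assoc)
    have e: "ee (- h) * ee h = 1" by (simp flip: ee_add)
    have "bf h (- h) = ee h * ths (- 2 * h) * th (h + 1/2)" by (simp add: bf_def add.commute)
    moreover have "rp = - c * (hG (- 2 * h) * (ee (- h) * th4 (- h)))" by (simp add: rp_def c_def)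
    ultimately have "rp * bf h (- h) = (ee (- h) * ee h) * (- c * (ths (- 2 * h) * hG (- 2 * h) * (th4 (- h) * th (h + 1/2))))"
      by (simp only: mult_ac)
    thus ?thesis unfolding e 1 using 2 by (simp only: mult_1_left mult.assoc[symmetric])
  qed
  ultimately show ?thesis unfolding Lf_def by (simp add: int mult.assoc)
qed

section \<open>Interpolation in u and reduction to the beta integral\<close>

lemma bf_minus: "bf u (- t) = - ee u * bf (- u) t"
proof -
  have a: "ths (- t - u) = - ee (- (t + u)) * ths (t - - u)"
    using theta0_minus[OF positive(3), of "t + u"] by (simp add: algebra_simps)
  have b: "th (1/2 + 2 * u + - t) = ee (- (t - 2 * u)) * th (1/2 + 2 * - u + t)"
    using theta0_half_minus[OF positive(2), of "t - 2 * u"] by (simp add: algebra_simps)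
  have "ee (- (- t)) * ee (- (t + u)) * ee (- (t - 2 * u)) = ee u * ee (- t)"
    unfolding ee_add[symmetric] by (rule arg_cong[of _ _ ee]) simp
  thus ?thesis unfolding bf_def a b by algebra
qed

lemma bf_add_1: "bf (u + 1) t = bf u t"
proof -
  have e: "t - (u + 1) = (t - u) - 1" "1/2 + 2 * (u + 1) + t = (1/2 + 2 * u + t) + 1 + 1" by simp_all
  show ?thesis unfolding bf_def e theta0_add_1 ..
qed

lemma bf_shift: "bf (u + s) t = - ee (- 3 * u - s) * bf u t"
proof -
  have a: "ths (t - (u + s)) = - ee (t - u - s) * ths (t - u)"
    using theta0_eq_shift[OF positive(3), of "t - (u + s)"] by (simp add: algebra_simps)
  have "1/2 + 2 * (u + s) + t = 1/2 + 2 * u + t + 2 * s" by simp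
  moreover have "ee (- (1/2 + 2 * u + t)) = - ee (- 2 * u - t)"
  proof -
    have "- (1/2 + 2 * u + t) = (- 2 * u - t) - 1/2" by simp
    thus ?thesis by (simp only: ee_diff ee_half) simp
  qed
  ultimately have b: "th (1/2 + 2 * (u + s) + t) = ee (- 2 * u - t) * th (1/2 + 2 * u + t)"
    using theta0_shift[OF positive(2), of "1/2 + 2 * u + t"] by (simp only: minus_minus)
  have e: "ee (t - u - s) * ee (- 2 * u - t) = ee (- 3 * u - s)"
    unfolding ee_add[symmetric] by (rule arg_cong[of _ _ ee]) simp
  show ?thesis unfolding bf_def a b e[symmetric] by (simp only: mult_ac mult_minus_left mult_minus_right)
qed

text \<open>The interpolation takes place in u, with t fixed. Twice the even part of
  \<open>bf u t\<close> in t vanishes for u in the lattice of 1 and s, and division by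
  \<open>ths u\<close> leaves an even theta function of degree two in u. The nodes are h, where
  \<open>Lf\<close> vanishes, and 1/2, where it becomes a beta integral.\<close>

lemma bf_interpolation:
  "theta_pair s (1/2) h * ths h * ths (1/2) * (bf u t + bf u (- t)) =
     ths u * theta_pair s (1/2) u * ths (1/2) * (bf h t + bf h (- t)) +
     ee (- h) * ths u * theta_pair s h u * ths h * (bf (1/2) t + bf (1/2) (- t))"
proof -
  define D where "D = (\<lambda>u. bf u t + bf u (- t))"
  have hol: "D holomorphic_on UNIV"
    unfolding D_def bf_def by (intro holomorphic_intros holomorphic_theta0 positive)
  have holt: "ths holomorphic_on UNIV" by (intro holomorphic_theta0 positive holomorphic_intros)
  have D1: "D (u + 1) = D u" for u by (simp add: D_def bf_add_1)
  have Ds: "D (u + s) = - ee (- 3 * u - s) * D u" for u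
    unfolding D_def bf_shift by (simp add: distrib_left)
  have Dm: "D (- u) = - ee (- u) * D u" for u
    unfolding D_def using bf_minus[of "- u" t] bf_minus[of "- u" "- t"] by (simp add: distrib_left)
  have D0: "D z = 0" if "ths z = 0" for z
  proof -
    obtain n k where z: "z = of_int n + of_int k * s" using \<open>ths z = 0\<close> theta0_eq_0_iff[OF positive(3)] by blast
    have "D 0 = 0" using bf_minus[of 0 t] by (simp add: D_def)
    moreover have "D (0 + of_int n + of_int k * s) = 0 \<longleftrightarrow> D 0 = 0"
      by (rule quasi_periodic_zero_shift[of D s "\<lambda>u. - ee (- 3 * u - s)", OF D1 Ds]) simp
    ultimately show ?thesis using z by simp
  qed
  obtain phi where hp: "phi holomorphic_on UNIV" and phi: "\<And>u. D u = ths u * phi u"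
    using holomorphic_quotient_simple_zeros[OF hol holt D0 theta0_simple_zero[OF positive(3)]] by blast
  have holc: "(\<lambda>z. phi (f z)) holomorphic_on UNIV" if "f holomorphic_on UNIV" for f
    using holomorphic_on_compose_gen[OF that hp] by (simp add: o_def)
  have cancel: "x z = y z" if "x holomorphic_on UNIV" "y holomorphic_on UNIV" "\<And>z. ths z * x z = ths z * y z" for x y z
  proof -
    have "continuous_on UNIV (\<lambda>z. x z - y z)"
      using that(1,2) by (intro continuous_intros holomorphic_on_imp_continuous_on)
    from mult_eq_0_simple_zeros[OF holt theta0_simple_zero[OF positive(3)] this] that(3) show ?thesis
      by (simp add: right_diff_distrib)
  qed
  have phi1: "phi (z + 1) = phi z" for z
  proof (rule cancel[of "\<lambda>z. phi (z + 1)" phi])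
    show "ths z * phi (z + 1) = ths z * phi z" for z
      using phi[of "z + 1"] phi[of z] D1[of z] by auto
  qed (auto intro!: holc hp holomorphic_intros)
  have phis: "phi (z + s) = ee (- 2 * z - s) * phi z" for z
  proof (rule cancel[of "\<lambda>z. phi (z + s)" "\<lambda>z. ee (- 2 * z - s) * phi z"])
    fix z
    have "ee (- z) * (ths z * phi (z + s)) = ee (- 3 * z - s) * (ths z * phi z)"
      using phi[of "z + s"] phi[of z] Ds[of z] theta0_shift[OF positive(3), of z] by (auto simp: mult_ac)
    moreover have "ee (- 3 * z - s) = ee (- z) * ee (- 2 * z - s)"
      unfolding ee_add[symmetric] by (rule arg_cong[of _ _ ee]) simp
    ultimately have "ee (- z) * (ths z * phi (z + s)) = ee (- z) * (ths z * (ee (- 2 * z - s) * phi z))"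
      by (simp only: mult_ac)
    thus "ths z * phi (z + s) = ths z * (ee (- 2 * z - s) * phi z)" by simp
  qed (auto intro!: holc hp holomorphic_intros)
  have phie: "phi (- z) = phi z" for z
  proof (rule cancel[of "\<lambda>z. phi (- z)" phi])
    show "ths z * phi (- z) = ths z * phi z" for z
      using phi[of "- z"] phi[of z] Dm[of z] theta0_minus[OF positive(3), of z] by auto
  qed (auto intro!: holc hp holomorphic_intros)
  have n1: "ths (2 * h) \<noteq> 0" using h s by (intro theta0_nonzero) auto
  have "ths (1/2 + h) \<noteq> 0" using h s by (intro theta0_nonzero) auto
  hence n2: "theta_pair s (1/2) h \<noteq> 0"
    using theta0_half_minus[OF positive(3), of h] by (simp add: theta_pair_def add.commute)
  have "theta_pair s (1/2) h * phi u = phi h * theta_pair s (1/2) u - ee (1/2 - h) * phi (1/2) * theta_pair s h u"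
    by (rule even_theta_interpolation[OF positive(3) hp phi1 phis phie n1 n2])
  moreover have "ee (1/2 - h) = - ee (- h)" by (simp add: ee_diff ee_minus)
  ultimately have "theta_pair s (1/2) h * phi u = phi h * theta_pair s (1/2) u + ee (- h) * phi (1/2) * theta_pair s h u"
    by simp
  moreover have "bf u t + bf u (- t) = ths u * phi u" "bf h t + bf h (- t) = ths h * phi h"
    "bf (1/2) t + bf (1/2) (- t) = ths (1/2) * phi (1/2)"
    using phi[of u] phi[of h] phi[of "1/2"] by (simp_all add: D_def)
  ultimately show ?thesis by algebra
qed

text \<open>Formally G(4h + x) = th(x) G(x), and reflection gives G(4h - x) = 1 / G(2s + x) = 1 /
  (th4(x) G(x)). Multiplied by \<open>th4 x\<close> the identity holds at the zeros of this factor
  as well.\<close>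

lemma Gamma_half_pair:
  assumes "\<bar>Im x\<bar> < 4 * Im h"
  shows "G (4 * h + x) * G (4 * h - x) * th4 x = th x"
proof -
  let ?q = "\<lambda>z. qpoch2 z (4 * h) (2 * s)"
  have g: "G (4 * h + x) = ?q (2 * s - x) / ?q (4 * h + x)" "G (4 * h - x) = ?q (2 * s + x) / ?q (4 * h - x)"
    by (simp_all add: ell_Gamma_eq)
  have a: "qpoch x (4 * h) * ?q (2 * s + x) = qpoch x (2 * s) * ?q (4 * h + x)"
    using qpoch2_rec[of x] qpoch2_rec'[of x] by (simp add: add.commute)
  have b: "?q (2 * s - x) = qpoch (2 * s - x) (2 * s) * ?q (4 * h - x + 2 * s)"
    using qpoch2_rec[of "2 * s - x"] by (simp add: algebra_simps)
  have c: "?q (4 * h - x) = qpoch (4 * h - x) (4 * h) * ?q (4 * h - x + 2 * s)"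
    using qpoch2_rec'[of "4 * h - x"] by simp
  have "?q (4 * h + x) \<noteq> 0" "?q (4 * h - x) \<noteq> 0"
    using assms by (auto intro!: qpoch2_nonzero)
  hence nz: "?q (4 * h + x) \<noteq> 0" "qpoch (4 * h - x) (4 * h) \<noteq> 0" "?q (4 * h - x + 2 * s) \<noteq> 0"
    using c by auto
  have "G (4 * h + x) * G (4 * h - x) * th4 x =
     qpoch (2 * s - x) (2 * s) * (qpoch x (4 * h) * ?q (2 * s + x)) / ?q (4 * h + x)"
    unfolding g b c theta0_def using nz(2,3) by simp
  also have "\<dots> = th x" unfolding a theta0_def using nz(1) by simp
  finally show ?thesis .
qed

text \<open>Splitting the Gamma functions of period s by \<open>ell_Gamma_dissect\<close> yields the
  parameters -h and s - h, and the quotient of \<open>th\<close> by \<open>th4\<close> at t + 1/2 is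
  read as the Gamma pair of the parameter 4h + 1/2. The values a = 4h + 1/2 and b = s - h are
  balanced.\<close>

lemma gf_bf_half:
  assumes "\<bar>Im t\<bar> \<le> Im h"
  shows "gf t * bf (1/2) t = - ee (- 2 * h) * W (4 * h + 1/2) (s - h) t"
proof -
  have "\<bar>Im (t + 1/2)\<bar> < 4 * Im h" using assms h by simp
  hence x: "G (4 * h + (t + 1/2)) * G (4 * h - (t + 1/2)) * th4 (t + 1/2) = th (t + 1/2)" by (rule Gamma_half_pair)
  have e: "4 * h + 1/2 + t = 4 * h + (t + 1/2)" "4 * h + 1/2 - t = (4 * h - (t + 1/2)) + 1"
    "s - h + t = t - h + s" "s - h - t = - t - h + s" by simp_all
  have d: "hG (t - h) = G (t - h) * G (t - h + s)" "hG (- t - h) = G (- t - h) * G (- t - h + s)"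
    by (rule half.ell_Gamma_dissect)+
  have f: "th4 (t + 2 * h) = - ee (- (t - 2 * h)) * th4 (t - 2 * h)"
    using theta0_shift[OF positive(1), of "t - 2 * h"] by (simp add: add.commute)
  have b: "bf (1/2) t = ee (- t) * ths (t + 1/2) * th (t + 1/2)"
  proof -
    have "t - 1/2 = (t + 1/2) - 1" "1/2 + 2 * (1/2) + t = (t + 1/2) + 1" by simp_all
    thus ?thesis unfolding bf_def by (simp only: theta0_add_1)
  qed
  have k: "ee (- 2 * h) * ee (- t) * ee (- (t - 2 * h)) = ee (- t) * ee (- t)"
    unfolding ee_add[symmetric] by (rule arg_cong[of _ _ ee]) simp
  have "- ee (- 2 * h) * W (4 * h + 1/2) (s - h) t =
     - ee (- 2 * h) * (hG (t - h) * hG (- t - h) * ((G (4 * h + (t + 1/2)) * G (4 * h - (t + 1/2)) * th4 (t + 1/2)) *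
        (ee (- t) * th4 (t + 2 * h) * ths (t + 1/2))))"
    unfolding W_def T_def e d ell_Gamma_add_1 by (simp only: mult_ac)
  also have "\<dots> = (ee (- 2 * h) * ee (- t) * ee (- (t - 2 * h))) * (hG (t - h) * hG (- t - h) * th (t + 1/2) * th4 (t - 2 * h) * ths (t + 1/2))"
    unfolding x f by (simp only: mult_ac mult_minus_left mult_minus_right minus_minus)
  also have "\<dots> = gf t * bf (1/2) t"
    unfolding k gf_def b by (simp only: mult_ac)
  finally show ?thesis ..
qed

lemma Lf_bf_half: "Lf (bf (1/2)) = - ee (- 2 * h) * J (4 * h + 1/2) (s - h)"
proof -
  have "bf (1/2) (- h) = bf (1/2) h" using bf_minus[of "1/2" h] bf_add_1[of "-1/2" h] by simp
  hence "Lf (bf (1/2)) = contour_integral rseg (\<lambda>t. gf t * bf (1/2) t) - 4 * of_real pi * \<i> * rp * bf (1/2) h"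
    by (simp add: Lf_def)
  also have "contour_integral rseg (\<lambda>t. gf t * bf (1/2) t) = contour_integral rseg (\<lambda>t. - ee (- 2 * h) * W (4 * h + 1/2) (s - h) t)"
    by (rule contour_integral_eq) (use h gf_bf_half in \<open>auto dest!: Im_rseg\<close>)
  also have "\<dots> = - ee (- 2 * h) * contour_integral rseg (W (4 * h + 1/2) (s - h))"
    by (intro contour_integral_lmul rseg_integrable continuous_W) (use h s in auto)
  \<comment> \<open>At t = h both sides of \<open>gf_bf_half\<close> are 0 by the convention x / 0 =
    0, so the residue terms of \<open>Lf\<close> and \<open>J\<close> are compared
    separately.\<close>
  also have "4 * of_real pi * \<i> * rp * bf (1/2) h = ee (- 2 * h) * (C * (G (- 2 * h) * (G (4 * h + 1/2 + h) * G (4 * h + 1/2 - h)) *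
      (G (s - h + h) * G (s - h - h)) * T h))"
  proof -
    define p where "p = qpoch (4 * h) (4 * h)"
    have p0: "p \<noteq> 0" "qpoch s (2 * s) \<noteq> 0" "qpoch (2 * s) (2 * s) \<noteq> 0"
      unfolding p_def by (rule qpoch_nonzero; use h s in simp)+
    have ss: "qpoch s s = qpoch s (2 * s) * qpoch (2 * s) (2 * s)" using qpoch_dissect[OF positive(3), of s] by simp
    have x: "G (4 * h + (h + 1/2)) * G (4 * h - (h + 1/2)) * th4 (h + 1/2) = th (h + 1/2)"
      by (rule Gamma_half_pair) (use h in simp)
    have e: "4 * h + 1/2 + h = 4 * h + (h + 1/2)" "4 * h + 1/2 - h = (4 * h - (h + 1/2)) + 1" "s - h + h = s" "s - h - h = - 2 * h + s" "h + 2 * h = 3 * h"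
      by simp_all
    have d: "hG (- 2 * h) = G (- 2 * h) * G (- 2 * h + s)" by (rule half.ell_Gamma_dissect)
    have t3: "th4 (3 * h) = th4 h" using theta0_reflect[of "4 * h" h] by simp
    have tm: "th4 (- h) = - ee (- h) * th4 h" by (rule theta0_minus[OF positive(1)])
    have b: "bf (1/2) h = ee (- h) * ths (h + 1/2) * th (h + 1/2)"
    proof -
      have "h - 1/2 = (h + 1/2) - 1" "1/2 + 2 * (1/2) + h = (h + 1/2) + 1" by simp_all
      thus ?thesis unfolding bf_def by (simp only: theta0_add_1)
    qed
    have k: "ee (- h) * ee (- h) = ee (- 2 * h)" by (simp flip: ee_add)
    have "ee (- 2 * h) * (C * (G (- 2 * h) * (G (4 * h + 1/2 + h) * G (4 * h + 1/2 - h)) *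
      (G (s - h + h) * G (s - h - h)) * T h)) = ee (- 2 * h) * (C * (1 / qpoch s (2 * s)) * hG (- 2 * h) *
       ((G (4 * h + (h + 1/2)) * G (4 * h - (h + 1/2)) * th4 (h + 1/2)) * (ee (- h) * th4 h * ths (h + 1/2))))"
      unfolding T_def e ell_Gamma_add_1 Gamma_values(5) d t3 by (simp only: mult_ac)
    also have "\<dots> = 2 / (p * qpoch s s) * hG (- 2 * h) * (ee (- h) * ee (- h) * ee (- h) * th (h + 1/2) * th4 h * ths (h + 1/2))"
      unfolding x C_def p_def[symmetric] ss k[symmetric] using p0 by (simp add: divide_simps mult_ac)
    also have "\<dots> = 4 * of_real pi * \<i> * rp * bf (1/2) h"
      unfolding rp_def b tm p_def[symmetric] by simp
    finally show ?thesis ..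
  qed
  finally show ?thesis unfolding J_def by (simp add: algebra_simps)
qed

lemma Lf_bf:
  "Lf (bf u) = - ee (- 2 * h) * (ths u * ths (h + u) * ths (h - u) / ((ths (h + 1/2))\<^sup>2 * ths (1/2))) * J (4 * h + 1/2) (s - h)"
proof -
  define D where "D = (\<lambda>x t. bf x t + bf x (- t))"
  have LD: "Lf (D x) = 2 * Lf (bf x)" for x
    using Lf_linear[where a=1 and b=1, OF continuous_bf(1)[of UNIV x] continuous_bf(2)[of UNIV x]] Lf_reflect[of "bf x"]
    by (simp add: D_def)
  have cD: "continuous_on UNIV (D x)" for x unfolding D_def by (intro continuous_intros continuous_bf)
  define E where "E = theta_pair s (1/2) h * ths h * ths (1/2)"
  define a b where "a = ths u * theta_pair s (1/2) u * ths (1/2)" and "b = ee (- h) * ths u * theta_pair s h u * ths h"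
  have "E * D u t + 0 * D u t = a * D h t + b * D (1/2) t" for t
    unfolding E_def D_def a_def b_def using bf_interpolation[of u t] by (simp only: mult_zero_left add_0_right)
  hence "Lf (\<lambda>t. E * D u t + 0 * D u t) = Lf (\<lambda>t. a * D h t + b * D (1/2) t)" by presburger
  hence "E * Lf (D u) = a * Lf (D h) + b * Lf (D (1/2))"
    unfolding Lf_linear[OF cD cD] by simp
  hence main: "E * Lf (bf u) = b * (- ee (- 2 * h) * J (4 * h + 1/2) (s - h))"
    unfolding LD Lf_bf_h Lf_bf_half by simp
  have half: "ths (1/2 - h) = ee (- h) * ths (h + 1/2)" by (rule theta0_half_minus[OF positive(3)])
  have nz: "ths h \<noteq> 0" "ths (h + 1/2) \<noteq> 0" by (rule theta0_nonzero; use h s in simp)+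
  have nz': "ths (1/2) \<noteq> 0"
  proof
    assume "ths (1/2) = 0"
    then obtain n k :: int where nk: "1/2 = of_int n + of_int k * s" using theta0_eq_0_iff[OF positive(3)] by blast
    have "Im (of_int n + of_int k * s) = 0" unfolding nk[symmetric] by simp
    hence "k = 0" using positive(3) by simp
    hence "(2::complex) * of_int n = 1" using nk by (simp add: mult.commute)
    hence "of_int (2 * n) = (of_int 1 :: complex)" by simp
    hence "2 * n = 1" by (simp only: of_int_eq_iff)
    thus False by presburger
  qed
  have "E = ee (- h) * (ths (h + 1/2))\<^sup>2 * ths h * ths (1/2)"
    unfolding E_def theta_pair_def half by (simp add: power2_eq_square add.commute)
  with main have "(ee (- h) * ths h) * (((ths (h + 1/2))\<^sup>2 * ths (1/2)) * Lf (bf u)) =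
     (ee (- h) * ths h) * ((ths u * (ths (h + u) * ths (h - u))) * (- ee (- 2 * h) * J (4 * h + 1/2) (s - h)))"
    unfolding b_def theta_pair_def by (simp only: mult_ac)
  hence "((ths (h + 1/2))\<^sup>2 * ths (1/2)) * Lf (bf u) = (ths u * (ths (h + u) * ths (h - u))) * (- ee (- 2 * h) * J (4 * h + 1/2) (s - h))"
    using nz ee_nonzero[of "- h"] by (simp only: mult_cancel_left mult_eq_0_iff simp_thms)
  thus ?thesis using nz nz' by (simp add: field_simps)
qed

text \<open>For s = \<kappa> h all poles are integral multiples of h modulo 1. Since \<kappa> \<ge>
  4, those above the cycle have index -1 or at least 3, those below have index 1 or at most -3, so
  \<open>cycle_integral\<close> applies.\<close>

lemma cycle_integral_gf:
  assumes s\<kappa>: "s = of_int \<kappa> * h" and \<kappa>: "\<kappa> \<ge> 4"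
    and g: "valid_path g" "pathstart g = -1/2" "pathfinish g = 1/2"
    and below: "\<And>j k. lies_below (h - of_nat j * (4 * h) - of_nat k * s) g"
    and above: "\<And>j k. lies_above (- h + of_nat j * (4 * h) + of_nat k * s) g"
    and \<phi>: "\<phi> holomorphic_on UNIV" "\<And>t. \<phi> (t + 1) = \<phi> t"
  shows "contour_integral g (\<lambda>t. gf t * \<phi> t) = Lf \<phi>" "(\<lambda>t. gf t * \<phi> t) contour_integrable_on g"
proof -
  define Ka Kb where "Ka = {k. \<exists>(i::nat) (j::nat). k = -1 + 4 * int i + \<kappa> * int j}"
    and "Kb = {k. \<exists>(i::nat) (j::nat). k = 1 - 4 * int i - \<kappa> * int j}"
  have ge: "4 * int i + \<kappa> * int j \<ge> 4" if "i \<noteq> 0 \<or> j \<noteq> 0" for i j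
  proof (cases "i = 0")
    case True
    have "\<kappa> * 1 \<le> \<kappa> * int j" using True that \<kappa> by (intro mult_left_mono) auto
    thus ?thesis using True \<kappa> by linarith
  next
    case False
    moreover have "\<kappa> * int j \<ge> 0" using \<kappa> by simp
    ultimately show ?thesis by linarith
  qed
  have Ka: "lies_above (of_int k * h) g" if k: "k \<in> Ka" for k
  proof -
    obtain i j :: nat where ij: "k = -1 + 4 * int i + \<kappa> * int j" using k unfolding Ka_def by blast
    have "of_int k * h = - h + of_nat i * (4 * h) + of_nat j * s" unfolding ij s\<kappa> by (simp add: algebra_simps)
    thus ?thesis using above by simp
  qed
  have Kb: "lies_below (of_int k * h) g" if k: "k \<in> Kb" for k
  proof -
    obtain i j :: nat where ij: "k = 1 - 4 * int i - \<kappa> * int j" using k unfolding Kb_def by blast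
    have "of_int k * h = h - of_nat i * (4 * h) - of_nat j * s" unfolding ij s\<kappa> by (simp add: algebra_simps)
    thus ?thesis using below by simp
  qed
  have Ka1: "-1 \<in> Ka" unfolding Ka_def by (auto intro!: exI[of _ "0::nat"])
  have Kb1: "1 \<in> Kb" unfolding Kb_def by (auto intro!: exI[of _ "0::nat"])
  have Ka2: "k > 1" if k: "k \<in> Ka" "k \<noteq> -1" for k
  proof -
    obtain i j :: nat where ij: "k = -1 + 4 * int i + \<kappa> * int j" using k(1) unfolding Ka_def by blast
    have "i \<noteq> 0 \<or> j \<noteq> 0" using k(2) ij by auto
    thus ?thesis using ge[of i j] ij by linarith
  qed
  have Kb2: "k < -1" if k: "k \<in> Kb" "k \<noteq> 1" for k
  proof -
    obtain i j :: nat where ij: "k = 1 - 4 * int i - \<kappa> * int j" using k(1) unfolding Kb_def by blast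
    have "i \<noteq> 0 \<or> j \<noteq> 0" using k(2) ij by auto
    thus ?thesis using ge[of i j] ij by linarith
  qed
  have per: "gf (t + 1) * \<phi> (t + 1) = gf t * \<phi> t" for t by (simp only: gf_periodic \<phi>(2))
  have diff: "(\<lambda>t. gf t * \<phi> t) field_differentiable at t"
    if t: "\<And>k n. k \<in> Ka \<union> Kb \<Longrightarrow> t \<noteq> of_int n + of_int k * h" for t
  proof -
    have "qpoch2 (t - h) (4 * h) s \<noteq> 0"
    proof
      assume "qpoch2 (t - h) (4 * h) s = 0"
      then obtain j k :: nat and n :: int where "t = h - of_nat j * (4 * h) - of_nat k * s + of_int n"
        using qpoch2_lattice by blast
      hence "t = of_int n + of_int (1 - 4 * int j - \<kappa> * int k) * h" by (simp add: s\<kappa> algebra_simps)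
      moreover have "1 - 4 * int j - \<kappa> * int k \<in> Ka \<union> Kb" by (auto simp: Kb_def)
      ultimately show False using t by blast
    qed
    moreover have "qpoch2 (- t - h) (4 * h) s \<noteq> 0"
    proof
      assume "qpoch2 (- t - h) (4 * h) s = 0"
      then obtain j k :: nat and n :: int where jk: "- t = h - of_nat j * (4 * h) - of_nat k * s + of_int n"
        using qpoch2_lattice by blast
      have "t = - (- t)" by simp
      also have "\<dots> = of_int (- n) + of_int (-1 + 4 * int j + \<kappa> * int k) * h" unfolding jk by (simp add: s\<kappa> algebra_simps)
      finally have "t = of_int (- n) + of_int (-1 + 4 * int j + \<kappa> * int k) * h" .
      moreover have "-1 + 4 * int j + \<kappa> * int k \<in> Ka \<union> Kb" by (auto simp: Ka_def)
      ultimately show False using t by blast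
    qed
    ultimately have "gf field_differentiable at t" by (rule gf_differentiable)
    moreover have "\<phi> field_differentiable at t" using \<phi>(1) by (simp add: holomorphic_on_imp_differentiable_at)
    ultimately show ?thesis by (rule field_differentiable_mult)
  qed
  have cont: "isCont \<phi> x" for x
    using holomorphic_on_imp_continuous_on[OF \<phi>(1)] by (simp add: continuous_on_eq_continuous_at)
  have "((\<lambda>t. gf t * (t - h) * \<phi> t) \<longlongrightarrow> rp * \<phi> h) (at h)"
    using cont[of h] by (intro tendsto_mult gf_residue) (simp add: isCont_def)
  hence l1: "((\<lambda>t. gf t * \<phi> t * (t - h)) \<longlongrightarrow> rp * \<phi> h) (at h)" by (simp only: mult_ac)
  have "((\<lambda>t. gf t * (t + h) * \<phi> t) \<longlongrightarrow> - rp * \<phi> (- h)) (at (- h))"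
    using cont[of "- h"] by (intro tendsto_mult gf_residue') (simp add: isCont_def)
  hence l2: "((\<lambda>t. gf t * \<phi> t * (t + h)) \<longlongrightarrow> - rp * \<phi> (- h)) (at (- h))" by (simp only: mult_ac)
  note ci = cycle_integral[of h "\<lambda>t. gf t * \<phi> t" g Ka Kb, OF h per g Ka Ka1 Ka2 Kb Kb1 Kb2 diff l1 l2]
  show "(\<lambda>t. gf t * \<phi> t) contour_integrable_on g" by (rule ci(2))
  have "contour_integral g (\<lambda>t. gf t * \<phi> t) = contour_integral rseg (\<lambda>t. gf t * \<phi> t) +
      2 * of_real pi * \<i> * (- rp * \<phi> (- h) - rp * \<phi> h)" by (rule ci(1))
  also have "\<dots> = Lf \<phi>" unfolding Lf_def by (simp add: algebra_simps)
  finally show "contour_integral g (\<lambda>t. gf t * \<phi> t) = Lf \<phi>" .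
qed

end

text \<open>By the triple product identity, the two terms on the right are the even and the odd part of the
  Laurent series of the left-hand side in \<open>ee y\<close>.\<close>

lemma theta0_dissection:
  assumes v: "Im v > 0"
  shows "qpoch v v * theta0 (1/2 + y) v =
    qpoch (4 * v) (4 * v) * (theta0 (1/2 + 2 * y + v) (4 * v) + ee y * theta0 (1/2 + 2 * y + 3 * v) (4 * v))"
proof -
  have v4: "Im (4 * v) > 0" "Im (2 * v) > 0" using v by simp_all
  define f where "f = (\<lambda>y. theta0 (1/2 + y) v)"
  have f1: "f (y + 1) = f y" for y using theta0_add_1(1)[of "1/2 + y" v] by (simp add: f_def add.assoc)
  have ehalf: "ee (- (1/2 + y)) = - ee (- y)" for y
  proof -
    have "- (1/2 + y) = - y - 1/2" by simp
    thus ?thesis by (simp only: ee_diff ee_half) simp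
  qed
  have fv: "f (y + v) = ee (- y) * f y" for y
    using theta0_shift[OF v, of "1/2 + y"] unfolding ehalf by (simp add: f_def add.assoc)
  have fneg: "f (- y) = ee (- y) * f y" for y
    using theta0_half_minus[OF v, of y] by (simp add: f_def add.commute)
  \<comment> \<open>Twice the part of f that is even in \<open>ee y\<close>; it is a function of
    2y.\<close>
  define e where "e = (\<lambda>y. f y + f (y + 1/2))"
  define F where "F = (\<lambda>w. e (w / 2))"
  define A where "A = (\<lambda>w. theta0 (w + (1/2 + v)) (4 * v))"
  have F1: "F (w + 1) = F w" for w
  proof -
    have "(w + 1) / 2 = w / 2 + 1/2" "w / 2 + 1/2 + 1/2 = w / 2 + 1" by simp_all
    thus ?thesis unfolding F_def e_def using f1[of "w / 2"] by (simp only: add.commute)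
  qed
  have A1: "A (w + 1) = A w" for w using theta0_add_1(1)[of "w + (1/2 + v)" "4 * v"] by (simp add: A_def algebra_simps)
  have f2v: "f (y + 2 * v) = ee (- 2 * y - v) * f y" for y
  proof -
    have "y + 2 * v = (y + v) + v" by simp
    hence "f (y + 2 * v) = ee (- (y + v)) * ee (- y) * f y" using fv[of "y + v"] fv[of y] by (simp only: mult.assoc)
    also have "ee (- (y + v)) * ee (- y) = ee (- 2 * y - v)"
      unfolding ee_add[symmetric] by (rule arg_cong[of _ _ ee]) simp
    finally show ?thesis .
  qed
  have F4: "F (w + 4 * v) = ee (- w - v) * F w" for w
  proof -
    have 1: "(w + 4 * v) / 2 = w / 2 + 2 * v" "w / 2 + 2 * v + 1/2 = (w / 2 + 1/2) + 2 * v" by simp_all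
    have 2: "- 2 * (w / 2) - v = - w - v" by simp
    have "- 2 * (w / 2 + 1/2) - v = (- w - v) - 1" by simp
    hence 3: "ee (- 2 * (w / 2 + 1/2) - v) = ee (- w - v)" by (simp only: ee_diff ee_1 div_by_1)
    show ?thesis unfolding F_def e_def 1 f2v 2 3 by (simp only: distrib_left)
  qed
  have A4: "A (w + 4 * v) = ee (- w - v) * A w" for w
  proof -
    have 1: "w + 4 * v + (1/2 + v) = (w + (1/2 + v)) + 4 * v" by simp
    have "w + (1/2 + v) = 1/2 + (w + v)" "- (w + v) = - w - v" by simp_all
    hence "ee (- (w + (1/2 + v))) = - ee (- w - v)" using ehalf[of "w + v"] by (simp only:)
    thus ?thesis unfolding A_def 1 theta0_shift[OF v4(1)] by simp
  qed
  define q where "q = theta0 (v / 2 - 1/4) v"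
  have q34: "theta0 (3/4 - v / 2) v = - ee (3/4 - v / 2) * q" "theta0 (1/4 - v / 2) v = - ee (1/4 - v / 2) * q"
  proof -
    have "theta0 (v / 2 - 3/4) v = theta0 (v / 2 - 3/4 + 1) v" by (simp only: theta0_add_1)
    also have "\<dots> = theta0 (v - (v / 2 - 1/4)) v" by (simp add: algebra_simps)
    also have "\<dots> = q" unfolding q_def by (rule theta0_reflect)
    finally show "theta0 (3/4 - v / 2) v = - ee (3/4 - v / 2) * q"
      using theta0_minus[OF v, of "v / 2 - 3/4"] by simp
    show "theta0 (1/4 - v / 2) v = - ee (1/4 - v / 2) * q"
      unfolding q_def using theta0_minus[OF v, of "v / 2 - 1/4"] by simp
  qed
  \<comment> \<open>The only zero of A modulo 1 and 4v; there the two summands of F cancel.\<close>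
  have Fz: "F (- 1/2 - v) = 0"
  proof -
    have "F (- 1/2 - v) = theta0 (1/4 - v / 2) v + theta0 (3/4 - v / 2) v"
    proof -
      have "1/2 + (- 1/2 - v) / 2 = 1/4 - v / 2" "1/2 + ((- 1/2 - v) / 2 + 1/2) = 3/4 - v / 2" by (simp_all add: field_simps)
      thus ?thesis unfolding F_def e_def f_def by (simp only:)
    qed
    also have "ee (3/4 - v / 2) = - ee (1/4 - v / 2)"
    proof -
      have "3/4 - v / 2 = (1/4 - v / 2) + 1/2" by simp
      thus ?thesis by (simp only: ee_add ee_half) simp
    qed
    hence "theta0 (1/4 - v / 2) v + theta0 (3/4 - v / 2) v = 0" unfolding q34 by simp
    finally show ?thesis .
  qed
  have "\<exists>c. \<forall>w. F w = c * A w"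
  proof (rule quasi_periodic_unique[OF _ _ v4(1) F1 A1 F4 A4 ee_nonzero])
    show "F holomorphic_on UNIV" unfolding F_def e_def f_def by (intro holomorphic_intros holomorphic_theta0 v) auto
    show holA: "A holomorphic_on UNIV" unfolding A_def by (intro holomorphic_intros holomorphic_theta0 v4)
    fix w assume w: "A w = 0"
    have "((\<lambda>z. theta0 z (4 * v)) has_field_derivative deriv (\<lambda>z. theta0 z (4 * v)) (w + (1/2 + v))) (at (w + (1/2 + v)))"
      by (rule holomorphic_derivI[of _ UNIV]) (auto intro!: holomorphic_theta0 v4 holomorphic_intros)
    hence "(A has_field_derivative deriv (\<lambda>z. theta0 z (4 * v)) (w + (1/2 + v))) (at w)"
      unfolding A_def by (simp add: DERIV_shift)
    thus "deriv A w \<noteq> 0"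
      using theta0_simple_zero[OF v4(1), of "w + (1/2 + v)"] w DERIV_imp_deriv by (metis A_def)
    obtain n k :: int where nk: "w + (1/2 + v) = of_int n + of_int k * (4 * v)"
      using w theta0_eq_0_iff[OF v4(1)] unfolding A_def by meson
    have "w = (w + (1/2 + v)) - (1/2 + v)" by simp
    also have "\<dots> = (- 1/2 - v) + of_int n + of_int k * (4 * v)" unfolding nk by simp
    finally show "F w = 0"
      using quasi_periodic_zero_shift[of F "4 * v" "\<lambda>w. ee (- w - v)", OF F1 F4 ee_nonzero] Fz by (simp only:)
  qed
  then obtain c where c: "\<And>w. F w = c * A w" by blast
  have ec: "e y = c * theta0 (1/2 + 2 * y + v) (4 * v)" for y
    using c[of "2 * y"] by (simp add: F_def A_def add_ac)
  have eneg: "e (- y) = ee (- y) * (f y - f (y + 1/2))" for y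
  proof -
    have "f (- y + 1/2) = ee (- (y - 1/2)) * f (y - 1/2)" using fneg[of "y - 1/2"] by simp
    also have "ee (- (y - 1/2)) = - ee (- y)"
    proof -
      have "- (y - 1/2) = - y + 1/2" by simp
      thus ?thesis by (simp only: ee_add ee_half) simp
    qed
    also have "f (y - 1/2) = f (y + 1/2)" using f1[of "y - 1/2"] by (simp add: add.commute)
    finally show ?thesis unfolding e_def fneg by (simp add: right_diff_distrib)
  qed
  have A_neg: "theta0 (1/2 + 2 * (- y) + v) (4 * v) = theta0 (1/2 + 2 * y + 3 * v) (4 * v)" for y
  proof -
    have "theta0 (1/2 + 2 * (- y) + v) (4 * v) = theta0 (4 * v - (1/2 + 2 * (- y) + v)) (4 * v)" by (simp only: theta0_reflect)
    also have "4 * v - (1/2 + 2 * (- y) + v) = (1/2 + 2 * y + 3 * v) - 1" by simp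
    finally show ?thesis by (simp only: theta0_add_1)
  qed
  have two: "2 * f y = c * (theta0 (1/2 + 2 * y + v) (4 * v) + ee y * theta0 (1/2 + 2 * y + 3 * v) (4 * v))" for y
  proof -
    have "f y - f (y + 1/2) = ee y * e (- y)" unfolding eneg by (simp add: ee_minus)
    moreover have "e y = f y + f (y + 1/2)" by (simp add: e_def)
    ultimately have "2 * f y = e y + ee y * e (- y)" by algebra
    thus ?thesis unfolding ec A_neg by (simp add: algebra_simps)
  qed
  \<comment> \<open>The constant is found at y = 1/4 - v/2, where the first theta function on the
    right vanishes.\<close>
  have c_val: "c * (qpoch (2 * v) (4 * v))\<^sup>2 = 2 * qpoch (v + 1/2) (2 * v)"
  proof -
    have "1/2 + 2 * (1/4 - v / 2) + v = 1" "1/2 + 2 * (1/4 - v / 2) + 3 * v = 2 * v + 1" by simp_all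
    hence "2 * f (1/4 - v / 2) = c * (theta0 1 (4 * v) + ee (1/4 - v / 2) * theta0 (2 * v + 1) (4 * v))"
      using two[of "1/4 - v / 2"] by (simp only:)
    moreover have "theta0 1 (4 * v) = 0" using theta0_add_1(1)[of 0 "4 * v"] v4 by simp
    moreover have "theta0 (2 * v + 1) (4 * v) = (qpoch (2 * v) (4 * v))\<^sup>2"
      unfolding theta0_add_1 by (simp add: theta0_def power2_eq_square)
    moreover have "f (1/4 - v / 2) = ee (1/4 - v / 2) * q"
    proof -
      have "f (1/4 - v / 2) = theta0 (3/4 - v / 2) v" by (simp add: f_def)
      also have "\<dots> = - ee (1/4 - v / 2 + 1/2) * q" unfolding q34 by simp
      finally show ?thesis by (simp only: ee_add ee_half) simp
    qed
    moreover have "q = qpoch (v + 1/2) (2 * v)"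
    proof -
      have "v - (v / 2 - 1/4) = (v / 2 - 1/4) + 1/2" by simp
      hence "q = qpoch (2 * (v / 2 - 1/4)) (2 * v)"
        unfolding q_def theta0_def qpoch_double[OF v] by (simp only:)
      also have "2 * (v / 2 - 1/4) = (v + 1/2) - 1" by simp
      finally show ?thesis by (simp only: qpoch_diff_1)
    qed
    ultimately show ?thesis by simp
  qed
  have "qpoch v v * c = 2 * qpoch (4 * v) (4 * v)"
  proof -
    have 1: "qpoch v v = qpoch v (2 * v) * qpoch (2 * v) (2 * v)" using qpoch_dissect[OF v, of v] by simp
    have 2: "qpoch (2 * v) (4 * v) = qpoch v (2 * v) * qpoch (v + 1/2) (2 * v)" using qpoch_double[OF v4(2), of v] by simp
    have 3: "qpoch (2 * v) (2 * v) = qpoch (2 * v) (4 * v) * qpoch (4 * v) (4 * v)" using qpoch_dissect[OF v4(2), of "2 * v"] by simp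
    have nz: "qpoch (2 * v) (4 * v) \<noteq> 0" by (rule qpoch_nonzero; use v in simp)
    have "qpoch v v * c * (qpoch (2 * v) (4 * v))\<^sup>2 = qpoch v (2 * v) * qpoch (2 * v) (2 * v) * (2 * qpoch (v + 1/2) (2 * v))"
      unfolding 1 mult.assoc[of _ c] c_val ..
    also have "\<dots> = 2 * qpoch (4 * v) (4 * v) * (qpoch (2 * v) (4 * v))\<^sup>2"
      unfolding 3 power2_eq_square by (subst (3) 2) (simp add: mult_ac)
    finally show ?thesis using nz by simp
  qed
  hence "2 * (qpoch v v * f y) = 2 * (qpoch (4 * v) (4 * v) * (theta0 (1/2 + 2 * y + v) (4 * v) + ee y * theta0 (1/2 + 2 * y + 3 * v) (4 * v)))"
    using two[of y] by algebra
  thus ?thesis by (simp add: f_def)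
qed

section \<open>Theta prefactors and reduction of the original integrands\<close>

lemma theta_eq: "theta z \<tau> = \<i> * ee (\<tau> / 8 - z / 2) * qpoch \<tau> \<tau> * theta0 z \<tau>"
proof -
  have "of_real pi * \<i> * \<tau> / 4 - of_real pi * \<i> * z = 2 * of_real pi * \<i> * (\<tau> / 8 - z / 2)"
    by (simp add: algebra_simps)
  thus ?thesis by (simp only: theta_def ee_def)
qed

lemma theta_divide_theta:
  assumes "Im \<tau> > 0"
  shows "theta z \<tau> / theta w \<tau> = ee ((w - z) / 2) * (theta0 z \<tau> / theta0 w \<tau>)"
proof -
  have "qpoch \<tau> \<tau> \<noteq> 0" using assms by (intro qpoch_nonzero)
  moreover have "ee (\<tau> / 8 - z / 2) = ee ((w - z) / 2) * ee (\<tau> / 8 - w / 2)"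
    unfolding ee_add[symmetric] by (rule arg_cong[of _ _ ee]) (simp add: field_simps)
  ultimately show ?thesis unfolding theta_eq by simp
qed

lemma deriv_theta_0:
  assumes "Im \<tau> > 0"
  shows "deriv (\<lambda>z. theta z \<tau>) 0 = 2 * of_real pi * ee (\<tau> / 8) * qpoch \<tau> \<tau> ^ 3"
proof -
  define f where "f = (\<lambda>z. \<i> * ee (\<tau> / 8 - z / 2) * qpoch \<tau> \<tau>)"
  have f0: "f 0 = \<i> * ee (\<tau> / 8) * qpoch \<tau> \<tau>" by (simp add: f_def)
  have "f field_differentiable at 0"
    unfolding f_def by (rule holomorphic_on_imp_differentiable_at[of _ UNIV]) (auto intro!: holomorphic_intros)
  then obtain D where "(f has_field_derivative D) (at 0)" by (auto simp: field_differentiable_def)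
  from DERIV_mult[OF this has_field_derivative_theta0_0[OF assms]]
  have "((\<lambda>z. theta z \<tau>) has_field_derivative - 2 * of_real pi * \<i> * (qpoch \<tau> \<tau>)\<^sup>2 * f 0) (at 0)"
    unfolding theta_eq f_def by (simp add: theta0_0[OF assms])
  moreover have "- 2 * of_real pi * \<i> * (qpoch \<tau> \<tau>)\<^sup>2 * f 0 = 2 * of_real pi * ee (\<tau> / 8) * qpoch \<tau> \<tau> ^ 3"
    unfolding f0 using i_squared by algebra
  ultimately show ?thesis by (simp only: DERIV_imp_deriv)
qed

lemma Qfac_eq:
  assumes s: "Im s > 0"
  shows "Qfac (- u) s (- h / 2) =
    - 2 * of_real pi * \<i> * (qpoch s s)\<^sup>2 * theta0 (2 * h) s / (theta0 (h - u) s * theta0 (h + u) s)"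
proof -
  have q: "qpoch s s \<noteq> 0" using s by (intro qpoch_nonzero)
  have 1: "theta (4 * (- h / 2)) s = - \<i> * ee (s / 8 - h) * qpoch s s * theta0 (2 * h) s"
  proof -
    have "theta (4 * (- h / 2)) s = \<i> * ee (s / 8 + h) * qpoch s s * (- ee (- (2 * h)) * theta0 (2 * h) s)"
      unfolding theta0_minus[OF s, symmetric] theta_eq by simp
    moreover have "ee (s / 8 - h) = ee (s / 8 + h) * ee (- (2 * h))"
      unfolding ee_add[symmetric] by (rule arg_cong[of _ _ ee]) simp
    ultimately show ?thesis by simp
  qed
  have 2: "theta (- u - 2 * (- h / 2)) s = \<i> * ee (s / 8 - h / 2 + u / 2) * qpoch s s * theta0 (h - u) s"
    unfolding theta_eq by (simp add: field_simps)
  have 3: "theta (- u + 2 * (- h / 2)) s = - \<i> * ee (s / 8 - h / 2 - u / 2) * qpoch s s * theta0 (h + u) s"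
  proof -
    have e: "- u + 2 * (- h / 2) = - (h + u)" by simp
    have "theta (- u + 2 * (- h / 2)) s = \<i> * ee (s / 8 - (- (h + u)) / 2) * qpoch s s * (- ee (- (h + u)) * theta0 (h + u) s)"
      unfolding theta0_minus[OF s, symmetric] theta_eq e ..
    moreover have "ee (s / 8 - h / 2 - u / 2) = ee (s / 8 - (- (h + u)) / 2) * ee (- (h + u))"
      unfolding ee_add[symmetric] by (rule arg_cong[of _ _ ee]) (simp add: field_simps)
    ultimately show ?thesis by simp
  qed
  have e: "ee (s / 8 - h) * ee (s / 8) = ee (s / 8 - h / 2 + u / 2) * ee (s / 8 - h / 2 - u / 2)"
    unfolding ee_add[symmetric] by (rule arg_cong[of _ _ ee]) simp
  define e1 e2 where "e1 = ee (s / 8 - h / 2 + u / 2)" and "e2 = ee (s / 8 - h / 2 - u / 2)"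
  have nz: "e1 \<noteq> 0" "e2 \<noteq> 0" by (simp_all add: e1_def e2_def)
  have "Qfac (- u) s (- h / 2) = (- \<i> * 2 * of_real pi * (ee (s / 8 - h) * ee (s / 8)) * qpoch s s ^ 4 * theta0 (2 * h) s) /
     (e1 * e2 * (qpoch s s)\<^sup>2 * (theta0 (h - u) s * theta0 (h + u) s))"
    unfolding Qfac_def 1 2 3 deriv_theta_0[OF s] e1_def[symmetric] e2_def[symmetric]
    by (simp add: power2_eq_square power3_eq_cube power4_eq_xxxx mult_ac)
  thus ?thesis unfolding e e1_def[symmetric] e2_def[symmetric] using nz q by (simp add: power2_eq_square power4_eq_xxxx)
qed

lemma theta_product:
  assumes h: "Im h > 0"
  shows "theta (- 3 * h) (4 * h) * theta (- 2 * h) (4 * h) * theta (- h) (4 * h) =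
    \<i> * ee (- 3 * h / 2) * qpoch (4 * h) (4 * h) ^ 3 * (theta0 h (4 * h))\<^sup>2 * theta0 (2 * h) (4 * h)"
proof -
  have h4: "Im (4 * h) > 0" using h by simp
  have t3: "theta0 (3 * h) (4 * h) = theta0 h (4 * h)" using theta0_reflect[of "4 * h" h] by simp
  have m: "- 3 * h = - (3 * h)" "- 2 * h = - (2 * h)" by simp_all
  have e: "ee (4 * h / 8 - - (3 * h) / 2) * ee (4 * h / 8 - - (2 * h) / 2) * ee (4 * h / 8 - - h / 2) *
     ee (- (3 * h)) * ee (- (2 * h)) * ee (- h) = ee (- (3 * h) / 2)"
    unfolding ee_add[symmetric] by (rule arg_cong[of _ _ ee]) simp
  have "theta (- (3 * h)) (4 * h) * theta (- (2 * h)) (4 * h) * theta (- h) (4 * h) =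
    \<i> * (ee (4 * h / 8 - - (3 * h) / 2) * ee (4 * h / 8 - - (2 * h) / 2) * ee (4 * h / 8 - - h / 2) *
     ee (- (3 * h)) * ee (- (2 * h)) * ee (- h)) * qpoch (4 * h) (4 * h) ^ 3 * (theta0 h (4 * h))\<^sup>2 * theta0 (2 * h) (4 * h)"
    unfolding theta_eq theta0_minus[OF h4] t3 by (simp add: power2_eq_square power3_eq_cube mult_ac)
  thus ?thesis unfolding m e .
qed

context beta_setup begin

text \<open>Reflection combined with one shift in each period. Its use is to trade 1 / hG(t + h) and
  the two theta denominators of the integrand for hG(-t - h).\<close>

lemma hG_times_hG_minus:
  assumes "qpoch2 z (4 * h) s \<noteq> 0" "qpoch2 (- z) (4 * h) s \<noteq> 0"
  shows "hG z * hG (- z) * th4 z * (- ee (- z) * ths z) = 1"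
proof -
  let ?q = "\<lambda>z. qpoch2 z (4 * h) s"
  have a: "?q z = qpoch z (4 * h) * (qpoch (s + z) s * ?q (4 * h + s + z))"
    using half.qpoch2_rec'[of z] half.qpoch2_rec[of "z + s"] by (simp add: add_ac)
  have b: "?q (- z) = qpoch (- z) s * (qpoch (4 * h - z) (4 * h) * ?q (4 * h + s - z))"
    using half.qpoch2_rec[of "- z"] half.qpoch2_rec'[of "- z + 4 * h"] by (simp add: algebra_simps)
  have g: "hG z = ?q (4 * h + s - z) / ?q z" "hG (- z) = ?q (4 * h + s + z) / ?q (- z)"
    by (simp_all add: half.ell_Gamma_eq)
  have t: "- ee (- z) * ths z = qpoch (- z) s * qpoch (s + z) s"
    unfolding theta0_minus[OF positive(3), symmetric] by (simp add: theta0_def)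
  have "hG z * hG (- z) * th4 z * (- ee (- z) * ths z) = (?q z * ?q (- z)) / (?q z * ?q (- z))"
    unfolding t g unfolding a b theta0_def by (simp add: mult_ac)
  thus ?thesis using assms by simp
qed

text \<open>Excluding the lattice of 1 and h keeps all denominators nonzero; at some of its points
  the convention x / 0 = 0 would spoil the identity. The excluded set is countable, as
  \<open>contour_integral_cong_countable\<close> allows.\<close>

lemma integrand_factor:
  assumes "\<And>n k :: int. t \<noteq> of_int n + of_int k * h" "s = of_int \<kappa> * h"
  shows "hG (t - h) / hG (t + h) * (A / th4 (t + h)) * (B / ths (t + h)) =
    - ee (- t - h) * hG (t - h) * hG (- t - h) * A * B"
proof -
  have q: "qpoch2 (t + h) (4 * h) s \<noteq> 0"
  proof
    assume "qpoch2 (t + h) (4 * h) s = 0"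
    then obtain i j :: nat and n :: int where "t + h + of_nat i * (4 * h) + of_nat j * s = of_int n"
      unfolding half.qpoch2_eq_0_iff by blast
    hence "t = of_int n + of_int (- 1 - 4 * int i - \<kappa> * int j) * h" by (simp add: assms(2) algebra_simps)
    thus False using assms(1) by blast
  qed
  have q': "qpoch2 (- (t + h)) (4 * h) s \<noteq> 0"
  proof
    assume "qpoch2 (- (t + h)) (4 * h) s = 0"
    then obtain i j :: nat and n :: int where "- (t + h) + of_nat i * (4 * h) + of_nat j * s = of_int n"
      unfolding half.qpoch2_eq_0_iff by blast
    hence "t = of_int (- n) + of_int (- 1 + 4 * int i + \<kappa> * int j) * h" by (simp add: assms(2) algebra_simps)
    thus False using assms(1) by blast
  qed
  have e: "- t - h = - (t + h)" by simp
  note 1 = hG_times_hG_minus[OF q q']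
  hence "hG (t + h) \<noteq> 0" "th4 (t + h) \<noteq> 0" "ths (t + h) \<noteq> 0" by auto
  hence "hG (t - h) / hG (t + h) * (A / th4 (t + h)) * (B / ths (t + h)) =
      (hG (t + h) * hG (- (t + h)) * th4 (t + h) * (- ee (- (t + h)) * ths (t + h))) *
      (hG (t - h) / hG (t + h) * (A / th4 (t + h)) * (B / ths (t + h)))" unfolding 1 by simp
  also have "\<dots> = - ee (- (t + h)) * hG (t - h) * hG (- (t + h)) * A * B"
    using \<open>hG (t + h) \<noteq> 0\<close> \<open>th4 (t + h) \<noteq> 0\<close> \<open>ths (t + h) \<noteq> 0\<close> by simp
  finally show ?thesis unfolding e .
qed

lemma theta_integrand_eq:
  assumes t: "\<And>n k :: int. t \<noteq> of_int n + of_int k * h" and s\<kappa>: "s = of_int \<kappa> * h" and u: "u = of_int m * h"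
  shows "theta_integrand m \<kappa> (- 2 * h) (4 * h) (- h / 2) t =
      - ee (h + u / 2) * (gf t * (ths (t - u) * theta0 (1/2 + 4 * u + 6 * s + 2 * t) (8 * s)))"
    and "theta_integrand m \<kappa> (2 * h) (4 * h) (- h / 2) t =
      ee (h + u / 2) * (gf t * (ee (- t) * ths (t - u) * theta0 (1/2 + 4 * u + 2 * s + 2 * t) (8 * s)))"
proof -
  have e: "t + 2 * (- h / 2) = t - h" "t - 2 * (- h / 2) = t + h" "t + 2 * (- h / 2) * of_int m = t - u"
    "- 2 * (- h / 2) * of_int \<kappa> = s" "2 * of_int \<kappa> * (4 * h) = 8 * s" "t + - 2 * h = t - 2 * h"
    by (simp_all add: s\<kappa> u mult.commute)
  have e1: "1/2 + of_int m * (4 * h) + of_int \<kappa> * (4 * h) - of_int \<kappa> * (- 2 * h) + 2 * t = 1/2 + 4 * u + 6 * s + 2 * t"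
    "1/2 + of_int m * (4 * h) + of_int \<kappa> * (4 * h) - of_int \<kappa> * (2 * h) + 2 * t = 1/2 + 4 * u + 2 * s + 2 * t"
    by (simp_all add: s\<kappa> u)
  note F = integrand_factor[OF t s\<kappa>]
  define E1 E2 where "E1 = ee ((t + h - (t - 2 * h)) / 2)" and "E2 = ee ((t + h - (t - u)) / 2)"
  have k: "E1 * E2 * ee (- t - h) = ee (h + u / 2) * ee (- t)"
    unfolding E1_def E2_def ee_add[symmetric] by (rule arg_cong[of _ _ ee]) (simp add: field_simps)
  have "theta_integrand m \<kappa> (- 2 * h) (4 * h) (- h / 2) t =
     E1 * E2 * (hG (t - h) / hG (t + h) * (th4 (t - 2 * h) / th4 (t + h)) * (ths (t - u) / ths (t + h))) *
       theta0 (1/2 + 4 * u + 6 * s + 2 * t) (8 * s)"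
    unfolding theta_integrand_def e e1 theta_divide_theta[OF positive(1)] theta_divide_theta[OF positive(3)] E1_def E2_def
    by (simp only: mult_ac)
  also have "\<dots> = - (E1 * E2 * ee (- t - h)) * hG (t - h) * hG (- t - h) * th4 (t - 2 * h) * ths (t - u) *
     theta0 (1/2 + 4 * u + 6 * s + 2 * t) (8 * s)"
    unfolding F by (simp only: mult_ac mult_minus_left mult_minus_right)
  also have "\<dots> = - ee (h + u / 2) * (gf t * (ths (t - u) * theta0 (1/2 + 4 * u + 6 * s + 2 * t) (8 * s)))"
    unfolding k gf_def by (simp only: mult_ac mult_minus_left mult_minus_right)
  finally show "theta_integrand m \<kappa> (- 2 * h) (4 * h) (- h / 2) t =
      - ee (h + u / 2) * (gf t * (ths (t - u) * theta0 (1/2 + 4 * u + 6 * s + 2 * t) (8 * s)))" .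
  define E3 where "E3 = ee ((t + h - (t + 2 * h)) / 2)"
  have f: "th4 (t + 2 * h) = - ee (- (t - 2 * h)) * th4 (t - 2 * h)"
    using theta0_shift[OF positive(1), of "t - 2 * h"] by (simp add: add.commute)
  have k': "E3 * E2 * ee (- t - h) * ee (- (t - 2 * h)) = ee (h + u / 2) * ee (- t) * ee (- t)"
    unfolding E3_def E2_def ee_add[symmetric] by (rule arg_cong[of _ _ ee]) (simp add: field_simps)
  have "theta_integrand m \<kappa> (2 * h) (4 * h) (- h / 2) t =
     E3 * E2 * (hG (t - h) / hG (t + h) * (th4 (t + 2 * h) / th4 (t + h)) * (ths (t - u) / ths (t + h))) *
       theta0 (1/2 + 4 * u + 2 * s + 2 * t) (8 * s)"
    unfolding theta_integrand_def e e1 theta_divide_theta[OF positive(1)] theta_divide_theta[OF positive(3)] E3_def E2_def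
    by (simp only: mult_ac)
  also have "\<dots> = (E3 * E2 * ee (- t - h) * ee (- (t - 2 * h))) * hG (t - h) * hG (- t - h) * th4 (t - 2 * h) * ths (t - u) *
     theta0 (1/2 + 4 * u + 2 * s + 2 * t) (8 * s)"
    unfolding F f by (simp only: mult_ac mult_minus_left mult_minus_right minus_minus)
  also have "\<dots> = ee (h + u / 2) * (gf t * (ee (- t) * ths (t - u) * theta0 (1/2 + 4 * u + 2 * s + 2 * t) (8 * s)))"
    unfolding k' gf_def by (simp only: mult_ac)
  finally show "theta_integrand m \<kappa> (2 * h) (4 * h) (- h / 2) t =
      ee (h + u / 2) * (gf t * (ee (- t) * ths (t - u) * theta0 (1/2 + 4 * u + 2 * s + 2 * t) (8 * s)))" .
qed

lemma theta0_pair_eq_bf: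
  "qpoch (8 * s) (8 * s) * (ths (t - u) * theta0 (1/2 + 4 * u + 6 * s + 2 * t) (8 * s) +
      ee (- 2 * u) * (ee (- t) * ths (t - u) * theta0 (1/2 + 4 * u + 2 * s + 2 * t) (8 * s))) =
    qpoch (2 * s) (2 * s) * ee (- 2 * u) * bf u t"
proof -
  have s8: "Im (8 * s) > 0" using positive(3) by simp
  \<comment> \<open>With v = 2s this y turns the first summand of \<open>theta0_dissection\<close>
    into the theta function belonging to \<lambda> = -2h; the second summand is off by the
    quasi-period 8s.\<close>
  define y where "y = 2 * u + 2 * s + t"
  have e: "1/2 + 2 * y + 2 * s = 1/2 + 4 * u + 6 * s + 2 * t"
     "1/2 + 2 * y + 3 * (2 * s) = (1/2 + 4 * u + 2 * s + 2 * t) + 8 * s"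
     "1/2 + y = (1/2 + 2 * u + t) + 2 * s" "4 * (2 * s) = 8 * s"
    by (simp_all add: y_def)
  have eh: "ee (- (1/2 + z)) = - ee (- z)" for z
  proof -
    have "- (1/2 + z) = - z - 1/2" by simp
    thus ?thesis by (simp only: ee_diff ee_half) simp
  qed
  have 1: "theta0 ((1/2 + 4 * u + 2 * s + 2 * t) + 8 * s) (8 * s) = ee (- (4 * u + 2 * s + 2 * t)) * theta0 (1/2 + 4 * u + 2 * s + 2 * t) (8 * s)"
    unfolding theta0_shift[OF s8] using eh[of "4 * u + 2 * s + 2 * t"] by (simp add: add.assoc)
  have 2: "th ((1/2 + 2 * u + t) + 2 * s) = ee (- (2 * u + t)) * th (1/2 + 2 * u + t)"
    unfolding theta0_shift[OF positive(2)] using eh[of "2 * u + t"] by (simp add: add.assoc)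
  have k: "ee y * ee (- (4 * u + 2 * s + 2 * t)) = ee (- 2 * u) * ee (- t)" "ee (- (2 * u + t)) = ee (- 2 * u) * ee (- t)"
    unfolding y_def ee_add[symmetric] by (rule arg_cong[of _ _ ee]; simp)+
  have "qpoch (2 * s) (2 * s) * (ee (- 2 * u) * ee (- t) * th (1/2 + 2 * u + t)) =
    qpoch (8 * s) (8 * s) * (theta0 (1/2 + 4 * u + 6 * s + 2 * t) (8 * s) +
       ee y * (ee (- (4 * u + 2 * s + 2 * t)) * theta0 (1/2 + 4 * u + 2 * s + 2 * t) (8 * s)))"
    using theta0_dissection[OF positive(2), of y] unfolding e 1 2 k .
  thus ?thesis unfolding mult.assoc[symmetric, of "ee y"] k bf_def by algebra
qed

text \<open>\<open>I_tilde\<close> selects its cycle by SOME, so a witness is required before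
  anything can be said about the integral.\<close>

lemma theta_cycle_exists:
  assumes s\<kappa>: "s = of_int \<kappa> * h" and \<kappa>: "\<kappa> \<ge> 4"
  shows "\<exists>g. theta_cycle \<kappa> (4 * h) (- h / 2) g"
proof -
  obtain g where g: "valid_path g" "pathstart g = -1/2" "pathfinish g = 1/2"
    and a: "\<And>(k::int) (n::int). k = -1 \<or> k \<ge> 3 \<Longrightarrow> lies_above (of_int n + of_int k * h) g"
    and b: "\<And>(k::int) (n::int). k = 1 \<or> k \<le> -3 \<Longrightarrow> lies_below (of_int n + of_int k * h) g"
    using separating_cycle_exists[OF h] by metis
  have ge: "4 * int j + \<kappa> * int k = 0 \<or> 4 * int j + \<kappa> * int k \<ge> 4" for j k :: nat
  proof (cases "j = 0")
    case True
    show ?thesis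
    proof (cases "k = 0")
      case False
      have "\<kappa> * 1 \<le> \<kappa> * int k" using False \<kappa> by (intro mult_left_mono) auto
      thus ?thesis using True \<kappa> by linarith
    qed (use True in simp)
  next
    case False
    moreover have "\<kappa> * int k \<ge> 0" using \<kappa> by simp
    ultimately show ?thesis by linarith
  qed
  have "lies_below (- 2 * (- h / 2) - of_nat j * (4 * h) + 2 * of_int \<kappa> * of_nat k * (- h / 2) + of_int n) g"
    "lies_above (2 * (- h / 2) + of_nat j * (4 * h) - 2 * of_int \<kappa> * of_nat k * (- h / 2) + of_int n) g" for j k n
  proof -
    have e: "- 2 * (- h / 2) - of_nat j * (4 * h) + 2 * of_int \<kappa> * of_nat k * (- h / 2) + of_int n =
       of_int n + of_int (1 - (4 * int j + \<kappa> * int k)) * h"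
      "2 * (- h / 2) + of_nat j * (4 * h) - 2 * of_int \<kappa> * of_nat k * (- h / 2) + of_int n =
       of_int n + of_int (- 1 + (4 * int j + \<kappa> * int k)) * h"
      by (simp_all add: algebra_simps)
    show "lies_below (- 2 * (- h / 2) - of_nat j * (4 * h) + 2 * of_int \<kappa> * of_nat k * (- h / 2) + of_int n) g"
      unfolding e by (rule b) (use ge[of j k] in linarith)
    show "lies_above (2 * (- h / 2) + of_nat j * (4 * h) - 2 * of_int \<kappa> * of_nat k * (- h / 2) + of_int n) g"
      unfolding e by (rule a) (use ge[of j k] in linarith)
  qed
  thus ?thesis using g unfolding theta_cycle_def by blast
qed

lemma I_tilde_difference:
  assumes s\<kappa>: "s = of_int \<kappa> * h" and \<kappa>: "\<kappa> \<ge> 4" and u: "u = of_int m * h"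
  shows "I_tilde m \<kappa> (- 2 * h) (4 * h) (- h / 2) - I_tilde m \<kappa> (2 * h) (4 * h) (- h / 2) =
    - ee (h * of_int m ^ 2 / of_int \<kappa>) * ee (h - u / 2) * qpoch (2 * s) (2 * s) * Lf (bf u)"
proof -
  \<comment> \<open>Both integrals use the same selected cycle, since the condition on it does not
    involve \<lambda>.\<close>
  define g where "g = (SOME g. theta_cycle \<kappa> (4 * h) (- h / 2) g)"
  have cyc: "theta_cycle \<kappa> (4 * h) (- h / 2) g"
    unfolding g_def using theta_cycle_exists[OF s\<kappa> \<kappa>] by (rule someI_ex)
  hence g: "valid_path g" "pathstart g = -1/2" "pathfinish g = 1/2"
    and c: "\<And>(j::nat) (k::nat) (n::int). lies_below (- 2 * (- h / 2) - of_nat j * (4 * h) + 2 * of_int \<kappa> * of_nat k * (- h / 2) + of_int n) g"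
      "\<And>(j::nat) (k::nat) (n::int). lies_above (2 * (- h / 2) + of_nat j * (4 * h) - 2 * of_int \<kappa> * of_nat k * (- h / 2) + of_int n) g"
    unfolding theta_cycle_def by blast+
  have below: "lies_below (h - of_nat j * (4 * h) - of_nat k * s) g" for j k
    using c(1)[of j k 0] by (simp add: s\<kappa> mult_ac)
  have above: "lies_above (- h + of_nat j * (4 * h) + of_nat k * s) g" for j k
    using c(2)[of j k 0] by (simp add: s\<kappa> mult_ac)
  define L where "L = {t. \<exists>n k :: int. t = of_int n + of_int k * h}"
  have "L = (\<lambda>(n, k). of_int n + of_int k * h) ` (UNIV :: (int \<times> int) set)" by (auto simp: L_def)
  hence cL: "countable L" by simp
  define \<phi>1 \<phi>2 where "\<phi>1 = (\<lambda>t. ths (t - u) * theta0 (1/2 + 4 * u + 6 * s + 2 * t) (8 * s))"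
    and "\<phi>2 = (\<lambda>t. ee (- t) * ths (t - u) * theta0 (1/2 + 4 * u + 2 * s + 2 * t) (8 * s))"
  have s8: "Im (8 * s) > 0" using positive(3) by simp
  have hol: "\<phi>1 holomorphic_on UNIV" "\<phi>2 holomorphic_on UNIV"
    unfolding \<phi>1_def \<phi>2_def by (intro holomorphic_intros holomorphic_theta0 positive s8)+
  have per: "\<phi>1 (t + 1) = \<phi>1 t" "\<phi>2 (t + 1) = \<phi>2 t" for t
  proof -
    have e: "t + 1 - u = (t - u) + 1" "c + 2 * (t + 1) = (c + 2 * t) + 1 + 1" "- (t + 1) = - t - 1" for c by simp_all
    show "\<phi>1 (t + 1) = \<phi>1 t" "\<phi>2 (t + 1) = \<phi>2 t"
      unfolding \<phi>1_def \<phi>2_def e by (simp_all only: theta0_add_1 ee_diff ee_1 div_by_1)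
  qed
  note ci1 = cycle_integral_gf[of \<kappa> g \<phi>1, OF s\<kappa> \<kappa> g below above hol(1) per(1)]
  note ci2 = cycle_integral_gf[of \<kappa> g \<phi>2, OF s\<kappa> \<kappa> g below above hol(2) per(2)]
  have "contour_integral g (theta_integrand m \<kappa> (- 2 * h) (4 * h) (- h / 2)) =
     contour_integral g (\<lambda>t. - ee (h + u / 2) * (gf t * \<phi>1 t))"
    by (rule contour_integral_cong_countable[OF g(1) cL])
       (unfold \<phi>1_def, rule theta_integrand_eq(1)[OF _ s\<kappa> u], auto simp: L_def)
  also have "\<dots> = - ee (h + u / 2) * Lf \<phi>1" unfolding ci1(1)[symmetric] by (rule contour_integral_lmul[OF ci1(2)])
  finally have 1: "contour_integral g (theta_integrand m \<kappa> (- 2 * h) (4 * h) (- h / 2)) = - ee (h + u / 2) * Lf \<phi>1" .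
  have "contour_integral g (theta_integrand m \<kappa> (2 * h) (4 * h) (- h / 2)) =
     contour_integral g (\<lambda>t. ee (h + u / 2) * (gf t * \<phi>2 t))"
    by (rule contour_integral_cong_countable[OF g(1) cL])
       (unfold \<phi>2_def, rule theta_integrand_eq(2)[OF _ s\<kappa> u], auto simp: L_def)
  also have "\<dots> = ee (h + u / 2) * Lf \<phi>2" unfolding ci2(1)[symmetric] by (rule contour_integral_lmul[OF ci2(2)])
  finally have 2: "contour_integral g (theta_integrand m \<kappa> (2 * h) (4 * h) (- h / 2)) = ee (h + u / 2) * Lf \<phi>2" .
  define E where "E = ee (h * of_int m ^ 2 / of_int \<kappa>)"
  have p1: "exp (of_real pi * \<i> * (4 * h) * (of_int m ^ 2 / (2 * of_int \<kappa>)) - of_real pi * \<i> * (- 2 * h) * of_int m) = E * ee u"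
    unfolding E_def u ee_add[symmetric] unfolding ee_def by (rule arg_cong[of _ _ exp]) (simp add: algebra_simps)
  have p2: "exp (of_real pi * \<i> * (4 * h) * (of_int m ^ 2 / (2 * of_int \<kappa>)) - of_real pi * \<i> * (2 * h) * of_int m) = E * ee u * ee (- 2 * u)"
    unfolding E_def u ee_add[symmetric] unfolding ee_def by (rule arg_cong[of _ _ exp]) (simp add: algebra_simps)
  have e8: "2 * of_int \<kappa> * (4 * h) = 8 * s" by (simp add: s\<kappa>)
  have cont: "continuous_on UNIV \<phi>1" "continuous_on UNIV \<phi>2" using hol holomorphic_on_imp_continuous_on by blast+
  \<comment> \<open>The summand with coefficient 0 brings the argument into the form of
    \<open>Lf_linear\<close>.\<close>
  have "qpoch (8 * s) (8 * s) * Lf (\<lambda>t. 1 * \<phi>1 t + ee (- 2 * u) * \<phi>2 t) =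
     Lf (\<lambda>t. 0 * \<phi>1 t + qpoch (8 * s) (8 * s) * (1 * \<phi>1 t + ee (- 2 * u) * \<phi>2 t))"
    by (subst Lf_linear[OF cont(1)]) (auto intro!: continuous_intros cont)
  also have "(\<lambda>t. 0 * \<phi>1 t + qpoch (8 * s) (8 * s) * (1 * \<phi>1 t + ee (- 2 * u) * \<phi>2 t)) =
     (\<lambda>t. 0 * \<phi>1 t + (qpoch (2 * s) (2 * s) * ee (- 2 * u)) * bf u t)"
    using theta0_pair_eq_bf unfolding \<phi>1_def \<phi>2_def by simp
  also have "Lf \<dots> = qpoch (2 * s) (2 * s) * ee (- 2 * u) * Lf (bf u)"
    by (subst Lf_linear[OF cont(1) continuous_bf(1)]) simp
  also have "Lf (\<lambda>t. 1 * \<phi>1 t + ee (- 2 * u) * \<phi>2 t) = Lf \<phi>1 + ee (- 2 * u) * Lf \<phi>2"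
    by (subst Lf_linear[OF cont]) simp
  finally have L: "qpoch (8 * s) (8 * s) * (Lf \<phi>1 + ee (- 2 * u) * Lf \<phi>2) = qpoch (2 * s) (2 * s) * ee (- 2 * u) * Lf (bf u)" .
  have k: "ee (h - u / 2) = ee u * ee (h + u / 2) * ee (- 2 * u)"
    unfolding ee_add[symmetric] by (rule arg_cong[of _ _ ee]) (simp add: field_simps)
  have "I_tilde m \<kappa> (- 2 * h) (4 * h) (- h / 2) - I_tilde m \<kappa> (2 * h) (4 * h) (- h / 2) =
     - E * ee u * ee (h + u / 2) * (qpoch (8 * s) (8 * s) * (Lf \<phi>1 + ee (- 2 * u) * Lf \<phi>2))"
    unfolding I_tilde_def g_def[symmetric] 1 2 p1 p2 e8 by algebra
  also have "\<dots> = - E * ee (h - u / 2) * qpoch (2 * s) (2 * s) * Lf (bf u)" unfolding L k by algebra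
  finally show ?thesis unfolding E_def .
qed

end

section \<open>Cancellation of the prefactors\<close>

theorem theorem3p6:
  fixes \<kappa> \<mu> :: int and \<eta> :: complex
  assumes "\<kappa> \<ge> 4"
    and "\<not> [\<mu> + 2 = 1] (mod \<kappa>)"
    and "\<not> [\<mu> + 2 = -1] (mod \<kappa>)"
    and "Im \<eta> < 0"
  shows "ell_Macdonald \<mu> \<kappa> (4 * \<eta>) (- 8 * \<eta>) \<eta> =
    - 2 * of_real pi *
    exp (- 12 * of_real pi * \<i> * \<eta> - 2 * of_real pi * \<i> * of_int (\<mu> + 2) * \<eta>) *
    (ell_Gamma (- 6 * \<eta>) (- 2 * of_int \<kappa> * \<eta>) (- 8 * \<eta>) /
     ell_Gamma (- 2 * \<eta>) (- 2 * of_int \<kappa> * \<eta>) (- 8 * \<eta>)) *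
    (theta0 (2 * of_int (\<mu> + 2) * \<eta>) (- 2 * of_int \<kappa> * \<eta>) *
     qpoch (- 2 * of_int \<kappa> * \<eta>) (- 2 * of_int \<kappa> * \<eta>) ^ 2 /
     (qpoch (- 8 * \<eta>) (- 8 * \<eta>) * qpoch (- 4 * \<eta>) (- 4 * \<eta>) ^ 2 * qpoch (- 2 * \<eta>) (- 2 * \<eta>)))"
proof -
  define h s u :: complex and m where "h = - 2 * \<eta>" and "s = of_int \<kappa> * h" and "u = of_int m * h" and "m = \<mu> + 2"
  have h0: "Im h > 0" using assms(4) by (simp add: h_def)
  interpret beta_setup h s
  proof
    have "4 * Im h \<le> of_int \<kappa> * Im h" using h0 assms(1) by (intro mult_right_mono) auto
    thus "Im s \<ge> 4 * Im h" by (simp add: s_def)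
  qed (rule h0)
  \<comment> \<open>The two congruence conditions on m = \<mu> + 2 enter here: with u = m h, the
    theta functions in the denominator of \<open>Qfac\<close> vanish precisely when \<kappa> divides
    1 - m or 1 + m.\<close>
  have nz: "ths (h - u) \<noteq> 0" "ths (h + u) \<noteq> 0"
  proof -
    have *: "ths (of_int j * h) \<noteq> 0" if j: "\<not> \<kappa> dvd j" for j :: int
    proof
      assume "ths (of_int j * h) = 0"
      then obtain n k :: int where nk: "of_int j * h = of_int n + of_int k * s"
        using theta0_eq_0_iff[OF positive(3)] by blast
      have "Im (of_int j * h) = Im (of_int (k * \<kappa>) * h)" unfolding nk by (simp add: s_def)
      hence "(of_int j :: real) = of_int (k * \<kappa>)" using h0 by simp
      hence "j = k * \<kappa>" by (simp only: of_int_eq_iff)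
      thus False using j by simp
    qed
    have e: "h - u = of_int (1 - m) * h" "h + u = of_int (1 + m) * h" by (simp_all add: u_def algebra_simps)
    have "\<not> \<kappa> dvd 1 - m" using assms(2) unfolding m_def cong_iff_dvd_diff by (metis dvd_diff_commute)
    moreover have "\<not> \<kappa> dvd 1 + m" using assms(3) unfolding m_def cong_iff_dvd_diff by (simp add: add.commute)
    ultimately show "ths (h - u) \<noteq> 0" "ths (h + u) \<noteq> 0" unfolding e by (simp_all only: * not_False_eq_True)
  qed
  define R where "R = hG (3 * h) / hG h / ((qpoch (2 * h) (2 * h))\<^sup>2 * qpoch h h)"
  define j where "j = J (4 * h + 1/2) (s - h)"
  define D where "D = (ths (h + 1/2))\<^sup>2 * ths (1/2)"
  have cf: "- ee (- h) * ths (2 * h) * qpoch (2 * s) (2 * s) * j /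
     (D * (qpoch (4 * h) (4 * h))\<^sup>2 * (th4 h)\<^sup>2 * th4 (2 * h)) = R"
    unfolding R_def D_def j_def using J_closed_form .
  have \<eta>: "\<eta> = - h / 2" by (simp add: h_def)
  define E where "E = ee (- h * of_int m ^ 2 / (2 * of_int \<kappa>))"
  \<comment> \<open>The exponentials quadratic in m cancel: one from the normalisation of the
    polynomial, one from \<open>Delta_tilde\<close> and one from \<open>I_tilde\<close>.\<close>
  have E2: "E * E * ee (h * of_int m ^ 2 / of_int \<kappa>) = 1"
    unfolding E_def ee_add[symmetric] by (simp add: field_simps)
  have a: "4 * (- h / 2) = - 2 * h" "- 8 * (- h / 2) = 4 * h" "- (- 2 * h) = 2 * h" "2 * (- h / 2) * of_int m = - u"
     "- 2 * (- h / 2) * of_int \<kappa> = s" "- 2 * h - 2 * (- h / 2) = - h" "- 2 * h + 2 * (- h / 2) = - 3 * h"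
     "- 6 * (- h / 2) = 3 * h" "- 2 * of_int \<kappa> * (- h / 2) = s" "2 * of_int m * (- h / 2) = - u"
     "- 4 * (- h / 2) = 2 * h"
    by (simp_all add: u_def s_def)
  have a': "- 2 * (- h / 2) = h" by simp
  have x1: "exp (2 * of_real pi * \<i> * (- h / 2) / of_int \<kappa> * of_int m ^ 2) = E"
    unfolding E_def ee_def by (rule arg_cong[of _ _ exp]) (simp add: field_simps)
  have x2: "exp (- of_real pi * \<i> * ((- 2 * h + 4 * h) / (2 * of_int \<kappa>)) * of_int m ^ 2 + 3 * of_real pi * \<i> * (4 * h) / 4) = E * ee (3 * h / 2)"
    unfolding E_def ee_add[symmetric] unfolding ee_def by (rule arg_cong[of _ _ exp]) (simp add: field_simps)
  have x3: "exp (- 12 * of_real pi * \<i> * (- h / 2) - 2 * of_real pi * \<i> * of_int m * (- h / 2)) = ee (3 * h + u / 2)"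
    unfolding u_def ee_def by (rule arg_cong[of _ _ exp]) (simp add: field_simps)
  have Dl: "Delta m \<kappa> (- 2 * h) (4 * h) (- h / 2) = E * Qfac (- u) s (- h / 2) *
      (I_tilde m \<kappa> (- 2 * h) (4 * h) (- h / 2) - I_tilde m \<kappa> (2 * h) (4 * h) (- h / 2))"
    unfolding Delta_def Delta_tilde_def a x1 by (simp only: right_diff_distrib)
  have th: "theta (- h) (4 * h) * theta (- 2 * h) (4 * h) * theta (- 3 * h) (4 * h) =
    \<i> * ee (- 3 * h / 2) * qpoch (4 * h) (4 * h) ^ 3 * (th4 h)\<^sup>2 * th4 (2 * h)"
    unfolding theta_product[OF h0, symmetric] by (simp only: mult_ac)
  have e1: "ee (3 * h / 2) = ee (3 * h) * ee (- 3 * h / 2)"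
    unfolding ee_add[symmetric] by (rule arg_cong[of _ _ ee]) (simp add: field_simps)
  have e2: "ee (3 * h) * ee (h - u / 2) * ee (- 2 * h) = ee (3 * h - u / 2) * ee (- h)"
    unfolding ee_add[symmetric] by (rule arg_cong[of _ _ ee]) (simp add: field_simps)
  have e3: "ee (3 * h - u / 2) = ee (3 * h + u / 2) * ee (- u)"
    unfolding ee_add[symmetric] by (rule arg_cong[of _ _ ee]) (simp add: field_simps)
  define K where "K = (qpoch s s)\<^sup>2 * ths (2 * h) * qpoch (2 * s) (2 * s) * ths u * j"
  define p where "p = qpoch (4 * h) (4 * h)"
  define H where "H = (th4 h)\<^sup>2 * th4 (2 * h)"
  have main: "ell_Macdonald \<mu> \<kappa> (4 * \<eta>) (- 8 * \<eta>) \<eta> =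
     - 2 * of_real pi * ee (3 * h - u / 2) * ee (- h) * K / (D * p ^ 3 * H)"
  proof -
    \<comment> \<open>The denominators of \<open>Qfac\<close> cancel the factors of
      \<open>Lf (bf u)\<close> that vanish at u = h and u = -h, so that only \<open>ths u\<close>
      and an exponential depend on u afterwards.\<close>
    define Y where "Y = ths (h - u) * ths (h + u)"
    have Y0: "Y \<noteq> 0" using nz by (simp add: Y_def)
    have Lf: "Lf (bf u) = - ee (- 2 * h) * (ths u * Y / D) * j"
      unfolding Lf_bf D_def j_def Y_def by (simp only: mult_ac)
    have Q: "Qfac (- u) s (- h / 2) = - 2 * of_real pi * \<i> * (qpoch s s)\<^sup>2 * ths (2 * h) / Y"
      unfolding Y_def by (rule Qfac_eq[OF positive(3)])
    have "ell_Macdonald \<mu> \<kappa> (4 * \<eta>) (- 8 * \<eta>) \<eta> = E * ee (3 * h / 2) *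
        (E * Qfac (- u) s (- h / 2) * (- ee (h * of_int m ^ 2 / of_int \<kappa>) * ee (h - u / 2) * qpoch (2 * s) (2 * s) * Lf (bf u)) /
        (\<i> * ee (- 3 * h / 2) * p ^ 3 * (th4 h)\<^sup>2 * th4 (2 * h)))"
      unfolding ell_Macdonald_def m_def[symmetric] \<eta> a x2 Dl I_tilde_difference[OF s_def assms(1) u_def] th p_def ..
    also have "\<dots> = - (E * E * ee (h * of_int m ^ 2 / of_int \<kappa>)) * (ee (3 * h) * ee (h - u / 2) * ee (- 2 * h)) *
        (2 * of_real pi * K) * (\<i> / \<i>) * (Y / Y) * (ee (- 3 * h / 2) / ee (- 3 * h / 2)) / (D * p ^ 3 * H)"
      unfolding Lf Q e1 K_def H_def using Y0 by (simp add: mult_ac)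
    also have "\<dots> = - 2 * of_real pi * ee (3 * h - u / 2) * ee (- h) * K / (D * p ^ 3 * H)"
      unfolding E2 e2 using Y0 by simp
    finally show ?thesis .
  qed
  have p0: "p \<noteq> 0" unfolding p_def by (rule qpoch_nonzero; use h0 in simp)
  \<comment> \<open>The argument 2 (\<mu> + 2) \<eta> of the theorem is -u, which accounts for the
    sign of the result.\<close>
  have m1: "theta0 (- u) s = - ee (- u) * ths u" by (rule theta0_minus[OF positive(3)])
  have "- 2 * of_real pi * ee (3 * h - u / 2) * ee (- h) * K / (D * p ^ 3 * H) =
     2 * of_real pi * ee (3 * h - u / 2) * (qpoch s s)\<^sup>2 * ths u / p *
       (- ee (- h) * ths (2 * h) * qpoch (2 * s) (2 * s) * j / (D * p\<^sup>2 * (th4 h)\<^sup>2 * th4 (2 * h)))"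
    unfolding K_def H_def by (simp add: power2_eq_square power3_eq_cube mult_ac)
  also have "\<dots> = 2 * of_real pi * ee (3 * h - u / 2) * (qpoch s s)\<^sup>2 * ths u / p * R"
    unfolding cf[folded p_def] ..
  also have "\<dots> = - 2 * of_real pi * ee (3 * h + u / 2) * (hG (3 * h) / hG h) *
     (theta0 (- u) s * qpoch s s ^ 2 / (p * (qpoch (2 * h) (2 * h))\<^sup>2 * qpoch h h))"
    unfolding R_def m1 e3 by (simp add: mult_ac)
  also have "\<dots> = - 2 * of_real pi * ee (3 * h + u / 2) * (ell_Gamma (3 * h) s (4 * h) / ell_Gamma h s (4 * h)) *
     (theta0 (- u) s * qpoch s s ^ 2 / (p * (qpoch (2 * h) (2 * h))\<^sup>2 * qpoch h h))"
    by (simp only: half.ell_Gamma_commute)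
  finally show ?thesis
    unfolding main m_def[symmetric] unfolding \<eta> a unfolding a' x3 p_def .
qed

end
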